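(* Let $h: \mathbb{Z}^2 \rightarrow \mathbb{C}$ be the symbol of triangular truncation, given by $h(i,j) = 1$ if $i-j\geq 0$ and $h(i,j)=0$ otherwise. Then for every $1 < p < \infty$ we have $\Vert h \Vert_{\mathcal{M}_p} = \Vert h \Vert_{\mathcal{M}^{cb}_p}$.
   Context: Let $H=\ell_2(\mathbb{Z})$ with its standard orthonormal basis $(f_j)_{j\in\mathbb{Z}}$; operators $x$ on $H$ are identified with matrices $(x_{i,j})_{i,j\in\mathbb{Z}}$. For $1\le p<\infty$, $\mathcal{S}_p=\mathcal{S}_p(H)$ is the Schatten class of operators $x\in\mathcal{B}(H)$ with $\|x\|_p:=\mathrm{Tr}(|x|^p)^{1/p}<\infty$. Write $\mathcal{S}_p^s=\mathcal{S}_p(\mathbb{C}^s)$, and let $\mathcal{S}_p^s\otimes\mathcal{S}_p$ denote the $L_p$-tensor product, i.e. the $p$-norm closure of the algebraic tensor product inside $\mathcal{S}_p(\mathbb{C}^s\otimes H)$. A symbol $m:\mathbb{Z}\times\mathbb{Z}\to\mathbb{C}$ is an $L_p$-Schur multiplier if the map $(x_{i,j})_{i,j}\mapsto (m(i,j)x_{i,j})_{i,j}$ on finitely supported matrices extends to a bounded linear map $M_m:\mathcal{S}_p\to\mathcal{S}_p$. The set of all such symbols is $\mathcal{M}_p$, with norm $\|m\|_{\mathcal{M}_p}=\|M_m\|_{\mathcal{B}(\mathcal{S}_p)}$. The completely bounded norm is $\|m\|_{\mathcal{M}_p^{cb}}:=\sup_{s\in\mathbb{N}_{\ge1}}\|\mathrm{id}_s\otimes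 M_m:\mathcal{S}_p^s\otimes\mathcal{S}_p\to\mathcal{S}_p^s\otimes\mathcal{S}_p\|$. It is a known fact that $\|h\|_{\mathcal{M}_p}<\infty$ for every $1<p<\infty$. *)

theory Defs
  imports "HOL-Analysis.Analysis" "HOL-Computational_Algebra.Polynomial"
begin

text \<open>
  Operators on \<open>\<ell>\<^sub>2(I)\<close> are represented by their matrices with respect to the standard basis.
  The index set \<open>I\<close> is an explicit carrier, so that \<open>\<complex>\<^sup>s\<close> (with \<open>I = {..<s}\<close>) and
  \<open>\<complex>\<^sup>s \<otimes> \<ell>\<^sub>2(\<int>)\<close> (with \<open>I = {..<s} \<times> UNIV\<close>) are available for variable \<open>s\<close>.
  Vectors and matrices are required to vanish outside the carrier, which makes equality of
  functions coincide with equality of operators.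
\<close>

type_synonym 'i cmat = "'i \<Rightarrow> 'i \<Rightarrow> complex"

definition ell2 :: "'i set \<Rightarrow> ('i \<Rightarrow> complex) set" where
  "ell2 I = {v. (\<forall>i. i \<notin> I \<longrightarrow> v i = 0) \<and> (\<lambda>i. (cmod (v i))\<^sup>2) summable_on I}"

definition ell2_norm :: "'i set \<Rightarrow> ('i \<Rightarrow> complex) \<Rightarrow> real" where
  "ell2_norm I v = sqrt (\<Sum>\<^sub>\<infinity>i\<in>I. (cmod (v i))\<^sup>2)"

definition mat_vec :: "'i set \<Rightarrow> 'i cmat \<Rightarrow> ('i \<Rightarrow> complex) \<Rightarrow> 'i \<Rightarrow> complex" where
  "mat_vec I x v = (\<lambda>i. \<Sum>\<^sub>\<infinity>j\<in>I. x i j * v j)"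

text \<open>
  Divergent sums evaluate to \<open>0\<close> in \<^const>\<open>mat_vec\<close>; this is harmless, because the bound
  on finitely supported vectors already forces the rows of \<open>x\<close> to be square summable.
\<close>

definition bounded_op :: "'i set \<Rightarrow> 'i cmat \<Rightarrow> bool" where
  "bounded_op I x \<longleftrightarrow>
     (\<forall>i j. i \<notin> I \<or> j \<notin> I \<longrightarrow> x i j = 0) \<and>
     (\<exists>C. \<forall>v\<in>ell2 I. mat_vec I x v \<in> ell2 I \<and> ell2_norm I (mat_vec I x v) \<le> C * ell2_norm I v)"

definition op_norm :: "'i set \<Rightarrow> 'i cmat \<Rightarrow> real" where
  "op_norm I x = (SUP v\<in>{v \<in> ell2 I. ell2_norm I v \<le> 1}. ell2_norm I (mat_vec I x v))"

definition mat_add :: "'i cmat \<Rightarrow> 'i cmat \<Rightarrow> 'i cmat" where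
  "mat_add x y = (\<lambda>i j. x i j + y i j)"

definition mat_diff :: "'i cmat \<Rightarrow> 'i cmat \<Rightarrow> 'i cmat" where
  "mat_diff x y = (\<lambda>i j. x i j - y i j)"

definition mat_scale :: "complex \<Rightarrow> 'i cmat \<Rightarrow> 'i cmat" where
  "mat_scale c x = (\<lambda>i j. c * x i j)"

definition mat_adj :: "'i cmat \<Rightarrow> 'i cmat" where
  "mat_adj x = (\<lambda>i j. cnj (x j i))"

definition mat_mul :: "'i set \<Rightarrow> 'i cmat \<Rightarrow> 'i cmat \<Rightarrow> 'i cmat" where
  "mat_mul I x y = (\<lambda>i j. \<Sum>\<^sub>\<infinity>k\<in>I. x i k * y k j)"

definition mat_one :: "'i set \<Rightarrow> 'i cmat" where
  "mat_one I = (\<lambda>i j. if i = j \<and> i \<in> I then 1 else 0)"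

primrec mat_pow :: "'i set \<Rightarrow> 'i cmat \<Rightarrow> nat \<Rightarrow> 'i cmat" where
  "mat_pow I a 0 = mat_one I"
| "mat_pow I a (Suc n) = mat_mul I a (mat_pow I a n)"

definition mat_poly :: "'i set \<Rightarrow> real poly \<Rightarrow> 'i cmat \<Rightarrow> 'i cmat" where
  "mat_poly I q a = (\<lambda>i j. \<Sum>k\<le>degree q. complex_of_real (coeff q k) * mat_pow I a k i j)"

text \<open>
  Continuous functional calculus \<open>f(a)\<close> for a positive bounded operator \<open>a\<close>, whose spectrum is
  contained in \<open>{0..\<parallel>a\<parallel>}\<close>, and \<open>f\<close> continuous on that interval: the operator-norm limit of
  \<open>q\<^sub>n(a)\<close> for every sequence of polynomials \<open>q\<^sub>n\<close> converging uniformly to \<open>f\<close> there.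
  Such sequences exist by the Weierstrass theorem, so the limit is unique.
\<close>

definition fun_calc :: "'i set \<Rightarrow> (real \<Rightarrow> real) \<Rightarrow> 'i cmat \<Rightarrow> 'i cmat" where
  "fun_calc I f a = (THE b. bounded_op I b \<and>
     (\<forall>q :: nat \<Rightarrow> real poly.
        uniform_limit {0..op_norm I a} (\<lambda>n. poly (q n)) f sequentially \<longrightarrow>
        (\<lambda>n. op_norm I (mat_diff (mat_poly I (q n) a) b)) \<longlonglongrightarrow> 0))"

definition abs_op :: "'i set \<Rightarrow> 'i cmat \<Rightarrow> 'i cmat" where
  "abs_op I x = fun_calc I sqrt (mat_mul I (mat_adj x) x)"

definition abs_op_powr :: "'i set \<Rightarrow> 'i cmat \<Rightarrow> real \<Rightarrow> 'i cmat" where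
  "abs_op_powr I x p = fun_calc I (\<lambda>t. t powr p) (abs_op I x)"

definition mat_trace :: "'i set \<Rightarrow> 'i cmat \<Rightarrow> complex" where
  "mat_trace I x = (\<Sum>\<^sub>\<infinity>i\<in>I. x i i)"

text \<open>
  The diagonal of \<open>|x|\<^sup>p\<close> is nonnegative, so its summability says that \<open>Tr(|x|\<^sup>p) < \<infinity>\<close>.
\<close>

definition schatten :: "'i set \<Rightarrow> real \<Rightarrow> 'i cmat set" where
  "schatten I p = {x. bounded_op I x \<and> (\<lambda>i. abs_op_powr I x p i i) summable_on I}"

definition schatten_norm :: "'i set \<Rightarrow> real \<Rightarrow> 'i cmat \<Rightarrow> real" where
  "schatten_norm I p x = Re (mat_trace I (abs_op_powr I x p)) powr (1 / p)"

definition bounded_linear_map_on ::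
  "'i cmat set \<Rightarrow> ('i cmat \<Rightarrow> real) \<Rightarrow> ('i cmat \<Rightarrow> 'i cmat) \<Rightarrow> bool" where
  "bounded_linear_map_on X N T \<longleftrightarrow>
     (\<forall>x\<in>X. T x \<in> X) \<and>
     (\<forall>x\<in>X. \<forall>y\<in>X. T (mat_add x y) = mat_add (T x) (T y)) \<and>
     (\<forall>c. \<forall>x\<in>X. T (mat_scale c x) = mat_scale c (T x)) \<and>
     (\<exists>C. \<forall>x\<in>X. N (T x) \<le> C * N x)"

definition map_norm_on ::
  "'i cmat set \<Rightarrow> ('i cmat \<Rightarrow> real) \<Rightarrow> ('i cmat \<Rightarrow> 'i cmat) \<Rightarrow> ennreal" where
  "map_norm_on X N T = (SUP x\<in>{x \<in> X. N x \<le> 1}. ennreal (N (T x)))"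

definition schur_mul :: "'i cmat \<Rightarrow> 'i cmat \<Rightarrow> 'i cmat" where
  "schur_mul m x = (\<lambda>i j. m i j * x i j)"

definition finitely_supported :: "'i cmat \<Rightarrow> bool" where
  "finitely_supported x \<longleftrightarrow> finite {(i, j). x i j \<noteq> 0}"

definition schur_extension ::
  "real \<Rightarrow> (int \<Rightarrow> int \<Rightarrow> complex) \<Rightarrow> (int cmat \<Rightarrow> int cmat) \<Rightarrow> bool" where
  "schur_extension p m T \<longleftrightarrow>
     bounded_linear_map_on (schatten UNIV p) (schatten_norm UNIV p) T \<and>
     (\<forall>x. finitely_supported x \<longrightarrow> T x = schur_mul m x)"

definition schur_multipliers :: "real \<Rightarrow> (int \<Rightarrow> int \<Rightarrow> complex) set" where
  "schur_multipliers p = {m. \<exists>T. schur_extension p m T}"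

text \<open>
  Finitely supported matrices are dense in \<open>S\<^sub>p\<close>, hence the extension is uniquely determined
  on \<open>S\<^sub>p\<close>; its values elsewhere are irrelevant.
\<close>

definition schur_map :: "real \<Rightarrow> (int \<Rightarrow> int \<Rightarrow> complex) \<Rightarrow> int cmat \<Rightarrow> int cmat" where
  "schur_map p m = (SOME T. schur_extension p m T)"

definition schur_norm :: "real \<Rightarrow> (int \<Rightarrow> int \<Rightarrow> complex) \<Rightarrow> ennreal" where
  "schur_norm p m =
     (if m \<in> schur_multipliers p
      then map_norm_on (schatten UNIV p) (schatten_norm UNIV p) (schur_map p m)
      else \<infinity>)"

definition mat_tensor :: "'k cmat \<Rightarrow> 'i cmat \<Rightarrow> ('k \<times> 'i) cmat" where
  "mat_tensor a y = (\<lambda>(k, i) (l, j). a k l * y i j)"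

definition alg_tensor :: "'k cmat set \<Rightarrow> 'i cmat set \<Rightarrow> ('k \<times> 'i) cmat set" where
  "alg_tensor A Y =
     {\<lambda>u v. \<Sum>r<n. mat_tensor (a r) (y r) u v | n a y. \<forall>r<(n::nat). a r \<in> A \<and> y r \<in> Y}"

abbreviation amp_index :: "nat \<Rightarrow> (nat \<times> int) set" where
  "amp_index s \<equiv> {..<s} \<times> UNIV"

definition schatten_tensor :: "nat \<Rightarrow> real \<Rightarrow> (nat \<times> int) cmat set" where
  "schatten_tensor s p =
     {x \<in> schatten (amp_index s) p.
        \<forall>e>0. \<exists>z\<in>alg_tensor (schatten {..<s} p) (schatten UNIV p).
          mat_diff x z \<in> schatten (amp_index s) p \<and>
          schatten_norm (amp_index s) p (mat_diff x z) < e}"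

text \<open>
  The map \<open>id\<^sub>s \<otimes> T\<close>: the bounded linear map determined by \<open>a \<otimes> y \<mapsto> a \<otimes> T y\<close> on elementary
  tensors. It exists for every bounded linear \<open>T\<close> on \<open>S\<^sub>p\<close>, since \<open>s\<close> is finite, and is unique
  on \<^const>\<open>schatten_tensor\<close>, where elementary tensors have dense span.
\<close>

definition amplification ::
  "nat \<Rightarrow> real \<Rightarrow> (int cmat \<Rightarrow> int cmat) \<Rightarrow> (nat \<times> int) cmat \<Rightarrow> (nat \<times> int) cmat" where
  "amplification s p T = (SOME W.
     bounded_linear_map_on (schatten_tensor s p) (schatten_norm (amp_index s) p) W \<and>
     (\<forall>a\<in>schatten {..<s} p. \<forall>y\<in>schatten UNIV p. W (mat_tensor a y) = mat_tensor a (T y)))"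

definition schur_cb_norm :: "real \<Rightarrow> (int \<Rightarrow> int \<Rightarrow> complex) \<Rightarrow> ennreal" where
  "schur_cb_norm p m =
     (if m \<in> schur_multipliers p
      then (SUP s\<in>{1..}. map_norm_on (schatten_tensor s p) (schatten_norm (amp_index s) p)
                            (amplification s p (schur_map p m)))
      else \<infinity>)"

end

theory Submission
  imports Defs "HOL-Computational_Algebra.Fundamental_Theorem_Algebra"
begin

text \<open>
  Let \<open>h\<close> be the symbol of triangular truncation and \<open>s\<close> a size of the amplification. Put the row
  \<open>(k, i)\<close> of a matrix over \<open>{..<s} \<times> \<int>\<close> at the place \<open>2 s i + s + k\<close> of \<open>\<int>\<close>, and its column \<open>(l, j)\<close> at
  the place \<open>2 s j + l\<close>. Since \<open>0 < s + k - l < 2 s\<close>, the row lies on or below the column exactly when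
  \<open>j \<le> i\<close>. So the map \<open>x \<mapsto> V x W\<^sup>*\<close> with the two isometries of these placements turns \<open>id\<^sub>s \<otimes> M\<^sub>h\<close> into
  \<open>M\<^sub>h\<close>, and it preserves Schatten norms because \<open>|V x W\<^sup>*| = W |x| W\<^sup>*\<close>. Hence no amplification has a
  larger norm than \<open>M\<^sub>h\<close>, and the one with \<open>s = 1\<close> has the same norm. If \<open>h\<close> is not a multiplier, both
  norms are infinite by definition. The facts that carry this are \<open>triangular_block_property\<close>,
  \<open>schatten_spread\<close>, \<open>amplified_schur_norm\<close> and \<open>schur_norm_eq_cb_norm\<close>.

  The multiplier is specified only on finitely supported matrices, and its amplification only on
  elementary tensors. That both are entrywise multiplications throughout follows from continuity of the
  entries (\<open>entry_le_schatten_norm\<close>) and density (\<open>finite_matrices_dense\<close> for the multiplier; for the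
  amplification it is part of the definition of the tensor product). To apply additivity of the
  amplification to a sum of elementary tensors, one needs that \<open>S\<^sub>p\<close> is closed under addition; the
  inequality \<open>Tr |X + Y|\<^sup>p \<le> K (Tr |X|\<^sup>p + Tr |Y|\<^sup>p)\<close> of \<open>trace_powr_add\<close> gives this, and also the
  control over the three error terms in the density proof.

  These results on \<open>S\<^sub>p\<close> are proved for bounded operators on a type \<open>'i l2\<close> of square-summable
  families. The powers \<open>|X|\<^sup>p\<close> come from a continuous functional calculus \<open>fcalc\<close> for positive operators,
  built from polynomials; it rests on the bound \<open>norm_poly_op_le\<close>. About traces, only one
  symmetry enters: an operator and its adjoint have the same Hilbert-Schmidt norm (\<open>hs_le_adj\<close>).
\<close>

section \<open>Functional calculus for positive operators on a real Hilbert space\<close>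

definition positive_op :: "('a::real_inner \<Rightarrow>\<^sub>L 'a) \<Rightarrow> bool" where
  "positive_op A \<longleftrightarrow> (\<forall>v w. A v \<bullet> w = v \<bullet> A w) \<and> (\<forall>v. 0 \<le> v \<bullet> A v)"

lemma positive_opD:
  assumes "positive_op A"
  shows "blinfun_apply A v \<bullet> w = v \<bullet> A w" "0 \<le> v \<bullet> A v"
  using assms by (auto simp: positive_op_def)

lemma inner_le_norm_op: "v \<bullet> blinfun_apply A v \<le> norm A * (norm v)\<^sup>2"
proof -
  have "v \<bullet> A v \<le> norm v * norm (A v)"
    by (rule norm_cauchy_schwarz)
  also have "\<dots> \<le> norm v * (norm A * norm v)"
    by (intro mult_left_mono norm_blinfun) simp
  finally show ?thesis by (simp add: power2_eq_square algebra_simps)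
qed

definition poly_op :: "real poly \<Rightarrow> ('a::real_normed_vector \<Rightarrow>\<^sub>L 'a) \<Rightarrow> ('a \<Rightarrow>\<^sub>L 'a)" where
  "poly_op q A = fold_coeffs (\<lambda>c B. c *\<^sub>R id_blinfun + (A o\<^sub>L B)) q 0"

lemma poly_op_0 [simp]: "poly_op 0 A = 0"
  by (simp add: poly_op_def)

lemma poly_op_pCons [simp]: "poly_op (pCons c q) A = c *\<^sub>R id_blinfun + (A o\<^sub>L poly_op q A)"
  by (cases "c = 0 \<and> q = 0") (auto simp: poly_op_def simp del: scaleR_eq_0_iff)

lemma poly_op_add: "poly_op (p + q) A = poly_op p A + poly_op q A"
  by (induction p q rule: poly_induct2)
    (auto intro!: blinfun_eqI simp: scaleR_left_distrib blinfun.bilinear_simps id_blinfun.rep_eq)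

lemma poly_op_smult: "poly_op (smult c p) A = c *\<^sub>R poly_op p A"
  by (induction p) (auto intro!: blinfun_eqI simp: scaleR_right_distrib blinfun.bilinear_simps id_blinfun.rep_eq)

lemma poly_op_diff: "poly_op (p - q) A = poly_op p A - poly_op q A"
  using poly_op_add[of "p - q" q A] by simp

lemma poly_op_mult_apply: "poly_op (p * q) A v = poly_op p A (poly_op q A v)"
  by (induction p arbitrary: v)
    (simp_all add: poly_op_add poly_op_smult blinfun.bilinear_simps id_blinfun.rep_eq)

lemma poly_op_mult: "poly_op (p * q) A = poly_op p A o\<^sub>L poly_op q A"
  by (rule blinfun_eqI) (simp add: poly_op_mult_apply)

lemma poly_op_symmetric:
  assumes "\<And>v w. blinfun_apply A v \<bullet> w = v \<bullet> A w"
  shows "blinfun_apply (poly_op q A) v \<bullet> w = v \<bullet> poly_op q A w"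
proof (induction q arbitrary: v w)
  case (pCons c q)
  have comm: "poly_op q A (A w) = A (poly_op q A w)" for w
    using poly_op_mult_apply[of q "[:0, 1:]" A w] poly_op_mult_apply[of "[:0, 1:]" q A w]
    by (simp add: mult.commute blinfun.bilinear_simps id_blinfun.rep_eq)
  have "A (poly_op q A v) \<bullet> w = v \<bullet> A (poly_op q A w)"
    by (simp add: assms pCons.IH comm)
  then show ?case
    by (simp add: blinfun.bilinear_simps inner_add_left inner_add_right)
qed (simp add: blinfun.bilinear_simps id_blinfun.rep_eq)

lemma poly_op_intertwine:
  assumes "\<And>v. blinfun_apply A2 (blinfun_apply X v) = X (blinfun_apply A1 v)"
  shows "poly_op q A2 (X v) = X (poly_op q A1 v)"
  by (induction q) (simp_all add: assms blinfun.bilinear_simps id_blinfun.rep_eq)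

lemma complex_poly_of_real:
  "poly (map_poly complex_of_real p) (complex_of_real r) = complex_of_real (poly p r)"
  by (induction p) (simp_all add: map_poly_pCons)

lemma bounded_below_of_form:
  assumes "\<And>v. d * (norm v)\<^sup>2 \<le> \<bar>v \<bullet> blinfun_apply B v\<bar>"
  shows "d * norm v \<le> norm (B v)"
proof (cases "v = 0")
  case False
  have "norm v * (d * norm v) \<le> \<bar>v \<bullet> B v\<bar>"
    using assms[of v] by (simp add: power2_eq_square algebra_simps)
  also have "\<dots> \<le> norm v * norm (B v)"
    by (rule Cauchy_Schwarz_ineq2)
  finally show ?thesis using False by simp
qed simp

lemma bounded_below_compose:
  assumes "d > 0" "\<And>v. d * norm v \<le> norm (blinfun_apply A v)"
    and "e > 0" "\<And>v. e * norm v \<le> norm (blinfun_apply B v)"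
  shows "\<exists>c>0. \<forall>v. c * norm v \<le> norm (A (B v))"
proof (intro exI[of _ "d * e"] conjI allI)
  fix v
  have "d * e * norm v \<le> d * norm (B v)"
    using assms(1) assms(4)[of v] by simp
  also have "\<dots> \<le> norm (A (B v))" by (rule assms(2))
  finally show "d * e * norm v \<le> norm (A (B v))" .
qed (use assms in simp)

text \<open>
  A real polynomial without zeros on \<open>[0, \<parallel>A\<parallel>]\<close> is a product of linear factors with roots off that
  interval and quadratic factors \<open>(t - \<alpha>)\<^sup>2 + \<beta>\<^sup>2\<close> with \<open>\<beta> \<noteq> 0\<close>. The quadratic form of each factor at \<open>A\<close>
  stays away from \<open>0\<close> on unit vectors, and operators that are bounded below can be composed.
\<close>

lemma poly_op_bounded_below:
  assumes A: "positive_op A"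
    and nz: "\<And>t. 0 \<le> t \<Longrightarrow> t \<le> norm A \<Longrightarrow> poly P t \<noteq> 0"
  shows "\<exists>c>0. \<forall>v. c * norm v \<le> norm (poly_op P A v)"
  using nz
proof (induction "degree P" arbitrary: P rule: less_induct)
  case less
  have P0: "P \<noteq> 0" using less.prems[of 0] by auto
  show ?case
  proof (cases "degree P = 0")
    case True
    then obtain c where P: "P = [:c:]" by (auto elim: degree_eq_zeroE)
    with P0 have "c \<noteq> 0" by auto
    then show ?thesis
      by (intro exI[of _ "\<bar>c\<bar>"]) (simp add: P blinfun.bilinear_simps id_blinfun.rep_eq)
  next
    case False
    let ?C = "map_poly complex_of_real"
    have "degree (?C P) = degree P" by (rule degree_map_poly) simp
    with False have "\<not> constant (poly (?C P))" by (simp add: constant_degree)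
    then obtain z where z: "poly (?C P) z = 0"
      using fundamental_theorem_of_algebra by blast
    obtain D Q where PDQ: "P = D * Q" and degD: "degree D > 0"
      and D: "\<exists>d>0. \<forall>v. d * norm v \<le> norm (poly_op D A v)"
    proof (cases "Im z = 0")
      case True
      define r where "r = Re z"
      have zr: "z = of_real r" using True by (simp add: r_def complex_eq_iff)
      have "poly P r = 0"
        using z complex_poly_of_real[of P r] unfolding zr by simp
      then obtain Q where PQ: "P = [:- r, 1:] * Q" by (auto simp: poly_eq_0_iff_dvd)
      have r: "r < 0 \<or> norm A < r"
        using less.prems[of r] \<open>poly P r = 0\<close> by force
      have form: "v \<bullet> poly_op [:- r, 1:] A v = v \<bullet> A v - r * (norm v)\<^sup>2" for v
        by (simp add: blinfun.bilinear_simps id_blinfun.rep_eq inner_diff_right power2_norm_eq_inner)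
      have "\<exists>d>0. \<forall>v. d * (norm v)\<^sup>2 \<le> \<bar>v \<bullet> poly_op [:- r, 1:] A v\<bar>"
      proof (cases "r < 0")
        case True
        show ?thesis
        proof (intro exI[of _ "- r"] conjI allI)
          fix v show "- r * (norm v)\<^sup>2 \<le> \<bar>v \<bullet> poly_op [:- r, 1:] A v\<bar>"
            unfolding form using positive_opD(2)[OF A, of v] by simp
        qed (use True in simp)
      next
        case False
        show ?thesis
        proof (intro exI[of _ "r - norm A"] conjI allI)
          fix v show "(r - norm A) * (norm v)\<^sup>2 \<le> \<bar>v \<bullet> poly_op [:- r, 1:] A v\<bar>"
            unfolding form using inner_le_norm_op[of v A] by (simp add: algebra_simps)
        qed (use r False in simp)
      qed
      then show ?thesis using that[OF PQ] bounded_below_of_form by (metis degree_pCons_eq_if one_neq_zero pCons_eq_0_iff zero_less_Suc)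
    next
      case False
      define D where "D = [:(Re z)\<^sup>2 + (Im z)\<^sup>2, - 2 * Re z, 1:]"
      \<comment> \<open>\<open>R\<close> is at most linear and has the nonreal zero \<open>z\<close>, so it vanishes\<close>
      define R where "R = P mod D"
      have D0: "D \<noteq> 0" and dD: "degree D = 2" by (simp_all add: D_def)
      have Dz: "poly (?C D) z = 0"
        by (simp add: D_def map_poly_pCons complex_eq_iff power2_eq_square algebra_simps)
      have "P = P div D * D + R" by (simp add: R_def)
      then have "?C P = ?C (P div D) * ?C D + ?C R"
        by (simp add: poly_eq_iff coeff_map_poly coeff_mult)
      then have Rz: "poly (?C R) z = 0" using z Dz by simp
      have "degree R < 2" using degree_mod_less'[OF D0, of P] dD
        unfolding R_def by (metis D0 degree_0 degree_mod_less zero_less_numeral)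
      then obtain a b where R: "R = [:a, b:]"
        by (metis One_nat_def degree_0 degree_pCons_eq_if less_2_cases nat.inject
            pCons_cases degree_eq_zeroE)
      have "b * Im z = 0" "a + b * Re z = 0"
        using Rz by (simp_all add: R map_poly_pCons complex_eq_iff algebra_simps)
      with False have "R = 0" by (simp add: R)
      then have PQ: "P = D * (P div D)"
        using \<open>P = P div D * D + R\<close> by (simp add: mult.commute)
      have form: "(Im z)\<^sup>2 * (norm v)\<^sup>2 \<le> \<bar>v \<bullet> poly_op D A v\<bar>" for v
      proof -
        have "v \<bullet> poly_op D A v = (norm (A v - Re z *\<^sub>R v))\<^sup>2 + (Im z)\<^sup>2 * (norm v)\<^sup>2"
          unfolding power2_norm_eq_inner
          by (simp add: D_def blinfun.bilinear_simps id_blinfun.rep_eq inner_simps positive_opD(1)[OF A]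
              algebra_simps power2_eq_square)
        then show ?thesis by simp
      qed
      have "(Im z)\<^sup>2 > 0" using False by simp
      then show ?thesis using that[OF PQ] form bounded_below_of_form dD by (metis zero_less_numeral)
    qed
    have "Q \<noteq> 0" using PDQ P0 by auto
    then have "degree Q < degree P" using PDQ degD P0 by (auto simp: degree_mult_eq)
    moreover have "poly Q t \<noteq> 0" if "0 \<le> t" "t \<le> norm A" for t
      using less.prems[OF that] PDQ by auto
    ultimately obtain c where "c > 0" "\<forall>v. c * norm v \<le> norm (poly_op Q A v)"
      using less.hyps by blast
    with D show ?thesis unfolding PDQ poly_op_mult_apply
      using bounded_below_compose by meson
  qed
qed

text \<open>
  If \<open>l = \<parallel>q(A)\<parallel>\<close> exceeded \<open>c\<close>, then \<open>q\<^sup>2 - l\<^sup>2\<close> would have no zero on \<open>[0, \<parallel>A\<parallel>]\<close>, and \<open>B\<^sup>2 - l\<^sup>2\<close> would be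
  bounded below for \<open>B = q(A)\<close>. But \<open>\<parallel>B\<^sup>2 v - l\<^sup>2 v\<parallel>\<^sup>2 \<le> l\<^sup>2 (l\<^sup>2 - \<parallel>B v\<parallel>\<^sup>2)\<close> for unit vectors \<open>v\<close>, by symmetry
  of \<open>B\<close>, and the right-hand side comes arbitrarily close to \<open>0\<close>.
\<close>

lemma norm_poly_op_le:
  assumes A: "positive_op A" and c: "\<And>t. 0 \<le> t \<Longrightarrow> t \<le> norm A \<Longrightarrow> \<bar>poly q t\<bar> \<le> c"
  shows "norm (poly_op q A) \<le> c"
proof (rule ccontr)
  define B where "B = poly_op q A"
  define l where "l = norm B"
  assume "\<not> norm (poly_op q A) \<le> c"
  then have lc: "c < l" by (simp add: l_def B_def)
  have "0 \<le> c" using c[of 0] by force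
  with lc have l0: "l > 0" by simp
  define P where "P = q * q - [:l\<^sup>2:]"
  have "poly P t \<noteq> 0" if "0 \<le> t" "t \<le> norm A" for t
  proof -
    have "\<bar>poly q t\<bar> < l" using c[OF that] lc by simp
    then have "\<bar>poly q t\<bar>\<^sup>2 < l\<^sup>2" by (intro power_strict_mono) simp_all
    then show ?thesis by (simp add: P_def power2_eq_square)
  qed
  from poly_op_bounded_below[OF A this] obtain d where d: "d > 0"
    "\<And>v. d * norm v \<le> norm (poly_op P A v)" by blast
  have PA: "poly_op P A v = B (B v) - l\<^sup>2 *\<^sub>R v" for v
    by (simp add: P_def poly_op_diff poly_op_mult_apply B_def blinfun.bilinear_simps id_blinfun.rep_eq)
  have sym: "B v \<bullet> w = v \<bullet> B w" for v w
    unfolding B_def using poly_op_symmetric[of A q v w] A by (simp add: positive_op_def)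
  have key: "(norm (B v))\<^sup>2 \<le> (l\<^sup>2 - d\<^sup>2 / l\<^sup>2) * (norm v)\<^sup>2" for v
  proof -
    have "(d * norm v)\<^sup>2 \<le> (norm (B (B v) - l\<^sup>2 *\<^sub>R v))\<^sup>2"
      using d(2)[of v] d(1) by (intro power_mono) (simp_all add: PA)
    also have "\<dots> = (norm (B (B v)))\<^sup>2 - 2 * l\<^sup>2 * (norm (B v))\<^sup>2 + l\<^sup>2 * l\<^sup>2 * (norm v)\<^sup>2"
      unfolding power2_norm_eq_inner
      by (simp add: inner_simps sym[of "B v" v] inner_commute sym algebra_simps)
    also have "(norm (B (B v)))\<^sup>2 \<le> (l * norm (B v))\<^sup>2"
      unfolding l_def by (intro power_mono norm_blinfun) simp
    finally have "d\<^sup>2 * (norm v)\<^sup>2 \<le> l\<^sup>2 * (l\<^sup>2 * (norm v)\<^sup>2 - (norm (B v))\<^sup>2)"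
      by (simp add: power_mult_distrib algebra_simps)
    then show ?thesis using l0 by (simp add: field_simps)
  qed
  define m where "m = l\<^sup>2 - d\<^sup>2 / l\<^sup>2"
  have ml: "m < l\<^sup>2" using d l0 by (simp add: m_def)
  have "norm B \<le> sqrt (max m 0)"
  proof (rule norm_blinfun_bound)
    fix v
    have "(norm (B v))\<^sup>2 \<le> max m 0 * (norm v)\<^sup>2"
      using key[of v] by (rule order_trans) (auto simp: m_def intro: mult_right_mono)
    then show "norm (B v) \<le> sqrt (max m 0) * norm v"
      by (metis norm_ge_zero real_le_rsqrt real_sqrt_mult real_sqrt_unique)
  qed simp
  also have "\<dots> < sqrt (l\<^sup>2)" using ml l0 by (intro real_sqrt_less_mono) simp
  finally show False using l0 by (simp add: l_def)
qed

lemma weierstrass_poly: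
  fixes f :: "real \<Rightarrow> real"
  assumes "continuous_on {a..b} f"
  shows "\<exists>q :: nat \<Rightarrow> real poly. uniform_limit {a..b} (\<lambda>n. poly (q n)) f sequentially"
proof -
  have "\<exists>q :: real poly. \<forall>x\<in>{a..b}. \<bar>f x - poly q x\<bar> < inverse (Suc n)" for n
  proof -
    obtain g where g: "real_polynomial_function g"
      "\<And>x. x \<in> {a..b} \<Longrightarrow> \<bar>f x - g x\<bar> < inverse (Suc n)"
      using Stone_Weierstrass_real_polynomial_function[OF compact_Icc assms, of "inverse (Suc n)"]
      by auto
    then obtain c N where "g = (\<lambda>x. \<Sum>i\<le>N. c i * x ^ i)"
      unfolding real_polynomial_function_iff_sum by blast
    then have "g = poly (\<Sum>i\<le>N. monom (c i) i)"
      by (simp add: poly_sum poly_monom fun_eq_iff)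
    with g(2) show ?thesis by blast
  qed
  then obtain q :: "nat \<Rightarrow> real poly"
    where q: "\<And>n x. x \<in> {a..b} \<Longrightarrow> \<bar>f x - poly (q n) x\<bar> < inverse (Suc n)" by metis
  have "uniform_limit {a..b} (\<lambda>n. poly (q n)) f sequentially"
  proof (rule uniform_limitI)
    fix e :: real assume "e > 0"
    then obtain N where N: "inverse (Suc N) < e" using reals_Archimedean by blast
    show "\<forall>\<^sub>F n in sequentially. \<forall>x\<in>{a..b}. dist (poly (q n) x) (f x) < e"
    proof (rule eventually_sequentiallyI[of N], intro ballI)
      fix n x assume n: "N \<le> n" and x: "x \<in> {a..b}"
      have "inverse (real (Suc n)) \<le> inverse (Suc N)" using n by (simp add: le_imp_inverse_le)
      with q[OF x, of n] N show "dist (poly (q n) x) (f x) < e"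
        unfolding dist_real_def by linarith
    qed
  qed
  then show ?thesis by blast
qed

text \<open>
  The limit along some sequence of polynomials that converges uniformly to \<open>f\<close> on \<open>[0, \<parallel>A\<parallel>]\<close>; by
  \<open>fcalc_LIMSEQ\<close> below it is the limit along every such sequence.
\<close>

definition fcalc :: "('a::{real_inner,banach} \<Rightarrow>\<^sub>L 'a) \<Rightarrow> (real \<Rightarrow> real) \<Rightarrow> ('a \<Rightarrow>\<^sub>L 'a)" where
  "fcalc A f = lim (\<lambda>n. poly_op
     ((SOME q. uniform_limit {0..norm A} (\<lambda>n. poly (q n)) f sequentially) n) A)"

lemma poly_op_uniform_close:
  assumes A: "positive_op A" and e: "e > 0"
    and q: "uniform_limit {0..norm A} (\<lambda>n. poly (q n)) f sequentially"
    and r: "uniform_limit {0..norm A} (\<lambda>n. poly (r n)) f sequentially"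
  shows "\<exists>N. \<forall>m\<ge>N. \<forall>n\<ge>N. norm (poly_op (q m) A - poly_op (r n) A) < e"
proof -
  have e3: "e / 3 > 0" using e by simp
  obtain N1 where N1: "\<And>n t. n \<ge> N1 \<Longrightarrow> t \<in> {0..norm A} \<Longrightarrow> \<bar>poly (q n) t - f t\<bar> < e / 3"
    using uniform_limitD[OF q e3] unfolding eventually_sequentially dist_real_def by blast
  obtain N2 where N2: "\<And>n t. n \<ge> N2 \<Longrightarrow> t \<in> {0..norm A} \<Longrightarrow> \<bar>poly (r n) t - f t\<bar> < e / 3"
    using uniform_limitD[OF r e3] unfolding eventually_sequentially dist_real_def by blast
  show ?thesis
  proof (intro exI[of _ "max N1 N2"] allI impI)
    fix m n assume mn: "max N1 N2 \<le> m" "max N1 N2 \<le> n"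
    have "norm (poly_op (q m - r n) A) \<le> 2 * (e / 3)"
    proof (rule norm_poly_op_le[OF A])
      fix t :: real assume "0 \<le> t" "t \<le> norm A"
      then show "\<bar>poly (q m - r n) t\<bar> \<le> 2 * (e / 3)"
        using N1[of m t] N2[of n t] mn by (simp add: abs_le_iff abs_less_iff) argo
    qed
    then show "norm (poly_op (q m) A - poly_op (r n) A) < e"
      using e by (simp add: poly_op_diff)
  qed
qed

lemma fcalc_LIMSEQ:
  assumes A: "positive_op A"
    and q: "uniform_limit {0..norm A} (\<lambda>n. poly (q n)) f sequentially"
  shows "(\<lambda>n. poly_op (q n) A) \<longlonglongrightarrow> fcalc A f"
proof -
  define r where "r = (SOME q. uniform_limit {0..norm A} (\<lambda>n. poly (q n)) f sequentially)"
  have r: "uniform_limit {0..norm A} (\<lambda>n. poly (r n)) f sequentially"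
    unfolding r_def by (rule someI[of _ q]) (rule q)
  have "Cauchy (\<lambda>n. poly_op (r n) A)"
    using poly_op_uniform_close[OF A _ r r] by (intro CauchyI) blast
  then have lim: "(\<lambda>n. poly_op (r n) A) \<longlonglongrightarrow> fcalc A f"
    unfolding fcalc_def r_def[symmetric] by (simp add: Cauchy_convergent convergent_LIMSEQ_iff[symmetric])
  have "(\<lambda>n. poly_op (q n) A - poly_op (r n) A) \<longlonglongrightarrow> 0"
  proof (rule LIMSEQ_I)
    fix e :: real assume "e > 0"
    from poly_op_uniform_close[OF A this q r]
    show "\<exists>no. \<forall>n\<ge>no. norm (poly_op (q n) A - poly_op (r n) A - 0) < e" by auto
  qed
  from tendsto_add[OF this lim] show ?thesis by simp
qed

lemma fcalc_approx:
  assumes "positive_op A" "continuous_on {0..norm A} f"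
  obtains q where "uniform_limit {0..norm A} (\<lambda>n. poly (q n)) f sequentially"
    "(\<lambda>n. poly_op (q n) A) \<longlonglongrightarrow> fcalc A f"
    "\<And>v. (\<lambda>n. poly_op (q n) A v) \<longlonglongrightarrow> fcalc A f v"
proof -
  obtain q where q: "uniform_limit {0..norm A} (\<lambda>n. poly (q n)) f sequentially"
    using weierstrass_poly[OF assms(2)] by blast
  note lim = fcalc_LIMSEQ[OF assms(1) q]
  show thesis using that[OF q lim] blinfun.tendsto[OF lim tendsto_const] by blast
qed

lemma fcalc_cong:
  assumes "\<And>t. 0 \<le> t \<Longrightarrow> t \<le> norm A \<Longrightarrow> f t = g t"
  shows "fcalc A f = fcalc A g"
proof -
  have "uniform_limit {0..norm A} (\<lambda>n. poly (q n)) f sequentially \<longleftrightarrow>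
      uniform_limit {0..norm A} (\<lambda>n. poly (q n)) g sequentially" for q
    by (rule uniform_limit_cong') (use assms in auto)
  then show ?thesis by (simp add: fcalc_def)
qed

lemma fcalc_poly: "positive_op A \<Longrightarrow> fcalc A (poly q) = poly_op q A"
  by (rule LIMSEQ_unique[OF fcalc_LIMSEQ[of A "\<lambda>_. q"]]) (simp_all add: uniform_limit_const)

lemma fcalc_const: "positive_op A \<Longrightarrow> fcalc A (\<lambda>_. c) = c *\<^sub>R id_blinfun"
  using fcalc_poly[of A "[:c:]"] by (simp add: poly_pCons[abs_def])

lemma fcalc_ident: "positive_op A \<Longrightarrow> fcalc A (\<lambda>t. t) = A"
  using fcalc_poly[of A "[:0, 1:]"] by (simp add: poly_pCons[abs_def] blinfun_eqI)

lemma fcalc_add: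
  assumes A: "positive_op A" and f: "continuous_on {0..norm A} f" and g: "continuous_on {0..norm A} g"
  shows "fcalc A (\<lambda>t. f t + g t) = fcalc A f + fcalc A g"
proof -
  obtain q where q: "uniform_limit {0..norm A} (\<lambda>n. poly (q n)) f sequentially"
    "(\<lambda>n. poly_op (q n) A) \<longlonglongrightarrow> fcalc A f" by (rule fcalc_approx[OF A f])
  obtain r where r: "uniform_limit {0..norm A} (\<lambda>n. poly (r n)) g sequentially"
    "(\<lambda>n. poly_op (r n) A) \<longlonglongrightarrow> fcalc A g" by (rule fcalc_approx[OF A g])
  have "uniform_limit {0..norm A} (\<lambda>n. poly (q n + r n)) (\<lambda>t. f t + g t) sequentially"
    using uniform_limit_add[OF q(1) r(1)] by (simp add: poly_add[abs_def])
  from fcalc_LIMSEQ[OF A this] tendsto_add[OF q(2) r(2)] show ?thesis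
    by (simp add: poly_op_add LIMSEQ_unique)
qed

lemma fcalc_mult:
  assumes A: "positive_op A" and f: "continuous_on {0..norm A} f" and g: "continuous_on {0..norm A} g"
  shows "fcalc A (\<lambda>t. f t * g t) = fcalc A f o\<^sub>L fcalc A g"
proof -
  obtain q where q: "uniform_limit {0..norm A} (\<lambda>n. poly (q n)) f sequentially"
    "(\<lambda>n. poly_op (q n) A) \<longlonglongrightarrow> fcalc A f" by (rule fcalc_approx[OF A f])
  obtain r where r: "uniform_limit {0..norm A} (\<lambda>n. poly (r n)) g sequentially"
    "(\<lambda>n. poly_op (r n) A) \<longlonglongrightarrow> fcalc A g" by (rule fcalc_approx[OF A g])
  have "bounded (f ` {0..norm A})" "bounded (g ` {0..norm A})"
    using f g by (auto intro!: compact_imp_bounded compact_continuous_image)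
  then have "uniform_limit {0..norm A} (\<lambda>n. poly (q n * r n)) (\<lambda>t. f t * g t) sequentially"
    using uniform_lim_mult[OF q(1) r(1)] by (simp add: poly_mult[abs_def])
  from fcalc_LIMSEQ[OF A this] bounded_bilinear.tendsto[OF bounded_bilinear_blinfun_compose q(2) r(2)] show ?thesis
    by (simp add: poly_op_mult LIMSEQ_unique)
qed

lemma fcalc_scale:
  assumes A: "positive_op A" and f: "continuous_on {0..norm A} f"
  shows "fcalc A (\<lambda>t. c * f t) = c *\<^sub>R fcalc A f"
  using fcalc_mult[OF A continuous_on_const f, of c]
  by (simp add: fcalc_const[OF A] blinfun_eqI blinfun.bilinear_simps)

lemma fcalc_sum:
  assumes A: "positive_op A" and f: "\<And>k. k \<in> K \<Longrightarrow> continuous_on {0..norm A} (f k)"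
  shows "fcalc A (\<lambda>t. \<Sum>k\<in>K. f k t) = (\<Sum>k\<in>K. fcalc A (f k))"
  using f
proof (induction K rule: infinite_finite_induct)
  case (insert k K)
  then show ?case by (simp add: fcalc_add[OF A] continuous_on_sum)
qed (use fcalc_const[OF A, of 0] in auto)

lemma fcalc_symmetric:
  assumes A: "positive_op A" and f: "continuous_on {0..norm A} f"
  shows "fcalc A f v \<bullet> w = v \<bullet> fcalc A f w"
proof -
  obtain q where q: "\<And>v. (\<lambda>n. poly_op (q n) A v) \<longlonglongrightarrow> fcalc A f v"
    using fcalc_approx[OF A f] by metis
  have "(\<lambda>n. poly_op (q n) A v \<bullet> w) \<longlonglongrightarrow> fcalc A f v \<bullet> w" by (intro tendsto_intros q)
  moreover have "(\<lambda>n. v \<bullet> poly_op (q n) A w) \<longlonglongrightarrow> v \<bullet> fcalc A f w" by (intro tendsto_intros q)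
  moreover have "poly_op (q n) A v \<bullet> w = v \<bullet> poly_op (q n) A w" for n
    using poly_op_symmetric A by (metis positive_op_def)
  ultimately show ?thesis by (simp add: LIMSEQ_unique)
qed

lemma fcalc_mult_form:
  assumes A: "positive_op A" and f: "continuous_on {0..norm A} f" and g: "continuous_on {0..norm A} g"
  shows "v \<bullet> fcalc A (\<lambda>t. f t * g t) w = fcalc A f v \<bullet> fcalc A g w"
  by (simp add: fcalc_mult[OF A f g] fcalc_symmetric[OF A f])

lemma fcalc_nonneg:
  assumes A: "positive_op A" and f: "continuous_on {0..norm A} f"
    and "\<And>t. 0 \<le> t \<Longrightarrow> t \<le> norm A \<Longrightarrow> 0 \<le> f t"
  shows "0 \<le> v \<bullet> fcalc A f v"
proof -
  have s: "continuous_on {0..norm A} (\<lambda>t. sqrt (f t))" by (intro continuous_intros f)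
  have "fcalc A f = fcalc A (\<lambda>t. sqrt (f t) * sqrt (f t))"
    by (rule fcalc_cong) (simp add: assms(3))
  also have "v \<bullet> \<dots> v = fcalc A (\<lambda>t. sqrt (f t)) v \<bullet> fcalc A (\<lambda>t. sqrt (f t)) v"
    by (rule fcalc_mult_form[OF A s s])
  finally show ?thesis by simp
qed

lemma positive_op_fcalc:
  assumes "positive_op A" "continuous_on {0..norm A} f"
    and "\<And>t. 0 \<le> t \<Longrightarrow> t \<le> norm A \<Longrightarrow> 0 \<le> f t"
  shows "positive_op (fcalc A f)"
  using assms fcalc_nonneg fcalc_symmetric by (metis positive_op_def)

lemma fcalc_mono:
  assumes A: "positive_op A" and f: "continuous_on {0..norm A} f" and g: "continuous_on {0..norm A} g"
    and "\<And>t. 0 \<le> t \<Longrightarrow> t \<le> norm A \<Longrightarrow> f t \<le> g t"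
  shows "v \<bullet> fcalc A f v \<le> v \<bullet> fcalc A g v"
proof -
  have m: "continuous_on {0..norm A} (\<lambda>t. (-1) * f t)" by (intro continuous_intros f)
  have "0 \<le> v \<bullet> fcalc A (\<lambda>t. g t + (-1) * f t) v"
    by (rule fcalc_nonneg[OF A]) (use assms(4) in \<open>auto intro!: continuous_intros f g\<close>)
  then show ?thesis
    unfolding fcalc_add[OF A g m] fcalc_scale[OF A f]
    by (simp add: blinfun.bilinear_simps inner_simps)
qed

lemma fcalc_norm_le:
  assumes A: "positive_op A" and f: "continuous_on {0..norm A} f"
    and c: "\<And>t. 0 \<le> t \<Longrightarrow> t \<le> norm A \<Longrightarrow> \<bar>f t\<bar> \<le> c"
  shows "norm (fcalc A f) \<le> c"
proof (rule norm_blinfun_bound)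
  show c0: "0 \<le> c" using c[of 0] by force
  fix v
  have "(norm (fcalc A f v))\<^sup>2 = v \<bullet> fcalc A (\<lambda>t. f t * f t) v"
    by (simp add: fcalc_mult_form[OF A f f] power2_norm_eq_inner)
  also have "\<dots> \<le> v \<bullet> fcalc A (\<lambda>_. c\<^sup>2) v"
  proof (rule fcalc_mono[OF A])
    fix t :: real assume "0 \<le> t" "t \<le> norm A"
    then show "f t * f t \<le> c\<^sup>2"
      using power_mono[OF c abs_ge_zero, of t 2] by (simp add: power2_eq_square)
  qed (intro continuous_intros f)+
  also have "\<dots> = (c * norm v)\<^sup>2"
    by (simp add: fcalc_const[OF A] blinfun.bilinear_simps power_mult_distrib power2_norm_eq_inner)
  finally show "norm (fcalc A f v) \<le> c * norm v"
    by (rule power2_le_imp_le) (simp add: c0)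
qed

text \<open>
  The interval \<open>[0, \<parallel>f(A)\<parallel>]\<close> and the range of \<open>f\<close> on \<open>[0, \<parallel>A\<parallel>]\<close> differ in general. Polynomials that
  converge to \<open>g\<close> on an interval containing both compute the two sides simultaneously.
\<close>

lemma fcalc_compose:
  assumes A: "positive_op A" and f: "continuous_on {0..norm A} f"
    and f0: "\<And>t. 0 \<le> t \<Longrightarrow> t \<le> norm A \<Longrightarrow> 0 \<le> f t"
    and g: "continuous_on {0..} g"
  shows "fcalc (fcalc A f) g = fcalc A (\<lambda>t. g (f t))"
proof -
  define B where "B = fcalc A f"
  have B: "positive_op B" unfolding B_def by (rule positive_op_fcalc[OF A f f0])
  have "bounded (f ` {0..norm A})"
    using f by (auto intro!: compact_imp_bounded compact_continuous_image)
  then obtain M where M: "\<And>t. t \<in> {0..norm A} \<Longrightarrow> f t \<le> M"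
    unfolding bounded_iff by (metis abs_le_D1 imageI real_norm_def)
  define L where "L = max M (norm B)"
  have "continuous_on {0..L} g" using g by (rule continuous_on_subset) auto
  then obtain q where q: "uniform_limit {0..L} (\<lambda>n. poly (q n)) g sequentially"
    using weierstrass_poly by blast
  have "uniform_limit {0..norm B} (\<lambda>n. poly (q n)) g sequentially"
    by (rule uniform_limit_on_subset[OF q]) (auto simp: L_def)
  note lim1 = fcalc_LIMSEQ[OF B this]
  have poly_B: "poly_op r B = fcalc A (\<lambda>t. poly r (f t))" for r
  proof (induction r)
    case 0
    show ?case using fcalc_const[OF A, of 0] by simp
  next
    case (pCons c r)
    have cr: "continuous_on {0..norm A} (\<lambda>t. poly r (f t))" by (intro continuous_intros f)
    show ?case
      by (simp add: pCons.IH[unfolded B_def] fcalc_add[OF A] fcalc_mult[OF A f cr] fcalc_const[OF A] B_def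
          cr f continuous_on_mult)
  qed
  have "(\<lambda>n. poly_op (q n) B) \<longlonglongrightarrow> fcalc A (\<lambda>t. g (f t))"
  proof (rule LIMSEQ_I)
    fix e :: real assume e: "e > 0"
    then have "e / 2 > 0" by simp
    then obtain N where N: "\<And>n t. n \<ge> N \<Longrightarrow> t \<in> {0..L} \<Longrightarrow> \<bar>poly (q n) t - g t\<bar> < e / 2"
      using uniform_limitD[OF q] unfolding eventually_sequentially dist_real_def by blast
    have gf: "continuous_on {0..norm A} (\<lambda>t. g (f t))"
      by (rule continuous_on_compose2[OF g f]) (use f0 in auto)
    show "\<exists>no. \<forall>n\<ge>no. norm (poly_op (q n) B - fcalc A (\<lambda>t. g (f t))) < e"
    proof (intro exI[of _ N] allI impI)
      fix n assume n: "N \<le> n"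
      have cq: "continuous_on {0..norm A} (\<lambda>t. poly (q n) (f t))" by (intro continuous_intros f)
      have mg: "continuous_on {0..norm A} (\<lambda>t. (-1) * g (f t))" by (intro continuous_intros gf)
      have "norm (fcalc A (\<lambda>t. poly (q n) (f t) + (-1) * g (f t))) \<le> e / 2"
      proof (rule fcalc_norm_le[OF A])
        fix t :: real assume t: "0 \<le> t" "t \<le> norm A"
        then have "f t \<in> {0..L}" using M[of t] f0[of t] by (auto simp: L_def)
        from N[OF n this] show "\<bar>poly (q n) (f t) + (-1) * g (f t)\<bar> \<le> e / 2" by simp
      qed (intro continuous_intros cq gf)
      then show "norm (poly_op (q n) B - fcalc A (\<lambda>t. g (f t))) < e"
        unfolding fcalc_add[OF A cq mg] fcalc_scale[OF A gf] poly_B using e by simp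
    qed
  qed
  with lim1 show ?thesis unfolding B_def by (simp add: LIMSEQ_unique)
qed

text \<open>
  Polynomials intertwine trivially; one sequence of them has to serve both operators, which is why
  continuity is required on the whole half line.
\<close>

lemma fcalc_intertwine:
  fixes X :: "'a::{real_inner,banach} \<Rightarrow>\<^sub>L 'b::{real_inner,banach}"
  assumes A: "positive_op A1" "positive_op A2" and f: "continuous_on {0..} f"
    and X: "\<And>v. blinfun_apply A2 (blinfun_apply X v) = X (blinfun_apply A1 v)"
  shows "fcalc A2 f (X v) = X (fcalc A1 f v)"
proof -
  define L where "L = max (norm A1) (norm A2)"
  have "continuous_on {0..L} f" using f by (rule continuous_on_subset) auto
  then obtain q where q: "uniform_limit {0..L} (\<lambda>n. poly (q n)) f sequentially"
    using weierstrass_poly by blast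
  have "(\<lambda>n. poly_op (q n) A1) \<longlonglongrightarrow> fcalc A1 f"
    by (rule fcalc_LIMSEQ[OF A(1) uniform_limit_on_subset[OF q]]) (auto simp: L_def)
  then have "(\<lambda>n. X (poly_op (q n) A1 v)) \<longlonglongrightarrow> X (fcalc A1 f v)"
    by (intro tendsto_intros)
  moreover have "(\<lambda>n. poly_op (q n) A2) \<longlonglongrightarrow> fcalc A2 f"
    by (rule fcalc_LIMSEQ[OF A(2) uniform_limit_on_subset[OF q]]) (auto simp: L_def)
  then have "(\<lambda>n. poly_op (q n) A2 (X v)) \<longlonglongrightarrow> fcalc A2 f (X v)"
    by (intro tendsto_intros)
  ultimately show ?thesis by (simp add: poly_op_intertwine[OF X] LIMSEQ_unique)
qed

section \<open>The Hilbert space of square-summable families\<close>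

lemma nonneg_summable_boundedI:
  fixes f :: "'i \<Rightarrow> real"
  assumes "\<And>i. 0 \<le> f i" and "\<And>F. finite F \<Longrightarrow> sum f F \<le> C"
  shows "f summable_on A"
  using assms by (intro nonneg_bounded_partial_sums_imp_summable_on[where C = C] eventually_finite_subsets_at_top_weakI) auto

text \<open>
  This becomes a real Hilbert space, so that the functional calculus and the bounded linear maps
  of the library apply; multiplication by complex scalars is the operator \<open>cscale\<close> below.
\<close>

typedef 'i l2 = "{v :: 'i \<Rightarrow> complex. (\<lambda>i. (cmod (v i))\<^sup>2) summable_on UNIV}"
  morphisms coord Abs_l2
  by (rule exI[of _ "\<lambda>_. 0"]) simp

setup_lifting type_definition_l2

lemma coord_summable: "(\<lambda>i. (cmod (coord v i))\<^sup>2) summable_on UNIV"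
  using coord[of v] by simp

lemma l2_eqI: "(\<And>i. coord v i = coord w i) \<Longrightarrow> v = w"
  by (simp add: coord_inject[symmetric] fun_eq_iff)

lemma norm_add_sq_le: "(norm (a + b :: 'a :: real_normed_vector))\<^sup>2 \<le> 2 * (norm a)\<^sup>2 + 2 * (norm b)\<^sup>2"
proof -
  have "(norm (a + b))\<^sup>2 \<le> (norm a + norm b)\<^sup>2"
    by (intro power_mono norm_triangle_ineq) simp
  also have "\<dots> \<le> 2 * (norm a)\<^sup>2 + 2 * (norm b)\<^sup>2"
    using sum_squares_bound[of "norm a" "norm b"] by (simp add: power2_sum)
  finally show ?thesis .
qed

instantiation l2 :: (type) real_vector
begin

lift_definition zero_l2 :: "'a l2" is "\<lambda>_. 0" by simp

lift_definition plus_l2 :: "'a l2 \<Rightarrow> 'a l2 \<Rightarrow> 'a l2" is "\<lambda>v w i. v i + w i"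
proof -
  fix v w :: "'a \<Rightarrow> complex"
  assume "(\<lambda>i. (cmod (v i))\<^sup>2) summable_on UNIV" "(\<lambda>i. (cmod (w i))\<^sup>2) summable_on UNIV"
  then have "(\<lambda>i. 2 * (cmod (v i))\<^sup>2 + 2 * (cmod (w i))\<^sup>2) summable_on UNIV"
    by (intro summable_on_add summable_on_cmult_right)
  then show "(\<lambda>i. (cmod (v i + w i))\<^sup>2) summable_on UNIV"
    by (rule summable_on_comparison_test) (simp_all add: norm_add_sq_le)
qed

lift_definition uminus_l2 :: "'a l2 \<Rightarrow> 'a l2" is "\<lambda>v i. - v i" by simp

lift_definition scaleR_l2 :: "real \<Rightarrow> 'a l2 \<Rightarrow> 'a l2" is "\<lambda>r v i. r *\<^sub>R v i"
  by (simp add: power_mult_distrib summable_on_cmult_right)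

definition minus_l2 :: "'a l2 \<Rightarrow> 'a l2 \<Rightarrow> 'a l2" where "minus_l2 v w = v + (- w)"

instance
proof
  fix u v w :: "'a l2" and r q :: real
  show "u + v + w = u + (v + w)" by transfer (simp add: add.assoc)
  show "u + v = v + u" by transfer (simp add: add.commute)
  show "0 + u = u" by transfer simp
  show "- u + u = 0" by transfer simp
  show "u - v = u + - v" by (rule minus_l2_def)
  show "r *\<^sub>R (u + v) = r *\<^sub>R u + r *\<^sub>R v" by transfer (simp add: scaleR_add_right)
  show "(r + q) *\<^sub>R u = r *\<^sub>R u + q *\<^sub>R u" by transfer (simp add: scaleR_add_left)
  show "r *\<^sub>R q *\<^sub>R u = (r * q) *\<^sub>R u" by transfer simp
  show "1 *\<^sub>R u = u" by transfer simp
qed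

end

lemma coord_simps [simp]:
  "coord 0 i = 0" "coord (v + w) i = coord v i + coord w i" "coord (- v) i = - coord v i"
  "coord (v - w) i = coord v i - coord w i" "coord (r *\<^sub>R v) i = r *\<^sub>R coord v i"
proof -
  show "coord (v - w) i = coord v i - coord w i"
    unfolding minus_l2_def by (simp only: plus_l2.rep_eq uminus_l2.rep_eq) simp
qed (simp_all add: zero_l2.rep_eq plus_l2.rep_eq uminus_l2.rep_eq scaleR_l2.rep_eq)

lemma coord_sum [simp]: "coord (\<Sum>k\<in>F. f k) i = (\<Sum>k\<in>F. coord (f k) i)"
  by (induction F rule: infinite_finite_induct) auto

lemma coord_inner_summable: "(\<lambda>i. coord v i \<bullet> coord w i) summable_on UNIV"
proof -
  have "(\<lambda>i. (cmod (coord v i))\<^sup>2 + (cmod (coord w i))\<^sup>2) summable_on UNIV"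
    by (intro summable_on_add coord_summable)
  then have "(\<lambda>i. \<bar>coord v i \<bullet> coord w i\<bar>) summable_on UNIV"
  proof (rule summable_on_comparison_test)
    fix i
    have "\<bar>coord v i \<bullet> coord w i\<bar> \<le> cmod (coord v i) * cmod (coord w i)"
      by (rule Cauchy_Schwarz_ineq2)
    also have "\<dots> \<le> (cmod (coord v i))\<^sup>2 + (cmod (coord w i))\<^sup>2"
      using sum_squares_bound[of "cmod (coord v i)" "cmod (coord w i)"]
        mult_nonneg_nonneg[OF norm_ge_zero[of "coord v i"] norm_ge_zero[of "coord w i"]] by linarith
    finally show "\<bar>coord v i \<bullet> coord w i\<bar> \<le> (cmod (coord v i))\<^sup>2 + (cmod (coord w i))\<^sup>2" .
  qed simp
  then show ?thesis by (subst summable_on_iff_abs_summable_on_real) simp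
qed

instantiation l2 :: (type) real_inner
begin

definition inner_l2 :: "'a l2 \<Rightarrow> 'a l2 \<Rightarrow> real" where
  "inner_l2 v w = (\<Sum>\<^sub>\<infinity>i. coord v i \<bullet> coord w i)"

definition norm_l2 :: "'a l2 \<Rightarrow> real" where "norm_l2 v = sqrt (v \<bullet> v)"

definition dist_l2 :: "'a l2 \<Rightarrow> 'a l2 \<Rightarrow> real" where "dist_l2 v w = norm (v - w)"

definition sgn_l2 :: "'a l2 \<Rightarrow> 'a l2" where "sgn_l2 v = v /\<^sub>R norm v"

definition uniformity_l2 :: "('a l2 \<times> 'a l2) filter" where
  "uniformity_l2 = (INF e\<in>{0 <..}. principal {(x, y). dist x y < e})"

definition open_l2 :: "'a l2 set \<Rightarrow> bool" where
  "open_l2 S = (\<forall>x\<in>S. \<forall>\<^sub>F (x', y) in uniformity. x' = x \<longrightarrow> y \<in> S)"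

instance
proof
  fix u v w :: "'a l2" and r :: real
  show "v \<bullet> w = w \<bullet> v" by (simp add: inner_l2_def inner_commute)
  show "(u + v) \<bullet> w = u \<bullet> w + v \<bullet> w"
    by (simp add: inner_l2_def inner_add_left infsum_add coord_inner_summable)
  show "r *\<^sub>R v \<bullet> w = r * (v \<bullet> w)"
    by (simp add: inner_l2_def infsum_cmult_right' del: scaleR_complex.sel)
  show "0 \<le> v \<bullet> v" by (simp add: inner_l2_def infsum_nonneg)
  show "(v \<bullet> v = 0) = (v = 0)"
  proof
    assume "v \<bullet> v = 0"
    then have "coord v i \<bullet> coord v i = 0" for i
      using nonneg_infsum_le_0D[of "\<lambda>i. coord v i \<bullet> coord v i" UNIV i] coord_inner_summable[of v v]
      by (simp add: inner_l2_def del: inner_eq_zero_iff)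
    then show "v = 0" by (intro l2_eqI) simp
  qed (simp add: inner_l2_def)
qed (simp_all add: norm_l2_def dist_l2_def sgn_l2_def uniformity_l2_def open_l2_def)

end

lemma inner_has_sum: "((\<lambda>i. coord v i \<bullet> coord w i) has_sum (v \<bullet> w)) UNIV"
  unfolding inner_l2_def by (intro has_sum_infsum coord_inner_summable)

lemma norm_sq_has_sum: "((\<lambda>i. (cmod (coord v i))\<^sup>2) has_sum (norm v)\<^sup>2) UNIV"
  using inner_has_sum[of v v] by (simp add: power2_norm_eq_inner)

lemma sum_coord_le: "finite F \<Longrightarrow> (\<Sum>i\<in>F. (cmod (coord v i))\<^sup>2) \<le> (norm v)\<^sup>2"
  by (rule finite_sum_le_has_sum[OF norm_sq_has_sum]) auto

lemma coord_le_norm: "cmod (coord v i) \<le> norm v"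
  using sum_coord_le[of "{i}" v] by (auto intro: power2_le_imp_le)

lemma norm_sq_leI:
  assumes "\<And>F. finite F \<Longrightarrow> (\<Sum>i\<in>F. (cmod (coord v i))\<^sup>2) \<le> C"
  shows "(norm v)\<^sup>2 \<le> C"
  by (rule has_sum_le_finite_sums[OF norm_sq_has_sum]) (use assms in auto)

lemma ex_l2I:
  assumes "\<And>F. finite F \<Longrightarrow> (\<Sum>i\<in>F. (cmod (f i))\<^sup>2) \<le> C"
  shows "\<exists>v. (\<forall>i. coord v i = f i) \<and> (norm v)\<^sup>2 \<le> C"
proof -
  have "(\<lambda>i. (cmod (f i))\<^sup>2) summable_on UNIV"
    by (rule nonneg_summable_boundedI[OF _ assms]) simp_all
  then have "coord (Abs_l2 f) = f" by (simp add: Abs_l2_inverse)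
  then show ?thesis using norm_sq_leI[of "Abs_l2 f" C] assms by (intro exI[of _ "Abs_l2 f"]) simp
qed

lemma bounded_linear_coord: "bounded_linear (\<lambda>v. coord v i)"
  by (rule bounded_linear_intro[where K = 1]) (auto simp: coord_le_norm)

instance l2 :: (type) banach
proof
  fix X :: "nat \<Rightarrow> 'a l2"
  assume X: "Cauchy X"
  have "Cauchy (\<lambda>n. coord (X n) i)" for i
    using bounded_linear.Cauchy[OF bounded_linear_coord X] .
  then obtain f where f: "\<And>i. (\<lambda>n. coord (X n) i) \<longlonglongrightarrow> f i"
    unfolding Cauchy_convergent_iff convergent_def by metis
  have tail: "(\<Sum>i\<in>F. (cmod (coord (X n) i - f i))\<^sup>2) \<le> e\<^sup>2"
    if F: "finite F" and e: "\<forall>m\<ge>N. norm (X n - X m) < e" for F n N and e :: real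
  proof (rule tendsto_upperbound)
    show "(\<lambda>m. \<Sum>i\<in>F. (cmod (coord (X n) i - coord (X m) i))\<^sup>2)
        \<longlonglongrightarrow> (\<Sum>i\<in>F. (cmod (coord (X n) i - f i))\<^sup>2)"
      by (intro tendsto_intros f)
    show "\<forall>\<^sub>F m in sequentially. (\<Sum>i\<in>F. (cmod (coord (X n) i - coord (X m) i))\<^sup>2) \<le> e\<^sup>2"
    proof (rule eventually_sequentiallyI[of N])
      fix m assume "N \<le> m"
      with e have "norm (X n - X m) < e" by blast
      then have "(norm (X n - X m))\<^sup>2 \<le> e\<^sup>2" by (intro power_mono) simp_all
      with sum_coord_le[OF F, of "X n - X m"]
      show "(\<Sum>i\<in>F. (cmod (coord (X n) i - coord (X m) i))\<^sup>2) \<le> e\<^sup>2" by simp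
    qed
  qed simp
  obtain N where N: "\<And>n m. n \<ge> N \<Longrightarrow> m \<ge> N \<Longrightarrow> norm (X n - X m) < 1"
    using CauchyD[OF X, of 1] by auto
  obtain d where d: "\<And>i. coord d i = coord (X N) i - f i"
    using ex_l2I[of "\<lambda>i. coord (X N) i - f i" "1\<^sup>2"] tail[where n = N and e = 1 and N = N] N by auto
  define v where "v = X N - d"
  have v: "coord v i = f i" for i by (simp add: v_def d)
  have "X \<longlonglongrightarrow> v"
  proof (rule LIMSEQ_I)
    fix e :: real assume e: "e > 0"
    then obtain N where N: "\<And>n m. n \<ge> N \<Longrightarrow> m \<ge> N \<Longrightarrow> norm (X n - X m) < e / 2"
      using CauchyD[OF X, of "e / 2"] by auto
    show "\<exists>no. \<forall>n\<ge>no. norm (X n - v) < e"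
    proof (intro exI[of _ N] allI impI)
      fix n assume n: "N \<le> n"
      have "(norm (X n - v))\<^sup>2 \<le> (e / 2)\<^sup>2"
      proof (rule norm_sq_leI)
        fix F :: "'a set" assume "finite F"
        from tail[OF this, where n = n and N = N and e = "e / 2"] N n
        show "(\<Sum>i\<in>F. (cmod (coord (X n - v) i))\<^sup>2) \<le> (e / 2)\<^sup>2" by (simp only: coord_simps v) blast
      qed
      then have "norm (X n - v) \<le> e / 2" by (rule power2_le_imp_le) (use e in simp)
      then show "norm (X n - v) < e" using e by simp
    qed
  qed
  then show "convergent X" by (auto simp: convergent_def)
qed

lift_definition single :: "'i \<Rightarrow> complex \<Rightarrow> 'i l2" is "\<lambda>i c j. if j = i then c else 0"
proof -
  fix i :: 'i and c :: complex
  show "(\<lambda>j. (cmod (if j = i then c else 0))\<^sup>2) summable_on UNIV"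
    by (rule finite_nonzero_values_imp_summable_on) (simp add: if_distrib cong: if_cong)
qed

lift_definition cscale :: "complex \<Rightarrow> 'i l2 \<Rightarrow> 'i l2" is "\<lambda>c v i. c * v i"
  by (simp add: norm_mult power_mult_distrib summable_on_cmult_right)

lemma coord_single: "coord (single i c) j = (if j = i then c else 0)"
  by (rule single.rep_eq[THEN fun_cong])

lemma coord_cscale [simp]: "coord (cscale c v) i = c * coord v i"
  by (rule cscale.rep_eq[THEN fun_cong])

lemma inner_single_left: "single i c \<bullet> v = c \<bullet> coord v i"
proof -
  have "((\<lambda>j. coord (single i c) j \<bullet> coord v j) has_sum (c \<bullet> coord v i)) UNIV"
    by (rule has_sum_finite_neutralI[of "{i}"]) (auto simp: coord_single)
  with inner_has_sum show ?thesis by (rule has_sum_unique)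
qed

lemma inner_single_right: "v \<bullet> single i c = coord v i \<bullet> c"
  using inner_single_left[of i c v] by (simp only: inner_commute)

lemma norm_single [simp]: "norm (single i c) = cmod c"
  by (simp add: norm_eq_sqrt_inner inner_single_left coord_single)

lemma single_add: "single i (c + d) = single i c + single i d"
  by (rule l2_eqI) (simp add: coord_single)

lemma single_scaleR: "single i (r *\<^sub>R c) = r *\<^sub>R single i c"
  by (rule l2_eqI) (simp add: coord_single)

lemma single_cscale: "single i (c * d) = cscale c (single i d)"
  by (rule l2_eqI) (simp add: coord_single)

lemma single_Re_Im: "single i c = Re c *\<^sub>R single i 1 + Im c *\<^sub>R single i \<i>"
  by (rule l2_eqI) (simp add: coord_single complex_eq_iff)

lemma bounded_linear_cscale: "bounded_linear (cscale c)"
proof (rule bounded_linear_intro[where K = "cmod c"])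
  show "cscale c (v + w) = cscale c v + cscale c w" for v w :: "'a l2"
    by (rule l2_eqI) (simp add: algebra_simps)
  show "cscale c (r *\<^sub>R v) = r *\<^sub>R cscale c v" for r and v :: "'a l2"
    by (rule l2_eqI) (simp add: algebra_simps)
  fix v :: "'a l2"
  have "(norm (cscale c v))\<^sup>2 \<le> (cmod c * norm v)\<^sup>2"
  proof (rule norm_sq_leI)
    fix F :: "'a set" assume "finite F"
    then have "(cmod c)\<^sup>2 * (\<Sum>i\<in>F. (cmod (coord v i))\<^sup>2) \<le> (cmod c)\<^sup>2 * (norm v)\<^sup>2"
      by (intro mult_left_mono sum_coord_le) auto
    then show "(\<Sum>i\<in>F. (cmod (coord (cscale c v) i))\<^sup>2) \<le> (cmod c * norm v)\<^sup>2"
      by (simp add: norm_mult power_mult_distrib sum_distrib_left)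
  qed
  then have "norm (cscale c v) \<le> cmod c * norm v" by (rule power2_le_imp_le) simp
  then show "norm (cscale c v) \<le> norm v * cmod c" by (simp only: mult.commute)
qed

lemma norm_sum_single_sq:
  assumes "finite F"
  shows "(norm (\<Sum>i\<in>F. single i (f i)))\<^sup>2 = (\<Sum>i\<in>F. (cmod (f i))\<^sup>2)"
proof -
  have "(norm (\<Sum>i\<in>F. single i (f i)))\<^sup>2 = (\<Sum>i\<in>F. f i \<bullet> coord (\<Sum>j\<in>F. single j (f j)) i)"
    unfolding power2_norm_eq_inner by (simp add: inner_sum_left inner_single_left)
  also have "\<dots> = (\<Sum>i\<in>F. f i \<bullet> f i)"
    using assms by (intro sum.cong refl) (simp add: coord_single sum.delta)
  finally show ?thesis by (simp add: power2_norm_eq_inner)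
qed

lemma has_sum_single: "((\<lambda>i. single i (coord v i)) has_sum v) UNIV"
  unfolding has_sum_def
proof (rule tendstoI)
  fix e :: real assume e: "e > 0"
  have "\<forall>\<^sub>F F in finite_subsets_at_top UNIV.
      dist (\<Sum>i\<in>F. (cmod (coord v i))\<^sup>2) ((norm v)\<^sup>2) < e\<^sup>2"
    using norm_sq_has_sum[of v] e unfolding has_sum_def by (rule_tac tendstoD) auto
  moreover have "\<forall>\<^sub>F F in finite_subsets_at_top (UNIV :: 'a set). finite F"
    by (rule eventually_finite_subsets_at_top_weakI) simp
  ultimately show "\<forall>\<^sub>F F in finite_subsets_at_top UNIV. dist (\<Sum>i\<in>F. single i (coord v i)) v < e"
  proof eventually_elim
    case (elim F)
    define u where "u = (\<Sum>i\<in>F. single i (coord v i))"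
    have uv: "u \<bullet> v = (\<Sum>i\<in>F. (cmod (coord v i))\<^sup>2)"
      by (simp add: u_def inner_sum_left inner_single_left power2_norm_eq_inner)
    have "(norm (u - v))\<^sup>2 = (norm v)\<^sup>2 - (\<Sum>i\<in>F. (cmod (coord v i))\<^sup>2)"
      using norm_sum_single_sq[OF elim(2), of "coord v"] uv
      by (simp add: u_def[symmetric] power2_norm_eq_inner inner_diff_left inner_diff_right inner_commute)
    also have "\<dots> < e\<^sup>2" using elim(1) by (simp add: dist_real_def)
    finally have "norm (u - v) < e" by (rule power2_less_imp_less) (use e in simp)
    then show ?case by (simp add: u_def dist_norm)
  qed
qed

lemma l2_inner_eqI:
  assumes "\<And>u. u \<bullet> v = u \<bullet> (w :: 'a :: real_inner)"
  shows "v = w"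
proof -
  have "(v - w) \<bullet> (v - w) = 0" using assms[of "v - w"] by (simp add: inner_diff_right[of "v - w" v w])
  then show ?thesis by simp
qed

text \<open>
  The adjoint is read off from the matrix coefficients, with the real and imaginary unit vectors
  recovering both parts of a coordinate of the real-linear operator.
\<close>

lemma ex_adjoint:
  fixes B :: "'i l2 \<Rightarrow>\<^sub>L 'h::real_inner"
  shows "\<exists>B' :: 'h \<Rightarrow>\<^sub>L 'i l2. norm B' \<le> norm B \<and> (\<forall>v w. blinfun_apply B v \<bullet> w = v \<bullet> blinfun_apply B' w)"
proof -
  have "\<exists>u. (\<forall>i. coord u i = Complex (B (single i 1) \<bullet> w) (B (single i \<i>) \<bullet> w)) \<and>
      (norm u)\<^sup>2 \<le> (norm B * norm w)\<^sup>2" for w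
  proof (rule ex_l2I)
    fix F :: "'i set" assume F: "finite F"
    define f where "f i = Complex (B (single i 1) \<bullet> w) (B (single i \<i>) \<bullet> w)" for i
    define S where "S = (\<Sum>i\<in>F. (cmod (f i))\<^sup>2)"
    define u where "u = (\<Sum>i\<in>F. single i (f i))"
    have Su: "(norm u)\<^sup>2 = S" by (simp add: u_def S_def norm_sum_single_sq[OF F])
    have "B (single i (f i)) \<bullet> w = (cmod (f i))\<^sup>2" for i
      unfolding single_Re_Im[of i "f i"]
      unfolding cmod_power2
      by (simp add: f_def blinfun.bilinear_simps inner_add_left power2_eq_square)
    then have "S = B u \<bullet> w" by (simp add: S_def u_def blinfun.sum_right inner_sum_left)
    also have "\<dots> \<le> norm (B u) * norm w" by (rule norm_cauchy_schwarz)
    also have "\<dots> \<le> (norm B * norm u) * norm w" by (intro mult_right_mono norm_blinfun) simp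
    finally have "norm u * norm u \<le> norm u * (norm B * norm w)"
      using Su by (simp add: power2_eq_square algebra_simps)
    then have "norm u \<le> norm B * norm w"
      by (cases "norm u = 0") (auto simp: mult_le_cancel_left)
    then show "(\<Sum>i\<in>F. (cmod (f i))\<^sup>2) \<le> (norm B * norm w)\<^sup>2"
      unfolding S_def[symmetric] Su[symmetric] by (intro power_mono) simp_all
  qed
  then obtain g where g: "\<And>w i. coord (g w) i = Complex (B (single i 1) \<bullet> w) (B (single i \<i>) \<bullet> w)"
    and gn: "\<And>w. (norm (g w))\<^sup>2 \<le> (norm B * norm w)\<^sup>2" by metis
  have gle: "norm (g w) \<le> norm B * norm w" for w
    using gn[of w] by (rule power2_le_imp_le) simp
  have adj: "B v \<bullet> w = v \<bullet> g w" for v w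
  proof -
    have "((\<lambda>i. B (single i (coord v i)) \<bullet> w) has_sum (B v \<bullet> w)) UNIV"
      by (rule has_sum_bounded_linear[OF bounded_linear_inner_left
            has_sum_bounded_linear[OF blinfun.bounded_linear_right has_sum_single]])
    moreover have "B (single i (coord v i)) \<bullet> w = coord v i \<bullet> coord (g w) i" for i
      unfolding single_Re_Im[of i "coord v i"]
      by (simp add: g blinfun.bilinear_simps inner_add_left inner_complex_def)
    ultimately show ?thesis using inner_has_sum[of v "g w"] by (simp add: has_sum_unique)
  qed
  have bl: "bounded_linear g"
  proof (rule bounded_linear_intro[where K = "norm B"])
    show "g (x + y) = g x + g y" for x y
      by (rule l2_inner_eqI) (simp add: inner_add_right flip: adj)
    show "g (r *\<^sub>R x) = r *\<^sub>R g x" for r x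
      by (rule l2_inner_eqI) (simp flip: adj)
    show "norm (g x) \<le> norm x * norm B" for x
      using gle[of x] by (simp only: mult.commute)
  qed
  show ?thesis
  proof (intro exI[of _ "Blinfun g"] conjI allI)
    show "norm (Blinfun g) \<le> norm B"
      by (rule norm_blinfun_bound) (simp_all add: bounded_linear_Blinfun_apply[OF bl] gle)
  qed (simp add: bounded_linear_Blinfun_apply[OF bl] adj)
qed

definition adj :: "('i l2 \<Rightarrow>\<^sub>L 'h::real_inner) \<Rightarrow> ('h \<Rightarrow>\<^sub>L 'i l2)" where
  "adj B = (SOME B'. norm B' \<le> norm B \<and> (\<forall>v w. blinfun_apply B v \<bullet> w = v \<bullet> blinfun_apply B' w))"

lemma norm_adj_le: "norm (adj B) \<le> norm B"
  and adj_right: "blinfun_apply B v \<bullet> w = v \<bullet> blinfun_apply (adj B) w"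
proof -
  have "norm (adj B) \<le> norm B \<and> (\<forall>v w. blinfun_apply B v \<bullet> w = v \<bullet> blinfun_apply (adj B) w)"
    unfolding adj_def by (rule someI_ex) (rule ex_adjoint)
  then show "norm (adj B) \<le> norm B" "blinfun_apply B v \<bullet> w = v \<bullet> blinfun_apply (adj B) w" by blast+
qed

lemma adj_left: "blinfun_apply (adj B) w \<bullet> v = w \<bullet> blinfun_apply B v"
  using adj_right[of B v w] by (simp only: inner_commute)

lemma adj_eqI:
  assumes "\<And>v w. blinfun_apply B v \<bullet> w = v \<bullet> blinfun_apply B' w"
  shows "adj B = B'"
  by (rule blinfun_eqI, rule l2_inner_eqI) (simp flip: adj_right add: assms)

lemma adj_adj: "adj (adj B) = B"
  by (rule adj_eqI) (simp add: adj_left)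

lemma adj_compose: "adj (A o\<^sub>L B) = adj B o\<^sub>L adj A"
  by (rule adj_eqI) (simp add: adj_right)

definition abs_sq :: "('i l2 \<Rightarrow>\<^sub>L 'h::real_inner) \<Rightarrow> ('i l2 \<Rightarrow>\<^sub>L 'i l2)" where
  "abs_sq B = adj B o\<^sub>L B"

lemma abs_sq_form: "v \<bullet> abs_sq B w = blinfun_apply B v \<bullet> blinfun_apply B w"
  by (simp add: abs_sq_def adj_right)

lemma positive_abs_sq: "positive_op (abs_sq B)"
proof -
  have "abs_sq B v \<bullet> w = v \<bullet> abs_sq B w" for v w
    using abs_sq_form[of w B v] abs_sq_form[of v B w]
    by (simp only: inner_commute[of "abs_sq B v"] inner_commute[of "B w"])
  then show ?thesis by (simp add: positive_op_def abs_sq_form)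
qed

subsection \<open>Complex-linear operators\<close>

definition clin :: "('i l2 \<Rightarrow>\<^sub>L 'j l2) \<Rightarrow> bool" where
  "clin B \<longleftrightarrow> (\<forall>c v. B (cscale c v) = cscale c (B v))"

lemma clin_compose: "clin A \<Longrightarrow> clin B \<Longrightarrow> clin (A o\<^sub>L B)"
  by (simp add: clin_def)

lemma cscale_inner: "cscale c v \<bullet> w = v \<bullet> cscale (cnj c) w"
proof -
  have "coord (cscale c v) i \<bullet> coord w i = coord v i \<bullet> coord (cscale (cnj c) w) i" for i
    by (simp add: inner_complex_def algebra_simps)
  then show ?thesis by (simp add: inner_l2_def)
qed

lemma clin_adj:
  assumes "clin B"
  shows "clin (adj B)"
  unfolding clin_def
proof (intro allI)
  fix c w
  show "adj B (cscale c w) = cscale c (adj B w)"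
  proof (rule l2_inner_eqI)
    fix u
    have "u \<bullet> adj B (cscale c w) = cscale (cnj c) (B u) \<bullet> w"
      by (simp add: adj_right[symmetric] cscale_inner)
    also have "\<dots> = cscale (cnj c) u \<bullet> adj B w"
      using assms by (simp add: clin_def flip: adj_right)
    finally show "u \<bullet> adj B (cscale c w) = u \<bullet> cscale c (adj B w)" by (simp add: cscale_inner)
  qed
qed

lemma clin_abs_sq: "clin B \<Longrightarrow> clin (abs_sq B)"
  by (simp add: abs_sq_def clin_compose clin_adj)

lemma clin_fcalc:
  assumes "positive_op A" "clin A" "continuous_on {0..} f"
  shows "clin (fcalc A f)"
  unfolding clin_def
proof (intro allI)
  fix c v
  have "fcalc A f (Blinfun (cscale c) v) = Blinfun (cscale c) (fcalc A f v)"
    by (rule fcalc_intertwine[OF assms(1,1,3)])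
      (use assms(2) in \<open>simp add: bounded_linear_Blinfun_apply[OF bounded_linear_cscale] clin_def\<close>)
  then show "fcalc A f (cscale c v) = cscale c (fcalc A f v)"
    by (simp add: bounded_linear_Blinfun_apply[OF bounded_linear_cscale])
qed

subsection \<open>Hilbert-Schmidt bounds\<close>

text \<open>
  A bound for the finite partial sums stands for a bound of the possibly infinite Hilbert-Schmidt
  norm. It saves all summability conditions.
\<close>

definition hs_le :: "('i l2 \<Rightarrow>\<^sub>L 'h::real_normed_vector) \<Rightarrow> real \<Rightarrow> bool" where
  "hs_le B c \<longleftrightarrow> (\<forall>F. finite F \<longrightarrow> (\<Sum>i\<in>F. (norm (B (single i 1)))\<^sup>2) \<le> c)"

lemma hs_leD: "hs_le B c \<Longrightarrow> finite F \<Longrightarrow> (\<Sum>i\<in>F. (norm (blinfun_apply B (single i 1)))\<^sup>2) \<le> c"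
  by (simp add: hs_le_def)

lemma hs_le_nonneg: "hs_le B c \<Longrightarrow> 0 \<le> c"
  using hs_leD[of B c "{}"] by simp

lemma hs_le_left:
  assumes "hs_le B c" "norm A \<le> a"
  shows "hs_le (A o\<^sub>L B) (a\<^sup>2 * c)"
  unfolding hs_le_def
proof (intro allI impI)
  fix F assume F: "finite (F :: 'a set)"
  have "(\<Sum>i\<in>F. (norm ((A o\<^sub>L B) (single i 1)))\<^sup>2) \<le> (\<Sum>i\<in>F. a\<^sup>2 * (norm (B (single i 1)))\<^sup>2)"
  proof (rule sum_mono)
    fix i
    have "norm (A (B (single i 1))) \<le> a * norm (B (single i 1))"
      by (rule order_trans[OF norm_blinfun]) (use assms(2) in \<open>simp add: mult_right_mono\<close>)
    from power_mono[OF this norm_ge_zero, of 2]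
    show "(norm ((A o\<^sub>L B) (single i 1)))\<^sup>2 \<le> a\<^sup>2 * (norm (B (single i 1)))\<^sup>2"
      by (simp add: power_mult_distrib)
  qed
  also have "\<dots> \<le> a\<^sup>2 * c"
    using hs_leD[OF assms(1) F] by (simp add: sum_distrib_left[symmetric] mult_left_mono)
  finally show "(\<Sum>i\<in>F. (norm ((A o\<^sub>L B) (single i 1)))\<^sup>2) \<le> a\<^sup>2 * c" .
qed

lemma coord_clin:
  assumes "clin B"
  shows "coord (adj B (single k 1)) i = cnj (coord (B (single i 1)) k)"
proof -
  have "c \<bullet> coord (adj B (single k 1)) i = c \<bullet> cnj (coord (B (single i 1)) k)" for c
  proof -
    have "single i c = cscale c (single i 1)" by (simp flip: single_cscale)
    then have "B (single i c) = cscale c (B (single i 1))" using assms by (simp add: clin_def)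
    then have "B (single i c) \<bullet> single k 1 = c \<bullet> cnj (coord (B (single i 1)) k)"
      by (simp add: inner_single_right inner_complex_def)
    then show ?thesis by (simp add: adj_right inner_single_left)
  qed
  then show ?thesis by (rule l2_inner_eqI)
qed

lemma has_sum_finite_sum:
  fixes f :: "'k \<Rightarrow> 'i \<Rightarrow> real"
  assumes "\<And>k. (f k has_sum s k) A"
  shows "((\<lambda>i. \<Sum>k\<in>F. f k i) has_sum (\<Sum>k\<in>F. s k)) A"
  by (induction F rule: infinite_finite_induct) (auto intro!: has_sum_add assms)

text \<open>
  Both sides are the same double sum of squared matrix entries, with the order of summation
  exchanged.
\<close>

lemma hs_le_adj:
  assumes B: "clin B" and c: "hs_le B c"
  shows "hs_le (adj B) c"
  unfolding hs_le_def
proof (intro allI impI)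
  fix F assume F: "finite (F :: 'b set)"
  have "((\<lambda>i. \<Sum>k\<in>F. (cmod (coord (adj B (single k 1)) i))\<^sup>2) has_sum
      (\<Sum>k\<in>F. (norm (adj B (single k 1)))\<^sup>2)) UNIV"
    by (intro has_sum_finite_sum norm_sq_has_sum)
  then show "(\<Sum>k\<in>F. (norm (adj B (single k 1)))\<^sup>2) \<le> c"
  proof (rule has_sum_le_finite_sums)
    fix G :: "'a set" assume G: "finite G"
    have "(\<Sum>i\<in>G. \<Sum>k\<in>F. (cmod (coord (adj B (single k 1)) i))\<^sup>2) =
        (\<Sum>i\<in>G. \<Sum>k\<in>F. (cmod (coord (B (single i 1)) k))\<^sup>2)"
      by (simp add: coord_clin[OF B])
    also have "\<dots> \<le> (\<Sum>i\<in>G. (norm (B (single i 1)))\<^sup>2)"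
      by (intro sum_mono sum_coord_le F)
    also have "\<dots> \<le> c" by (rule hs_leD[OF c G])
    finally show "(\<Sum>i\<in>G. \<Sum>k\<in>F. (cmod (coord (adj B (single k 1)) i))\<^sup>2) \<le> c" .
  qed
qed

lemma hs_le_right:
  assumes "clin A" "clin B" "hs_le B c" "norm A \<le> a"
  shows "hs_le (B o\<^sub>L A) (a\<^sup>2 * c)"
proof -
  have "hs_le (adj A o\<^sub>L adj B) (a\<^sup>2 * c)"
    by (rule hs_le_left[OF hs_le_adj[OF assms(2,3)] order_trans[OF norm_adj_le assms(4)]])
  then have "hs_le (adj (B o\<^sub>L A)) (a\<^sup>2 * c)" by (simp add: adj_compose)
  from hs_le_adj[OF _ this] show ?thesis
    using assms by (simp add: adj_adj clin_adj clin_compose)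
qed

lemma norm_le_hs:
  assumes B: "clin (B :: 'i l2 \<Rightarrow>\<^sub>L 'j l2)" and c: "hs_le B c"
  shows "norm B \<le> sqrt c"
proof (rule norm_blinfun_bound)
  show "0 \<le> sqrt c" using hs_le_nonneg[OF c] by simp
  fix v :: "'i l2"
  have "((\<lambda>i. B (single i (coord v i))) has_sum B v) UNIV"
    by (rule has_sum_bounded_linear[OF blinfun.bounded_linear_right has_sum_single])
  then have lim: "((\<lambda>F. norm (\<Sum>i\<in>F. B (single i (coord v i)))) \<longlongrightarrow> norm (B v))
      (finite_subsets_at_top UNIV)"
    unfolding has_sum_def by (rule tendsto_norm)
  show "norm (B v) \<le> sqrt c * norm v"
  proof (rule tendsto_upperbound[OF lim])
    show "\<forall>\<^sub>F F in finite_subsets_at_top UNIV. norm (\<Sum>i\<in>F. B (single i (coord v i))) \<le> sqrt c * norm v"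
    proof (rule eventually_finite_subsets_at_top_weakI)
      fix F :: "'i set" assume F: "finite F"
      have Bs: "norm (B (single i (coord v i))) = cmod (coord v i) * norm (B (single i 1))" for i
      proof -
        have "single i (coord v i) = cscale (coord v i) (single i 1)" by (simp flip: single_cscale)
        then have "B (single i (coord v i)) = cscale (coord v i) (B (single i 1))"
          using B by (simp add: clin_def)
        moreover have "(norm (cscale a w))\<^sup>2 = (cmod a * norm w)\<^sup>2" for a and w :: "'j l2"
        proof -
          have "((\<lambda>i. (cmod a)\<^sup>2 * (cmod (coord w i))\<^sup>2) has_sum (cmod a)\<^sup>2 * (norm w)\<^sup>2) UNIV"
            by (intro has_sum_cmult_right norm_sq_has_sum)
          with norm_sq_has_sum[of "cscale a w"] show ?thesis
            by (simp add: norm_mult power_mult_distrib has_sum_unique)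
        qed
        ultimately show ?thesis by simp
      qed
      have "norm (\<Sum>i\<in>F. B (single i (coord v i))) \<le> (\<Sum>i\<in>F. \<bar>cmod (coord v i)\<bar> * \<bar>norm (B (single i 1))\<bar>)"
        by (rule order_trans[OF norm_sum]) (simp add: Bs)
      also have "\<dots> \<le> L2_set (\<lambda>i. cmod (coord v i)) F * L2_set (\<lambda>i. norm (B (single i 1))) F"
        by (rule L2_set_mult_ineq)
      also have "\<dots> \<le> norm v * sqrt c"
        using sum_coord_le[OF F, of v] hs_leD[OF c F]
        by (intro mult_mono) (auto simp: L2_set_def real_le_lsqrt sum_nonneg hs_le_nonneg[OF c])
      finally show "norm (\<Sum>i\<in>F. B (single i (coord v i))) \<le> sqrt c * norm v"
        by (simp add: mult.commute)
    qed
  qed simp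
qed

section \<open>Schatten classes of operators\<close>

definition diag :: "('i l2 \<Rightarrow>\<^sub>L 'i l2) \<Rightarrow> 'i \<Rightarrow> real" where
  "diag A i = single i 1 \<bullet> A (single i 1)"

text \<open>
  This is \<open>|B|\<^sup>p\<close>, as a function of \<open>|B|\<^sup>2 = B\<^sup>* B\<close>.
\<close>

definition spow :: "real \<Rightarrow> ('i l2 \<Rightarrow>\<^sub>L 'j l2) \<Rightarrow> ('i l2 \<Rightarrow>\<^sub>L 'i l2)" where
  "spow p B = fcalc (abs_sq B) (\<lambda>t. t powr (p / 2))"

definition tr_le :: "('i l2 \<Rightarrow>\<^sub>L 'i l2) \<Rightarrow> real \<Rightarrow> bool" where
  "tr_le A c \<longleftrightarrow> (\<forall>F. finite F \<longrightarrow> (\<Sum>i\<in>F. diag A i) \<le> c)"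

lemma tr_leD: "tr_le A c \<Longrightarrow> finite F \<Longrightarrow> (\<Sum>i\<in>F. diag A i) \<le> c"
  by (simp add: tr_le_def)

lemma tr_leI: "(\<And>F. finite F \<Longrightarrow> (\<Sum>i\<in>F. diag A i) \<le> c) \<Longrightarrow> tr_le A c"
  by (simp add: tr_le_def)

lemma tr_le_nonneg: "tr_le A c \<Longrightarrow> 0 \<le> c"
  using tr_leD[of A c "{}"] by simp

lemma tr_le_mono: "tr_le A c \<Longrightarrow> c \<le> d \<Longrightarrow> tr_le A d"
  by (auto simp: tr_le_def intro: order_trans)

lemma tr_le_diag_mono:
  assumes "tr_le A c" "\<And>i. diag B i \<le> diag A i"
  shows "tr_le B c"
proof (rule tr_leI)
  fix F assume F: "finite (F :: 'a set)"
  have "(\<Sum>i\<in>F. diag B i) \<le> (\<Sum>i\<in>F. diag A i)" by (intro sum_mono assms)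
  also have "\<dots> \<le> c" by (rule tr_leD[OF assms(1) F])
  finally show "(\<Sum>i\<in>F. diag B i) \<le> c" .
qed

lemma tr_le_diag_scale:
  assumes "tr_le A c" "\<And>i. diag B i \<le> r * diag A i" "0 \<le> r"
  shows "tr_le B (r * c)"
proof (rule tr_leI)
  fix F assume F: "finite (F :: 'a set)"
  have "(\<Sum>i\<in>F. diag B i) \<le> (\<Sum>i\<in>F. r * diag A i)" by (intro sum_mono assms)
  also have "\<dots> = r * (\<Sum>i\<in>F. diag A i)" by (simp add: sum_distrib_left)
  also have "\<dots> \<le> r * c" by (intro mult_left_mono tr_leD[OF assms(1) F] assms)
  finally show "(\<Sum>i\<in>F. diag B i) \<le> r * c" .
qed

lemma diag_add: "diag (A + B) i = diag A i + diag B i"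
  by (simp add: diag_def blinfun.bilinear_simps inner_add_right)

lemma diag_scaleR: "diag (r *\<^sub>R A) i = r * diag A i"
  by (simp add: diag_def blinfun.bilinear_simps)

lemma diag_sum: "diag (\<Sum>k\<in>K. A k) i = (\<Sum>k\<in>K. diag (A k) i)"
  by (simp add: diag_def blinfun.sum_left inner_sum_right)

lemma diag_const: "positive_op A \<Longrightarrow> diag (fcalc A (\<lambda>_. c)) i = c"
  by (simp add: diag_def fcalc_const blinfun.bilinear_simps inner_single_left coord_single)

lemma diag_le_norm: "diag A i \<le> norm A"
  unfolding diag_def by (rule order_trans[OF inner_le_norm_op]) simp

lemma hs_le_iff_tr_le: "hs_le B c \<longleftrightarrow> tr_le (abs_sq B) c"
  by (simp add: hs_le_def tr_le_def diag_def abs_sq_form power2_norm_eq_inner)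

lemma continuous_on_powr_nonneg:
  assumes "0 < a" "S \<subseteq> {0..}"
  shows "continuous_on S (\<lambda>t::real. t powr a)"
  by (intro continuous_on_powr' continuous_on_id continuous_on_const) (use assms in auto)

lemma abs_sq_compose_fcalc_form:
  assumes f: "continuous_on {0..norm (abs_sq X)} f" and g: "continuous_on {0..norm (abs_sq X)} g"
  shows "X (fcalc (abs_sq X) f v) \<bullet> X (fcalc (abs_sq X) g w) =
    v \<bullet> fcalc (abs_sq X) (\<lambda>t. t * (f t * g t)) w"
proof -
  note P = positive_abs_sq[of X]
  have id: "continuous_on {0..norm (abs_sq X)} (\<lambda>t. t)" by (intro continuous_intros)
  have fg: "continuous_on {0..norm (abs_sq X)} (\<lambda>t. f t * g t)" by (intro continuous_intros f g)
  have gt: "continuous_on {0..norm (abs_sq X)} (\<lambda>t. t * g t)" by (intro continuous_intros g)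
  have "X (fcalc (abs_sq X) f v) \<bullet> X (fcalc (abs_sq X) g w) =
      fcalc (abs_sq X) f v \<bullet> abs_sq X (fcalc (abs_sq X) g w)"
    by (simp add: abs_sq_form)
  also have "abs_sq X (fcalc (abs_sq X) g w) = fcalc (abs_sq X) (\<lambda>t. t * g t) w"
    by (simp add: fcalc_mult[OF P id g] fcalc_ident[OF P])
  also have "fcalc (abs_sq X) f v \<bullet> fcalc (abs_sq X) (\<lambda>t. t * g t) w =
      v \<bullet> fcalc (abs_sq X) (\<lambda>t. f t * (t * g t)) w"
    by (rule fcalc_mult_form[OF P f gt, symmetric])
  finally show ?thesis by (simp add: algebra_simps)
qed

lemma abs_sq_compose_fcalc:
  assumes f: "continuous_on {0..norm (abs_sq X)} f"
  shows "abs_sq (X o\<^sub>L fcalc (abs_sq X) f) = fcalc (abs_sq X) (\<lambda>t. t * (f t)\<^sup>2)"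
  by (rule blinfun_eqI, rule l2_inner_eqI)
    (simp add: abs_sq_form abs_sq_compose_fcalc_form[OF f f] power2_eq_square)

lemma norm_compose_fcalc_le:
  assumes f: "continuous_on {0..norm (abs_sq X)} f" and c: "0 \<le> c"
    and le: "\<And>t. 0 \<le> t \<Longrightarrow> t \<le> norm (abs_sq X) \<Longrightarrow> t * (f t)\<^sup>2 \<le> c\<^sup>2"
  shows "norm (X o\<^sub>L fcalc (abs_sq X) f) \<le> c"
proof (rule norm_blinfun_bound)
  fix v
  have "(norm ((X o\<^sub>L fcalc (abs_sq X) f) v))\<^sup>2 = v \<bullet> fcalc (abs_sq X) (\<lambda>t. t * (f t)\<^sup>2) v"
    unfolding power2_norm_eq_inner
    by (simp add: abs_sq_compose_fcalc_form[OF f f] power2_eq_square)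
  also have "\<dots> \<le> v \<bullet> fcalc (abs_sq X) (\<lambda>_. c\<^sup>2) v"
    by (rule fcalc_mono[OF positive_abs_sq]) (use le in \<open>auto intro!: continuous_intros f\<close>)
  also have "\<dots> = (c * norm v)\<^sup>2"
    by (simp add: fcalc_const[OF positive_abs_sq] blinfun.bilinear_simps power_mult_distrib power2_norm_eq_inner)
  finally show "norm ((X o\<^sub>L fcalc (abs_sq X) f) v) \<le> c * norm v"
    by (rule power2_le_imp_le) (simp add: c)
qed (rule c)

lemma norm_abs_sq: "norm (abs_sq X) \<le> (norm X)\<^sup>2"
proof -
  have "norm (abs_sq X) \<le> norm (adj X) * norm X"
    unfolding abs_sq_def by (rule norm_blinfun_compose)
  also have "\<dots> \<le> norm X * norm X" by (intro mult_right_mono norm_adj_le) simp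
  finally show ?thesis by (simp add: power2_eq_square)
qed

lemma diag_fcalc_mono:
  assumes "positive_op A" "continuous_on {0..norm A} f" "continuous_on {0..norm A} g"
    and "\<And>t. 0 \<le> t \<Longrightarrow> t \<le> norm A \<Longrightarrow> f t \<le> g t"
  shows "diag (fcalc A f) i \<le> diag (fcalc A g) i"
  unfolding diag_def by (rule fcalc_mono[OF assms])

lemma diag_fcalc_nonneg:
  assumes "positive_op A" "continuous_on {0..norm A} f"
    and "\<And>t. 0 \<le> t \<Longrightarrow> t \<le> norm A \<Longrightarrow> 0 \<le> f t"
  shows "0 \<le> diag (fcalc A f) i"
  unfolding diag_def by (rule fcalc_nonneg[OF assms])

lemma diag_spow_nonneg: "0 < p \<Longrightarrow> 0 \<le> diag (spow p X) i"
  unfolding spow_def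
  by (rule diag_fcalc_nonneg[OF positive_abs_sq]) (auto intro!: continuous_on_powr_nonneg)

lemma clin_spow: "clin X \<Longrightarrow> 0 < p \<Longrightarrow> clin (spow p X)"
  unfolding spow_def by (intro clin_fcalc positive_abs_sq clin_abs_sq continuous_on_powr_nonneg) auto

lemma norm_spow_le:
  assumes "0 < p"
  shows "norm (spow p X) \<le> norm X powr p"
  unfolding spow_def
proof (rule fcalc_norm_le[OF positive_abs_sq])
  fix t assume t: "0 \<le> t" "t \<le> norm (abs_sq X)"
  then have "t \<le> (norm X)\<^sup>2" using norm_abs_sq[of X] by simp
  then have "t powr (p / 2) \<le> ((norm X)\<^sup>2) powr (p / 2)"
    using assms t by (intro powr_mono2) auto
  also have "\<dots> = norm X powr p"
    by (simp add: powr_powr powr_realpow' flip: powr_numeral)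
  finally show "\<bar>t powr (p / 2)\<bar> \<le> norm X powr p" by simp
qed (use assms in \<open>auto intro!: continuous_on_powr_nonneg\<close>)

text \<open>
  The operator norm is recovered from the trace of \<open>|B|\<^sup>p\<close> because \<open>|B|\<^sup>2\<close> is in turn a power of
  \<open>|B|\<^sup>p\<close>, and a positive operator is bounded by its trace.
\<close>

lemma norm_le_trace_powr:
  assumes p: "0 < p" and X: "clin X" and c: "tr_le (spow p X) c"
  shows "norm X \<le> c powr (1 / p)"
proof -
  let ?C = "abs_sq X"
  note P = positive_abs_sq[of X]
  have c0: "0 \<le> c" by (rule tr_le_nonneg[OF c])
  have c4: "continuous_on {0..norm ?C} (\<lambda>t. t powr (p / 4))"
    using p by (intro continuous_on_powr_nonneg) auto
  have c2: "continuous_on {0..norm ?C} (\<lambda>t. t powr (p / 2))"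
    using p by (intro continuous_on_powr_nonneg) auto
  define R where "R = fcalc ?C (\<lambda>t. t powr (p / 4))"
  have RR: "v \<bullet> spow p X v = (norm (R v))\<^sup>2" for v
    unfolding power2_norm_eq_inner R_def spow_def fcalc_mult_form[OF P c4 c4, symmetric]
    by (simp flip: powr_add)
  have "clin R" unfolding R_def using p
    by (intro clin_fcalc P clin_abs_sq X continuous_on_powr_nonneg) auto
  moreover have "hs_le R c"
    unfolding hs_le_def using c by (simp add: tr_le_def diag_def RR)
  ultimately have nR: "norm R \<le> sqrt c" by (rule norm_le_hs)
  have "spow p X = R o\<^sub>L R"
    unfolding spow_def R_def fcalc_mult[OF P c4 c4, symmetric] by (simp flip: powr_add)
  then have "norm (spow p X) \<le> norm R * norm R"
    using norm_blinfun_compose[of R R] by simp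
  also have "\<dots> \<le> sqrt c * sqrt c" using nR c0 by (intro mult_mono) auto
  finally have nS: "norm (spow p X) \<le> c" using c0 by simp
  have "fcalc (spow p X) (\<lambda>s. s powr (2 / p)) = fcalc ?C (\<lambda>t. (t powr (p / 2)) powr (2 / p))"
    unfolding spow_def by (rule fcalc_compose[OF P c2]) (use p in \<open>auto intro!: continuous_on_powr_nonneg\<close>)
  also have "\<dots> = fcalc ?C (\<lambda>t. t)"
    by (rule fcalc_cong) (use p in \<open>simp add: powr_powr\<close>)
  finally have C: "?C = fcalc (spow p X) (\<lambda>s. s powr (2 / p))" by (simp add: fcalc_ident[OF P])
  have nC: "norm ?C \<le> c powr (2 / p)"
    unfolding C
  proof (rule fcalc_norm_le)
    show "positive_op (spow p X)" unfolding spow_def by (rule positive_op_fcalc[OF P c2]) simp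
    show "\<bar>s powr (2 / p)\<bar> \<le> c powr (2 / p)" if "0 \<le> s" "s \<le> norm (spow p X)" for s
      using that nS p by (simp add: powr_mono2)
  qed (use p in \<open>auto intro!: continuous_on_powr_nonneg\<close>)
  show ?thesis
  proof (rule norm_blinfun_bound)
    fix v
    have "(norm (X v))\<^sup>2 = v \<bullet> ?C v" by (simp add: abs_sq_form power2_norm_eq_inner)
    also have "\<dots> \<le> norm ?C * (norm v)\<^sup>2" by (rule inner_le_norm_op)
    also have "\<dots> \<le> c powr (2 / p) * (norm v)\<^sup>2" by (intro mult_right_mono nC) simp
    also have "\<dots> = (c powr (1 / p) * norm v)\<^sup>2"
      by (simp add: power_mult_distrib power2_eq_square flip: powr_add)
    finally show "norm (X v) \<le> c powr (1 / p) * norm v" by (rule power2_le_imp_le) simp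
  qed simp
qed

text \<open>
  Let \<open>s\<close> be the inverse of \<open>|Z|\<close>, regularised by a small \<open>d > 0\<close>. Then \<open>|Z|\<close> is close to \<open>s Z\<^sup>* Z\<close>, that is, to
  \<open>(s Z\<^sup>* U) W\<close>. As \<open>s Z\<^sup>*\<close> is a contraction, both factors have bounded Hilbert-Schmidt norm, and the
  Cauchy-Schwarz inequality bounds the sum of the diagonal entries.
\<close>

lemma trace_norm_product:
  assumes U: "clin U" "hs_le U a" and W: "clin W" "hs_le W b"
  shows "tr_le (spow 1 (U o\<^sub>L W)) (sqrt a * sqrt b)"
proof (rule tr_leI)
  fix F :: "'c set" assume F: "finite F"
  define Z where "Z = U o\<^sub>L W"
  let ?C = "abs_sq Z"
  note P = positive_abs_sq[of Z]
  have Z: "clin Z" unfolding Z_def by (intro clin_compose U W)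
  show "(\<Sum>i\<in>F. diag (spow 1 (U o\<^sub>L W)) i) \<le> sqrt a * sqrt b"
  proof (rule field_le_epsilon)
    fix e :: real assume e: "e > 0"
    define d where "d = e / (real (card F) + 1)"
    have d: "d > 0" using e by (simp add: d_def)
    define s where "s = (\<lambda>t. 1 / (sqrt t + d))"
    have pos: "sqrt t + d > 0" if "0 \<le> t" for t using that d by (simp add: add_nonneg_pos)
    have s0: "continuous_on {0..} s"
      unfolding s_def using pos by (intro continuous_intros) force
    then have s: "continuous_on {0..norm ?C} s" by (rule continuous_on_subset) auto
    have ts: "continuous_on {0..norm ?C} (\<lambda>t. t * s t)" by (intro continuous_intros s)
    \<comment> \<open>the diagonal of \<open>s(|Z|\<^sup>2) Z\<^sup>* U W\<close> pairs the columns of \<open>W\<close> with those of \<open>D\<close>\<close>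
    define D where "D = adj U o\<^sub>L (Z o\<^sub>L fcalc ?C s)"
    have "hs_le D (1\<^sup>2 * a)"
      unfolding D_def
    proof (rule hs_le_right)
      show "clin (Z o\<^sub>L fcalc ?C s)" by (intro clin_compose Z clin_fcalc P clin_abs_sq s0)
      show "clin (adj U)" "hs_le (adj U) a" by (intro clin_adj hs_le_adj U)+
      show "norm (Z o\<^sub>L fcalc ?C s) \<le> 1"
      proof (rule norm_compose_fcalc_le[OF s])
        fix t :: real assume t: "0 \<le> t"
        have "(sqrt t)\<^sup>2 \<le> (sqrt t + d)\<^sup>2" using d t by (intro power_mono) auto
        then show "t * (s t)\<^sup>2 \<le> 1\<^sup>2" using t pos[OF t]
          by (simp add: s_def power_divide divide_le_eq)
      qed simp
    qed
    then have D: "hs_le D a" by simp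
    have diag_ts: "diag (fcalc ?C (\<lambda>t. t * s t)) i = W (single i 1) \<bullet> D (single i 1)" for i
    proof -
      have one: "continuous_on {0..norm ?C} (\<lambda>_. 1 :: real)" by (intro continuous_intros)
      have "Z (fcalc ?C (\<lambda>_. 1) (single i 1)) \<bullet> Z (fcalc ?C s (single i 1)) =
          single i 1 \<bullet> fcalc ?C (\<lambda>t. t * (1 * s t)) (single i 1)"
        by (rule abs_sq_compose_fcalc_form[OF one s])
      then show ?thesis
        by (simp add: diag_def fcalc_const[OF P] blinfun.bilinear_simps D_def)
          (simp add: Z_def adj_right)
    qed
    have "diag (spow 1 Z) i \<le> W (single i 1) \<bullet> D (single i 1) + d" for i
    proof -
      have c2: "continuous_on {0..norm ?C} (\<lambda>t. t powr (1 / 2))"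
        by (intro continuous_on_powr_nonneg) auto
      have "diag (fcalc ?C (\<lambda>t. t powr (1 / 2))) i \<le> diag (fcalc ?C (\<lambda>t. t * s t + d)) i"
      proof (rule diag_fcalc_mono[OF P c2])
        fix t :: real assume t: "0 \<le> t"
        have "sqrt t * (sqrt t + d) \<le> t + d * (sqrt t + d)"
          using t by (simp add: algebra_simps)
        then have "sqrt t \<le> t * s t + d" using pos[OF t]
          by (simp add: s_def field_simps)
        then show "t powr (1 / 2) \<le> t * s t + d" using t by (simp add: powr_half_sqrt)
      qed (intro continuous_intros s)
      also have "\<dots> = diag (fcalc ?C (\<lambda>t. t * s t)) i + d"
        by (simp add: fcalc_add[OF P ts continuous_on_const] diag_add diag_const[OF P])
      finally show ?thesis by (simp add: spow_def diag_ts)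
    qed
    then have "(\<Sum>i\<in>F. diag (spow 1 Z) i) \<le> (\<Sum>i\<in>F. W (single i 1) \<bullet> D (single i 1) + d)"
      by (rule sum_mono)
    also have "\<dots> = (\<Sum>i\<in>F. W (single i 1) \<bullet> D (single i 1)) + real (card F) * d"
      by (simp add: sum.distrib)
    also have "(\<Sum>i\<in>F. W (single i 1) \<bullet> D (single i 1)) \<le>
        (\<Sum>i\<in>F. \<bar>norm (D (single i 1))\<bar> * \<bar>norm (W (single i 1))\<bar>)"
      by (rule sum_mono) (simp add: norm_cauchy_schwarz mult.commute[of "norm (D _)"])
    also have "\<dots> \<le> L2_set (\<lambda>i. norm (D (single i 1))) F * L2_set (\<lambda>i. norm (W (single i 1))) F"
      by (rule L2_set_mult_ineq)
    also have "\<dots> \<le> sqrt a * sqrt b"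
      using hs_leD[OF D F] hs_leD[OF W(2) F] hs_le_nonneg[OF D]
      by (intro mult_mono) (auto simp: L2_set_def sum_nonneg)
    also have "real (card F) * d \<le> e" using e by (simp add: d_def field_simps)
    finally show "(\<Sum>i\<in>F. diag (spow 1 (U o\<^sub>L W)) i) \<le> sqrt a * sqrt b + e"
      by (simp add: Z_def)
  qed
qed

text \<open>
  This is \<open>|Z|\<^sup>p \<le> \<parallel>Z\<parallel>\<^sup>p\<^sup>-\<^sup>1 |Z|\<close>, read on the diagonal.
\<close>

lemma spow_le_of_trace_norm:
  assumes p: "1 < p" and c: "tr_le (spow 1 Z) c"
  shows "tr_le (spow p Z) (norm Z powr (p - 1) * c)"
proof (rule tr_le_diag_scale[OF c])
  let ?C = "abs_sq Z"
  note P = positive_abs_sq[of Z]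
  fix i
  have c1: "continuous_on {0..norm ?C} (\<lambda>t. t powr (1 / 2))"
    by (intro continuous_on_powr_nonneg) auto
  have "diag (spow p Z) i \<le> diag (fcalc ?C (\<lambda>t. norm Z powr (p - 1) * t powr (1 / 2))) i"
    unfolding spow_def
  proof (rule diag_fcalc_mono[OF P])
    fix t assume t: "0 \<le> t" "t \<le> norm ?C"
    then have "t \<le> (norm Z)\<^sup>2" using norm_abs_sq[of Z] by simp
    then have "t powr ((p - 1) / 2) \<le> ((norm Z)\<^sup>2) powr ((p - 1) / 2)"
      using p t by (intro powr_mono2) auto
    also have "\<dots> = norm Z powr (p - 1)"
      by (simp add: powr_powr diff_divide_distrib flip: powr_numeral)
    finally have "t powr ((p - 1) / 2) * t powr (1 / 2) \<le> norm Z powr (p - 1) * t powr (1 / 2)"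
      by (intro mult_right_mono) auto
    then show "t powr (p / 2) \<le> norm Z powr (p - 1) * t powr (1 / 2)"
      by (simp add: diff_divide_distrib flip: powr_add)
  qed (use p in \<open>auto intro!: continuous_intros continuous_on_powr_nonneg\<close>)
  also have "\<dots> = norm Z powr (p - 1) * diag (spow 1 Z) i"
    by (simp add: fcalc_scale[OF P c1] diag_scaleR spow_def)
  finally show "diag (spow p Z) i \<le> norm Z powr (p - 1) * diag (spow 1 Z) i" .
qed simp

lemma poly_op_kernel: "blinfun_apply A v = 0 \<Longrightarrow> poly_op q A v = poly q 0 *\<^sub>R v"
proof (induction q)
  case (pCons c q)
  then show ?case by (simp add: blinfun.bilinear_simps)
qed (simp add: blinfun.bilinear_simps)

lemma fcalc_kernel:
  assumes A: "positive_op A" and f: "continuous_on {0..norm A} f" and v: "blinfun_apply A v = 0"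
  shows "fcalc A f v = f 0 *\<^sub>R v"
proof -
  obtain q where q: "uniform_limit {0..norm A} (\<lambda>n. poly (q n)) f sequentially"
    "\<And>v. (\<lambda>n. poly_op (q n) A v) \<longlonglongrightarrow> fcalc A f v"
    using fcalc_approx[OF A f] by metis
  have "(\<lambda>n. poly (q n) 0) \<longlonglongrightarrow> f 0"
    by (rule tendsto_uniform_limitI[OF q(1)]) simp
  then have "(\<lambda>n. poly (q n) 0 *\<^sub>R v) \<longlonglongrightarrow> f 0 *\<^sub>R v" by (intro tendsto_intros)
  with q(2)[of v] show ?thesis by (simp add: poly_op_kernel[OF v] LIMSEQ_unique)
qed

lemma diag_spow_kernel:
  assumes "0 < p" "blinfun_apply X (single i 1) = 0"
  shows "diag (spow p X) i = 0"
proof -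
  have "abs_sq X (single i 1) = 0" using assms by (simp add: abs_sq_def blinfun.bilinear_simps)
  then have "spow p X (single i 1) = 0"
    unfolding spow_def using assms
    by (subst fcalc_kernel[OF positive_abs_sq]) (auto intro!: continuous_on_powr_nonneg)
  then show ?thesis by (simp add: diag_def)
qed

text \<open>
  A basis vector outside \<open>F\<close> is in the kernel of \<open>|Z|\<^sup>p\<close>, and any other diagonal entry is at most
  \<open>\<parallel>Z\<parallel>\<^sup>p\<close>.
\<close>

lemma tr_le_finite_columns:
  fixes Z :: "'i l2 \<Rightarrow>\<^sub>L 'j l2"
  assumes p: "0 < p" and F: "finite F" and Z: "\<And>i. i \<notin> F \<Longrightarrow> blinfun_apply Z (single i 1) = 0"
  shows "tr_le (spow p Z) (card F * norm Z powr p)"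
proof (rule tr_leI)
  fix G :: "'i set" assume G: "finite G"
  have "(\<Sum>i\<in>G. diag (spow p Z) i) = (\<Sum>i\<in>G \<inter> F. diag (spow p Z) i)"
    using G by (intro sum.mono_neutral_right) (auto intro: diag_spow_kernel[OF p] Z)
  also have "\<dots> \<le> (\<Sum>i\<in>F. diag (spow p Z) i)"
    using F by (intro sum_mono2) (auto simp: diag_spow_nonneg[OF p])
  also have "\<dots> \<le> (\<Sum>i\<in>F. norm Z powr p)"
    by (intro sum_mono order_trans[OF diag_le_norm] norm_spow_le p)
  finally show "(\<Sum>i\<in>G. diag (spow p Z) i) \<le> card F * norm Z powr p" by simp
qed

lemma spow_compose_fcalc:
  assumes f: "continuous_on {0..norm (abs_sq X)} f" and p: "0 < p"
  shows "spow p (X o\<^sub>L fcalc (abs_sq X) f) = fcalc (abs_sq X) (\<lambda>t. (t * (f t)\<^sup>2) powr (p / 2))"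
  unfolding spow_def abs_sq_compose_fcalc[OF f]
  by (rule fcalc_compose[OF positive_abs_sq])
    (use p in \<open>auto intro!: continuous_intros f continuous_on_powr_nonneg\<close>)

section \<open>The quasi-triangle inequality\<close>

text \<open>
  In terms of \<open>t = |X|\<^sup>2\<close>, \<open>soft l\<close> is \<open>(|X| - l)\<^sub>+\<close>, and \<open>cutoff l\<close> is its quotient by \<open>|X|\<close>. The traces
  of \<open>(|X| - l)\<^sub>+\<close> over all levels \<open>l > 0\<close> determine \<open>Tr |X|\<^sup>p\<close> up to constants, and they are almost
  additive: \<open>Tr (|X + Y| - 2 l)\<^sub>+\<close> is controlled by \<open>Tr (|X| - l)\<^sub>+ + Tr (|Y| - l)\<^sub>+\<close>.
\<close>

definition soft :: "real \<Rightarrow> real \<Rightarrow> real" where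
  "soft l t = max 0 (sqrt t - l)"

definition cutoff :: "real \<Rightarrow> real \<Rightarrow> real" where
  "cutoff l t = soft l t / max (sqrt t) l"

lemma soft_nonneg [simp]: "0 \<le> soft l t"
  by (simp add: soft_def)

lemma max_neq_0: "0 < l \<Longrightarrow> max x l \<noteq> (0::real)"
  by (auto simp: max_def)

lemma continuous_on_soft: "continuous_on S (soft l)"
  unfolding soft_def[abs_def] by (intro continuous_intros)

lemma continuous_on_cutoff: "0 < l \<Longrightarrow> continuous_on S (cutoff l)"
  unfolding cutoff_def[abs_def] by (intro continuous_intros continuous_on_soft) (simp add: max_neq_0)

lemma cutoff_nonneg: "0 < l \<Longrightarrow> 0 \<le> cutoff l t"
  by (simp add: cutoff_def)

lemma cutoff_le_1: "0 < l \<Longrightarrow> cutoff l t \<le> 1"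
  by (simp add: cutoff_def soft_def divide_le_eq less_max_iff_disj) linarith

lemma max_sqrt_sq: "0 \<le> t \<Longrightarrow> t \<le> (max (sqrt t) l)\<^sup>2"
  by (metis max.cobounded1 real_le_lsqrt real_sqrt_ge_zero real_sqrt_le_iff sqrt_le_D)

lemma residual_sq_le: 
  assumes "0 < l" "0 \<le> t"
  shows "t * (1 - cutoff l t)\<^sup>2 \<le> l\<^sup>2"
proof (cases "sqrt t \<le> l")
  case True
  then have "cutoff l t = 0" by (simp add: cutoff_def soft_def)
  moreover have "t \<le> l\<^sup>2" using True sqrt_le_D by blast
  ultimately show ?thesis by simp
next
  case False
  then have t: "sqrt t > 0" using assms by linarith
  have "1 - cutoff l t = l / sqrt t" using False t by (simp add: cutoff_def soft_def max_def field_simps)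
  then show ?thesis using t assms by (simp add: power_divide)
qed

text \<open>
  With \<open>k = cutoff l\<close> as a function of \<open>|X|\<^sup>2\<close>, split \<open>X = X (1 - k) + X k\<close>. The first part has norm at
  most \<open>l\<close>. The second is the product of the adjoint of \<open>soft_left\<close> and \<open>soft_right\<close>; the squares of
  their Hilbert-Schmidt norms are at most \<open>Tr (|X| - l)\<^sub>+\<close>.
\<close>

definition soft_left :: "real \<Rightarrow> ('i l2 \<Rightarrow>\<^sub>L 'j l2) \<Rightarrow> ('j l2 \<Rightarrow>\<^sub>L 'i l2)" where
  "soft_left l X = fcalc (abs_sq X) (\<lambda>t. sqrt (soft l t) / max (sqrt t) l) o\<^sub>L adj X"

definition soft_right :: "real \<Rightarrow> ('i l2 \<Rightarrow>\<^sub>L 'j l2) \<Rightarrow> ('i l2 \<Rightarrow>\<^sub>L 'i l2)" where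
  "soft_right l X = fcalc (abs_sq X) (\<lambda>t. sqrt (soft l t))"

lemma soft_form_bound:
  fixes X :: "'i l2 \<Rightarrow>\<^sub>L 'j l2"
  assumes l: "0 < l"
  shows "2 * (X v \<bullet> w) \<le> l * ((norm v)\<^sup>2 + (norm w)\<^sup>2)
    + (norm (soft_right l X v))\<^sup>2 + (norm (soft_left l X w))\<^sup>2"
proof -
  let ?C = "abs_sq X"
  note P = positive_abs_sq[of X]
  define m where "m = (\<lambda>t. sqrt (soft l t) / max (sqrt t) l)"
  have m: "continuous_on S m" for S
    unfolding m_def using l by (intro continuous_intros continuous_on_soft) (simp add: max_neq_0)
  have sr: "continuous_on S (\<lambda>t. sqrt (soft l t))" for S by (intro continuous_intros continuous_on_soft)
  have res: "continuous_on S (\<lambda>t. 1 - cutoff l t)" for S by (intro continuous_intros continuous_on_cutoff l)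
  have "fcalc ?C (\<lambda>t. m t * sqrt (soft l t) + (1 - cutoff l t)) = fcalc ?C (\<lambda>_. 1)"
    by (rule fcalc_cong) (simp add: m_def cutoff_def)
  moreover have "fcalc ?C (\<lambda>t. m t * sqrt (soft l t) + (1 - cutoff l t)) =
      (fcalc ?C m o\<^sub>L soft_right l X) + fcalc ?C (\<lambda>t. 1 - cutoff l t)"
    unfolding soft_right_def fcalc_mult[OF P m sr, symmetric]
    by (rule fcalc_add[OF P]) (intro continuous_intros m sr res)+
  ultimately have "v = fcalc ?C m (soft_right l X v) + fcalc ?C (\<lambda>t. 1 - cutoff l t) v"
    by (metis blinfun.add_left blinfun_apply_blinfun_compose blinfun_apply_id_blinfun fcalc_const[OF P] scaleR_one)
  then have "X v \<bullet> w = X (fcalc ?C m (soft_right l X v)) \<bullet> w + X (fcalc ?C (\<lambda>t. 1 - cutoff l t) v) \<bullet> w"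
    by (metis blinfun.add_right inner_add_left)
  also have "X (fcalc ?C m (soft_right l X v)) \<bullet> w = soft_right l X v \<bullet> soft_left l X w"
    unfolding adj_right[of X] fcalc_symmetric[OF P m] soft_left_def m_def[symmetric] by simp
  finally have eq: "X v \<bullet> w = soft_right l X v \<bullet> soft_left l X w + X (fcalc ?C (\<lambda>t. 1 - cutoff l t) v) \<bullet> w" .
  have "norm (X o\<^sub>L fcalc ?C (\<lambda>t. 1 - cutoff l t)) \<le> l"
    using l by (intro norm_compose_fcalc_le res residual_sq_le) auto
  then have "norm (X (fcalc ?C (\<lambda>t. 1 - cutoff l t) v)) \<le> l * norm v"
    using order_trans[OF norm_blinfun[of "X o\<^sub>L fcalc ?C (\<lambda>t. 1 - cutoff l t)" v] mult_right_mono]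
    by simp
  then have "norm (X (fcalc ?C (\<lambda>t. 1 - cutoff l t) v)) * norm w \<le> l * norm v * norm w"
    by (rule mult_right_mono) simp
  then have "X (fcalc ?C (\<lambda>t. 1 - cutoff l t) v) \<bullet> w \<le> l * (norm v * norm w)"
    using norm_cauchy_schwarz[of "X (fcalc ?C (\<lambda>t. 1 - cutoff l t) v)" w] by (simp add: mult.assoc)
  moreover have "2 * (l * (norm v * norm w)) \<le> l * ((norm v)\<^sup>2 + (norm w)\<^sup>2)"
    using mult_left_mono[OF sum_squares_bound[of "norm v" "norm w"], of l] l by (simp add: algebra_simps)
  moreover have "2 * (a \<bullet> b) \<le> (norm a)\<^sup>2 + (norm b)\<^sup>2" for a b :: "'i l2"
    using norm_cauchy_schwarz[of a b] sum_squares_bound[of "norm a" "norm b"] by simp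
  note this[of "soft_right l X v" "soft_left l X w"]
  ultimately show ?thesis unfolding eq by simp
qed

lemma hs_soft_right: "tr_le (fcalc (abs_sq X) (soft l)) d \<Longrightarrow> hs_le (soft_right l X) d"
proof -
  assume d: "tr_le (fcalc (abs_sq X) (soft l)) d"
  have sr: "continuous_on S (\<lambda>t. sqrt (soft l t))" for S by (intro continuous_intros continuous_on_soft)
  have "(norm (soft_right l X v))\<^sup>2 = v \<bullet> fcalc (abs_sq X) (\<lambda>t. sqrt (soft l t) * sqrt (soft l t)) v" for v
    by (simp only: soft_right_def power2_norm_eq_inner fcalc_mult_form[OF positive_abs_sq sr sr])
  then show ?thesis using d by (simp add: hs_le_def tr_le_def diag_def)
qed

lemma clin_soft_left: "clin X \<Longrightarrow> 0 < l \<Longrightarrow> clin (soft_left l X)"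
  unfolding soft_left_def
  by (intro clin_compose clin_fcalc clin_adj clin_abs_sq positive_abs_sq continuous_intros continuous_on_soft)
    (simp_all add: max_neq_0)

lemma clin_soft_right: "clin X \<Longrightarrow> clin (soft_right l X)"
  unfolding soft_right_def
  by (intro clin_fcalc clin_abs_sq positive_abs_sq continuous_intros continuous_on_soft)

lemma hs_soft_left:
  assumes X: "clin X" and l: "0 < l" and d: "tr_le (fcalc (abs_sq X) (soft l)) d"
  shows "hs_le (soft_left l X) d"
proof -
  note P = positive_abs_sq[of X]
  define m where "m = (\<lambda>t. sqrt (soft l t) / max (sqrt t) l)"
  have m: "continuous_on S m" for S
    unfolding m_def using l by (intro continuous_intros continuous_on_soft) (simp add: max_neq_0)
  have "hs_le (X o\<^sub>L fcalc (abs_sq X) m) d"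
    unfolding hs_le_iff_tr_le
  proof (rule tr_le_diag_mono[OF d])
    fix i
    show "diag (abs_sq (X o\<^sub>L fcalc (abs_sq X) m)) i \<le> diag (fcalc (abs_sq X) (soft l)) i"
      unfolding abs_sq_compose_fcalc[OF m]
    proof (rule diag_fcalc_mono[OF P])
      fix t :: real assume t: "0 \<le> t"
      have "soft l t * t \<le> soft l t * (max (sqrt t) l)\<^sup>2"
        by (intro mult_left_mono max_sqrt_sq t) simp
      moreover have "max (sqrt t) l > 0" using l by simp
      ultimately show "t * (m t)\<^sup>2 \<le> soft l t"
        by (simp add: m_def power_divide divide_le_eq mult.commute)
    qed (intro continuous_intros m continuous_on_soft)+
  qed
  then have "hs_le (adj (X o\<^sub>L fcalc (abs_sq X) m)) d"
    by (rule hs_le_adj[rotated]) (intro clin_compose X clin_fcalc P clin_abs_sq m)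
  moreover have "adj (X o\<^sub>L fcalc (abs_sq X) m) = soft_left l X"
    unfolding soft_left_def m_def[symmetric] adj_compose
    by (simp add: adj_eqI fcalc_symmetric[OF P m])
  ultimately show ?thesis by simp
qed

text \<open>
  For \<open>Z = X + Y\<close> let \<open>r = cutoff (2 l)\<close> and \<open>s = r / |Z|\<close>, as functions of \<open>|Z|\<^sup>2\<close>, and test \<open>Z\<close> on
  \<open>v = r e\<^sub>i\<close> and \<open>w = Z s e\<^sub>i\<close>, so that \<open>\<langle>Z v, w\<rangle> = \<langle>|Z| r\<^sup>2 e\<^sub>i, e\<^sub>i\<rangle>\<close> and \<open>\<parallel>w\<parallel> \<le> \<parallel>v\<parallel>\<close>. By \<open>soft_form_bound\<close>
  for \<open>X\<close> and for \<open>Y\<close>, twice this number is at most \<open>4 l \<langle>r\<^sup>2 e\<^sub>i, e\<^sub>i\<rangle>\<close>, which turns the factor \<open>|Z|\<close> into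
  \<open>|Z| - 2 l\<close>, plus four squared norms whose sums over \<open>i\<close> are Hilbert-Schmidt norms. The maps
  \<open>e\<^sub>i \<mapsto> v\<close> and \<open>e\<^sub>i \<mapsto> w\<close> are contractions, so these sums do not exceed the given traces.
\<close>

lemma trace_level_sum:
  fixes X Y :: "'i l2 \<Rightarrow>\<^sub>L 'j l2"
  assumes X: "clin X" and Y: "clin Y" and l: "0 < l"
    and a: "tr_le (fcalc (abs_sq X) (soft l)) a" and b: "tr_le (fcalc (abs_sq Y) (soft l)) b"
  shows "tr_le (fcalc (abs_sq (X + Y)) (\<lambda>t. soft (2 * l) t * (cutoff (2 * l) t)\<^sup>2)) (a + b)"
proof (rule tr_leI)
  fix F :: "'i set" assume F: "finite F"
  let ?Z = "X + Y"
  let ?C = "abs_sq ?Z"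
  note P = positive_abs_sq[of ?Z]
  define r where "r = cutoff (2 * l)"
  define s where "s = (\<lambda>t. r t / max (sqrt t) (2 * l))"
  have r: "continuous_on S r" for S unfolding r_def using l by (intro continuous_on_cutoff) auto
  have s: "continuous_on S s" for S
    unfolding s_def using l by (intro continuous_intros r) (simp add: max_neq_0)
  have r01: "0 \<le> r t" "r t \<le> 1" for t unfolding r_def using l by (auto intro: cutoff_nonneg cutoff_le_1)
  have Z: "clin ?Z"
    using X Y by (simp add: clin_def blinfun.bilinear_simps l2_eqI algebra_simps)
  have ts_le: "t * (s t)\<^sup>2 \<le> (r t)\<^sup>2" if t: "0 \<le> t" for t
  proof -
    have "(r t)\<^sup>2 * t \<le> (r t)\<^sup>2 * (max (sqrt t) (2 * l))\<^sup>2"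
      by (intro mult_left_mono max_sqrt_sq t) simp
    moreover have "max (sqrt t) (2 * l) > 0" using l by simp
    ultimately show ?thesis by (simp add: s_def power_divide divide_le_eq mult.commute)
  qed
  define V where "V = fcalc ?C r"
  define W where "W = ?Z o\<^sub>L fcalc ?C s"
  have cV: "clin V" unfolding V_def by (intro clin_fcalc P clin_abs_sq Z r)
  have cW: "clin W" unfolding W_def by (intro clin_compose clin_fcalc P clin_abs_sq Z s)
  have nV: "norm V \<le> 1" unfolding V_def by (rule fcalc_norm_le[OF P r]) (simp add: r01 abs_le_iff)
  have nW: "norm W \<le> 1"
    unfolding W_def
  proof (rule norm_compose_fcalc_le[OF s])
    fix t :: real assume "0 \<le> t"
    from order_trans[OF ts_le[OF this] power_le_one[OF r01]] show "t * (s t)\<^sup>2 \<le> 1\<^sup>2" by simp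
  qed simp
  have hs: "hs_le (soft_right l X o\<^sub>L V) a" "hs_le (soft_left l X o\<^sub>L W) a"
    "hs_le (soft_right l Y o\<^sub>L V) b" "hs_le (soft_left l Y o\<^sub>L W) b"
    using hs_le_right[OF cV clin_soft_right[OF X] hs_soft_right[OF a] nV]
      hs_le_right[OF cW clin_soft_left[OF X l] hs_soft_left[OF X l a] nW]
      hs_le_right[OF cV clin_soft_right[OF Y] hs_soft_right[OF b] nV]
      hs_le_right[OF cW clin_soft_left[OF Y l] hs_soft_left[OF Y l b] nW] by simp_all
  define g where "g = (\<lambda>t. soft (2 * l) t * (cutoff (2 * l) t)\<^sup>2)"
  have rr: "continuous_on S (\<lambda>t. r t * r t)" for S by (intro continuous_intros r)
  have g: "continuous_on S g" for S
    unfolding g_def using l by (intro continuous_intros continuous_on_soft continuous_on_cutoff) auto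
  have key: "2 * diag (fcalc ?C g) i \<le>
      (norm ((soft_right l X o\<^sub>L V) (single i 1)))\<^sup>2 + (norm ((soft_left l X o\<^sub>L W) (single i 1)))\<^sup>2
      + ((norm ((soft_right l Y o\<^sub>L V) (single i 1)))\<^sup>2 + (norm ((soft_left l Y o\<^sub>L W) (single i 1)))\<^sup>2)" for i
  proof -
    let ?v = "V (single i 1)" and ?w = "W (single i 1)"
    have tot: "?Z ?v \<bullet> ?w = diag (fcalc ?C (\<lambda>t. t * (r t * s t))) i"
      by (simp only: V_def W_def blinfun_apply_blinfun_compose abs_sq_compose_fcalc_form[OF r s] diag_def)
    have nv: "(norm ?v)\<^sup>2 = diag (fcalc ?C (\<lambda>t. r t * r t)) i"
      by (simp only: V_def power2_norm_eq_inner fcalc_mult_form[OF P r r] diag_def)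
    have "(norm ?w)\<^sup>2 = diag (fcalc ?C (\<lambda>t. t * (s t * s t))) i"
      by (simp only: W_def power2_norm_eq_inner blinfun_apply_blinfun_compose
          abs_sq_compose_fcalc_form[OF s s] diag_def)
    also have "\<dots> \<le> diag (fcalc ?C (\<lambda>t. r t * r t)) i"
      by (rule diag_fcalc_mono[OF P])
        (use ts_le in \<open>auto intro!: continuous_intros r s simp: power2_eq_square\<close>)
    finally have nw: "(norm ?w)\<^sup>2 \<le> diag (fcalc ?C (\<lambda>t. r t * r t)) i" .
    have "fcalc ?C (\<lambda>t. t * (r t * s t)) = fcalc ?C (\<lambda>t. g t + 2 * l * (r t * r t))"
    proof (rule fcalc_cong)
      fix t :: real assume t: "0 \<le> t"
      show "t * (r t * s t) = g t + 2 * l * (r t * r t)"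
      proof (cases "sqrt t \<le> 2 * l")
        case True
        then have "r t = 0" "soft (2 * l) t = 0" by (simp_all add: r_def cutoff_def soft_def)
        then show ?thesis by (simp add: g_def)
      next
        case False
        then have "sqrt t > 2 * l" by simp
        moreover from this have "sqrt t > 0" using l by linarith
        ultimately have "sqrt t > 0" "max (sqrt t) (2 * l) = sqrt t" "soft (2 * l) t = sqrt t - 2 * l"
          by (auto simp: soft_def)
        moreover have "t / sqrt t = sqrt t" using t by (rule real_div_sqrt)
        ultimately have "t * s t = sqrt t * r t" by (simp add: s_def) (metis times_divide_eq_left)
        then have "t * (r t * s t) = sqrt t * (r t * r t)" by (simp add: mult_ac)
        also have "sqrt t = soft (2 * l) t + 2 * l" using \<open>soft (2 * l) t = sqrt t - 2 * l\<close> by simp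
        also have "(soft (2 * l) t + 2 * l) * (r t * r t) = g t + 2 * l * (r t * r t)"
          by (simp only: g_def r_def power2_eq_square distrib_right mult.assoc)
        finally show ?thesis .
      qed
    qed
    also have "diag \<dots> i = diag (fcalc ?C g) i + 2 * l * diag (fcalc ?C (\<lambda>t. r t * r t)) i"
      by (simp add: fcalc_add[OF P g continuous_on_mult[OF continuous_on_const rr]]
          fcalc_scale[OF P rr] diag_add diag_scaleR del: mult_scaleR_left)
    finally have "2 * diag (fcalc ?C g) i + 4 * l * diag (fcalc ?C (\<lambda>t. r t * r t)) i
        = 2 * (X ?v \<bullet> ?w) + 2 * (Y ?v \<bullet> ?w)"
      using tot by (simp add: blinfun.bilinear_simps inner_add_left)
    moreover note soft_form_bound[OF l, of X ?v ?w] soft_form_bound[OF l, of Y ?v ?w]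
    moreover have "l * ((norm ?v)\<^sup>2 + (norm ?w)\<^sup>2) \<le> 2 * l * diag (fcalc ?C (\<lambda>t. r t * r t)) i"
      using mult_left_mono[OF nw, of l] l nv by (simp add: algebra_simps)
    ultimately show ?thesis by simp
  qed
  have "2 * (\<Sum>i\<in>F. diag (fcalc ?C g) i) \<le> a + a + (b + b)"
    unfolding sum_distrib_left
    by (rule order_trans[OF sum_mono[OF key]])
      (simp only: sum.distrib, intro add_mono hs_leD[OF hs(1) F] hs_leD[OF hs(2) F] hs_leD[OF hs(3) F] hs_leD[OF hs(4) F])
  then show "(\<Sum>i\<in>F. diag (fcalc ?C (\<lambda>t. soft (2 * l) t * (cutoff (2 * l) t)\<^sup>2)) i) \<le> a + b"
    by (simp add: g_def)
qed

lemma tr_le_summable: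
  assumes "tr_le A c" "\<And>i. 0 \<le> diag A i"
  shows "diag A summable_on UNIV"
  by (rule nonneg_summable_boundedI[OF assms(2) tr_leD[OF assms(1)]])

lemma diag_fcalc_sum:
  assumes P: "positive_op A" and f: "\<And>k. continuous_on {0..norm A} (f k)"
  shows "(\<Sum>k\<in>K. w k * diag (fcalc A (f k)) i) = diag (fcalc A (\<lambda>t. \<Sum>k\<in>K. w k * f k t)) i"
  by (simp add: fcalc_sum[OF P continuous_on_mult[OF continuous_on_const f]] diag_sum
      fcalc_scale[OF P f] diag_scaleR)

text \<open>
  The sum of a geometric progression is dominated by its last term.
\<close>

lemma dyadic_powr_sum_le:
  fixes l q s :: real
  assumes l: "0 < l" and q: "0 < q" and s: "0 \<le> s"
  shows "(\<Sum>k<N. if l * 2 ^ k < s then (l * 2 ^ k) powr q else 0)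
    \<le> 2 powr q / (2 powr q - 1) * s powr q"
proof -
  define r where "r = 2 powr q"
  have r: "r > 1" using q by (simp add: r_def)
  have step: "(l * 2 ^ Suc k) powr q = r * (l * 2 ^ k) powr q" for k
    using l by (simp add: r_def powr_mult mult_ac)
  have geo: "(\<Sum>k<M. (l * 2 ^ k) powr q) \<le> (l * 2 ^ M) powr q / (r - 1)" for M
  proof (induction M)
    case (Suc M)
    have "(l * 2 ^ M) powr q / (r - 1) + (l * 2 ^ M) powr q = r * (l * 2 ^ M) powr q / (r - 1)"
      using r by (simp add: field_simps)
    with Suc step[of M] show ?case by simp
  qed (use r in simp)
  show ?thesis unfolding r_def[symmetric]
  proof (induction N)
    case (Suc N)
    show ?case
    proof (cases "l * 2 ^ N < s")
      case True
      have "(\<Sum>k<Suc N. if l * 2 ^ k < s then (l * 2 ^ k) powr q else 0)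
          \<le> (\<Sum>k<Suc N. (l * 2 ^ k) powr q)" by (intro sum_mono) simp
      also have "\<dots> \<le> (l * 2 ^ Suc N) powr q / (r - 1)" by (rule geo)
      also have "\<dots> = r / (r - 1) * (l * 2 ^ N) powr q" unfolding step by simp
      also have "\<dots> \<le> r / (r - 1) * s powr q"
        using True l q r by (intro mult_left_mono powr_mono2) auto
      finally show ?thesis .
    qed (use Suc in simp)
  qed (use r in simp)
qed

lemma sqrt_powr: "0 \<le> t \<Longrightarrow> sqrt t powr p = t powr (p / 2)"
  by (simp add: powr_half_sqrt[symmetric] powr_powr)

lemma soft_dyadic_sum_le:
  assumes l: "0 < l" and p: "1 < p" and t: "0 \<le> t"
  shows "(\<Sum>k<N. (l * 2 ^ k) powr (p - 1) * soft (l * 2 ^ k) t)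
    \<le> 2 powr (p - 1) / (2 powr (p - 1) - 1) * t powr (p / 2)"
proof -
  have "(\<Sum>k<N. (l * 2 ^ k) powr (p - 1) * soft (l * 2 ^ k) t)
      \<le> (\<Sum>k<N. (if l * 2 ^ k < sqrt t then (l * 2 ^ k) powr (p - 1) else 0) * sqrt t)"
    using l t by (intro sum_mono) (auto simp: soft_def max_def intro!: mult_left_mono)
  also have "\<dots> \<le> 2 powr (p - 1) / (2 powr (p - 1) - 1) * sqrt t powr (p - 1) * sqrt t"
    unfolding sum_distrib_right[symmetric]
    using l p t by (intro mult_right_mono dyadic_powr_sum_le) auto
  also have "\<dots> = 2 powr (p - 1) / (2 powr (p - 1) - 1) * t powr (p / 2)"
  proof (cases "t = 0")
    case False
    then have "sqrt t powr (p - 1) * sqrt t powr 1 = t powr (p / 2)"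
      unfolding powr_add[symmetric] using t by (simp add: sqrt_powr)
    then show ?thesis using t by simp
  qed simp
  finally show ?thesis .
qed

text \<open>
  The single level \<open>m = l 2\<^sup>k\<close> with \<open>4 m \<le> \<surd>t < 8 m\<close> suffices: there the cutoff at \<open>2 m\<close> is at least \<open>1/2\<close>.
  Together with the preceding bound, this makes \<open>t\<^sup>p\<^sup>/\<^sup>2\<close> comparable with a weighted sum over dyadic levels.
\<close>

lemma powr_le_dyadic_sum:
  assumes l: "0 < l" and p: "1 < p" and t: "0 \<le> t" "sqrt t < 4 * l * 2 ^ N"
  shows "t powr (p / 2) \<le> (4 * l) powr p + 8 powr p *
    (\<Sum>k<N. (l * 2 ^ k) powr (p - 1) * (soft (2 * (l * 2 ^ k)) t * (cutoff (2 * (l * 2 ^ k)) t)\<^sup>2))"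
    (is "_ \<le> _ + 8 powr p * (\<Sum>k<N. ?b k)")
proof -
  have b0: "0 \<le> ?b k" for k by simp
  define s where "s = sqrt t"
  have s: "0 \<le> s" "t powr (p / 2) = s powr p" using t by (simp_all add: s_def sqrt_powr)
  show ?thesis
  proof (cases "s < 4 * l")
    case True
    then have "s powr p \<le> (4 * l) powr p" using p s by (intro powr_mono2) auto
    moreover have "0 \<le> 8 powr p * (\<Sum>k<N. ?b k)" by (intro mult_nonneg_nonneg sum_nonneg b0) simp
    ultimately show ?thesis using s by simp
  next
    case False
    define n where "n = (LEAST n. s < 4 * l * 2 ^ n)"
    have ex: "s < 4 * l * 2 ^ N" using t by (simp add: s_def)
    have n: "s < 4 * l * 2 ^ n" unfolding n_def by (rule LeastI[of _ N]) (rule ex)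
    have nN: "n \<le> N" unfolding n_def by (rule Least_le) (rule ex)
    have "n \<noteq> 0" using n False by (intro notI) simp
    then obtain k where k: "n = Suc k" by (cases n) auto
    have "\<not> s < 4 * l * 2 ^ k" using not_less_Least[of k "\<lambda>n. s < 4 * l * 2 ^ n"] k n_def by simp
    define m where "m = l * 2 ^ k"
    have m: "m > 0" "4 * m \<le> s" "s < 8 * m"
      using l \<open>\<not> s < 4 * l * 2 ^ k\<close> n k by (simp_all add: m_def)
    have sm: "soft (2 * m) t = s - 2 * m" using m by (simp add: soft_def s_def[symmetric])
    have cm: "cutoff (2 * m) t = (s - 2 * m) / s" using m by (simp add: cutoff_def sm s_def[symmetric] max_def)
    have s0: "s > 0" using m by linarith
    have "1 / 2 \<le> cutoff (2 * m) t" unfolding cm using m s0 by (simp add: le_divide_eq)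
    then have "(1 / 2)\<^sup>2 \<le> (cutoff (2 * m) t)\<^sup>2" by (rule power_mono) simp
    then have "(s / 2) * (1 / 2)\<^sup>2 \<le> soft (2 * m) t * (cutoff (2 * m) t)\<^sup>2"
      unfolding sm using m s0 by (intro mult_mono) auto
    moreover have "(s / 8) powr (p - 1) \<le> m powr (p - 1)" using m s0 p by (intro powr_mono2) auto
    ultimately have "(s / 8) powr (p - 1) * (s / 8) \<le> ?b k"
      unfolding m_def[symmetric] using s0 by (intro mult_mono) (auto simp: power2_eq_square)
    moreover have "(s / 8) powr (p - 1) * (s / 8) = (s / 8) powr p"
      using powr_add[of "s / 8" "p - 1" 1] s0 by simp
    moreover have "?b k \<le> (\<Sum>k<N. ?b k)"
      using nN k by (intro member_le_sum b0) auto
    ultimately have "8 powr p * (s / 8) powr p \<le> 8 powr p * (\<Sum>k<N. ?b k)"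
      by (intro mult_left_mono) auto
    moreover have "8 powr p * (s / 8) powr p = s powr p"
      using s0 by (simp flip: powr_mult)
    ultimately show ?thesis using s by (simp add: add_increasing)
  qed
qed

lemma soft_le_powr:
  assumes l: "0 < l" and p: "1 < p" and t: "0 \<le> t"
  shows "soft l t \<le> l powr (1 - p) * t powr (p / 2)"
proof (cases "l < sqrt t")
  case True
  have "sqrt t powr (1 - p) \<le> l powr (1 - p)" using True l p by (intro powr_mono2') auto
  then have "sqrt t powr (1 - p) * sqrt t powr p \<le> l powr (1 - p) * sqrt t powr p"
    by (rule mult_right_mono) simp
  moreover have "sqrt t powr (1 - p) * sqrt t powr p = sqrt t"
    using True l by (simp flip: powr_add)
  ultimately show ?thesis using True l by (simp add: soft_def sqrt_powr[OF t])
qed (simp add: soft_def)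

text \<open>
  The numbers \<open>d k\<close> are the traces of \<open>(|X| - l 2\<^sup>k)\<^sub>+\<close>.
\<close>

lemma soft_levels:
  assumes p: "1 < p" and l: "0 < l" and a: "tr_le (spow p X) a"
  shows "\<exists>d. (\<forall>k. tr_le (fcalc (abs_sq X) (soft (l * 2 ^ k))) (d k)) \<and>
    (\<Sum>k<N. (l * 2 ^ k) powr (p - 1) * d k) \<le> 2 powr (p - 1) / (2 powr (p - 1) - 1) * a"
proof -
  let ?C = "abs_sq X"
  note P = positive_abs_sq[of X]
  define w where "w k = (l * 2 ^ k) powr (p - 1)" for k :: nat
  define f where "f k = soft (l * 2 ^ k)" for k :: nat
  define K where "K = 2 powr (p - 1) / (2 powr (p - 1) - 1)"
  have K: "0 \<le> K" using p by (simp add: K_def ge_one_powr_ge_zero)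
  have f: "continuous_on S (f k)" for S k unfolding f_def by (rule continuous_on_soft)
  have pw: "continuous_on {0..norm ?C} (\<lambda>t. t powr (p / 2))"
    using p by (intro continuous_on_powr_nonneg) auto
  have fn: "0 \<le> diag (fcalc ?C (f k)) i" for k i
    by (rule diag_fcalc_nonneg[OF P f]) (simp add: f_def)
  have "tr_le (fcalc ?C (f k)) ((l * 2 ^ k) powr (1 - p) * a)" for k
  proof (rule tr_le_diag_scale[OF a])
    fix i
    have "diag (fcalc ?C (f k)) i \<le> diag (fcalc ?C (\<lambda>t. (l * 2 ^ k) powr (1 - p) * t powr (p / 2))) i"
      by (rule diag_fcalc_mono[OF P f])
        (use l p in \<open>auto intro!: soft_le_powr continuous_intros pw simp: f_def\<close>)
    then show "diag (fcalc ?C (f k)) i \<le> (l * 2 ^ k) powr (1 - p) * diag (spow p X) i"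
      by (simp add: spow_def fcalc_scale[OF P pw] diag_scaleR)
  qed simp
  then have sm: "diag (fcalc ?C (f k)) summable_on UNIV" for k
    by (rule tr_le_summable[OF _ fn])
  define d where "d k = infsum (diag (fcalc ?C (f k))) UNIV" for k
  have "tr_le (fcalc ?C (f k)) (d k)" for k
    unfolding d_def by (rule tr_leI) (intro finite_sum_le_infsum sm, auto simp: fn)
  moreover have "(\<Sum>k<N. w k * d k) \<le> K * a"
  proof (rule has_sum_le_finite_sums)
    show "((\<lambda>i. \<Sum>k<N. w k * diag (fcalc ?C (f k)) i) has_sum (\<Sum>k<N. w k * d k)) UNIV"
      unfolding d_def by (intro has_sum_finite_sum has_sum_cmult_right has_sum_infsum sm)
    fix F :: "'a set" assume F: "finite F"
    have "(\<Sum>i\<in>F. \<Sum>k<N. w k * diag (fcalc ?C (f k)) i) \<le> (\<Sum>i\<in>F. K * diag (spow p X) i)"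
    proof (rule sum_mono)
      fix i
      have "diag (fcalc ?C (\<lambda>t. \<Sum>k<N. w k * f k t)) i \<le> diag (fcalc ?C (\<lambda>t. K * t powr (p / 2))) i"
      proof (rule diag_fcalc_mono[OF P])
        show "(\<Sum>k<N. w k * f k t) \<le> K * t powr (p / 2)" if "0 \<le> t" for t
          using soft_dyadic_sum_le[OF l p that] by (simp only: w_def f_def K_def)
      qed (intro continuous_intros pw f)+
      then show "(\<Sum>k<N. w k * diag (fcalc ?C (f k)) i) \<le> K * diag (spow p X) i"
        by (simp add: diag_fcalc_sum[OF P f] spow_def fcalc_scale[OF P pw] diag_scaleR)
    qed
    also have "\<dots> \<le> K * a"
      unfolding sum_distrib_left[symmetric] by (intro mult_left_mono tr_leD[OF a F] K)
    finally show "(\<Sum>i\<in>F. \<Sum>k<N. w k * diag (fcalc ?C (f k)) i) \<le> K * a" .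
  qed
  ultimately show ?thesis unfolding w_def f_def K_def by (intro exI[of _ d]) simp
qed

definition quasi_const :: "real \<Rightarrow> real" where
  "quasi_const p = 8 powr p * (2 powr (p - 1) / (2 powr (p - 1) - 1))"

lemma quasi_const_pos: "1 < p \<Longrightarrow> 0 < quasi_const p"
  by (simp add: quasi_const_def)

text \<open>
  Sum the inequality \<open>trace_level_sum\<close> over the levels \<open>l 2\<^sup>k\<close> with weights \<open>(l 2\<^sup>k)\<^sup>p\<^sup>-\<^sup>1\<close>. The lowest level
  \<open>l\<close> costs an error \<open>(4 l)\<^sup>p\<close> in each of the finitely many diagonal entries under consideration, and it can
  be chosen arbitrarily small, as the constant does not depend on it.
\<close>

lemma trace_powr_add:
  fixes X Y :: "'i l2 \<Rightarrow>\<^sub>L 'j l2"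
  assumes p: "1 < p" and X: "clin X" and Y: "clin Y"
    and a: "tr_le (spow p X) a" and b: "tr_le (spow p Y) b"
  shows "tr_le (spow p (X + Y)) (quasi_const p * (a + b))"
proof (rule tr_leI, rule field_le_epsilon)
  fix F :: "'i set" and e :: real
  assume F: "finite F" and e: "0 < e"
  let ?C = "abs_sq (X + Y)"
  note P = positive_abs_sq[of "X + Y"]
  define K where "K = 2 powr (p - 1) / (2 powr (p - 1) - 1)"
  define dl where "dl = e / (real (card F) + 1)"
  have dl: "dl > 0" using e by (simp add: dl_def)
  define l where "l = dl powr (1 / p) / 4"
  have l: "l > 0" using dl by (simp add: l_def)
  have l4: "(4 * l) powr p = dl" using dl p by (simp add: l_def powr_powr)
  obtain N where "sqrt (norm ?C) / (4 * l) < 2 ^ N"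
    using real_arch_pow[of 2 "sqrt (norm ?C) / (4 * l)"] by auto
  then have N: "sqrt (norm ?C) < 4 * l * 2 ^ N" using l by (simp add: divide_less_eq mult_ac)
  define w where "w k = (l * 2 ^ k) powr (p - 1)" for k :: nat
  define g where "g k = (\<lambda>t. soft (2 * (l * 2 ^ k)) t * (cutoff (2 * (l * 2 ^ k)) t)\<^sup>2)" for k :: nat
  have g: "continuous_on S (g k)" for S k
    unfolding g_def using l by (intro continuous_intros continuous_on_soft continuous_on_cutoff) auto
  have wg: "continuous_on S (\<lambda>t. \<Sum>k<N. w k * g k t)" for S by (intro continuous_intros g)
  have kwg: "continuous_on S (\<lambda>t. 8 powr p * (\<Sum>k<N. w k * g k t))" for S by (intro continuous_intros wg)
  obtain dX where dX: "\<And>k. tr_le (fcalc (abs_sq X) (soft (l * 2 ^ k))) (dX k)"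
    "(\<Sum>k<N. w k * dX k) \<le> K * a"
    using soft_levels[OF p l a] unfolding w_def K_def by blast
  obtain dY where dY: "\<And>k. tr_le (fcalc (abs_sq Y) (soft (l * 2 ^ k))) (dY k)"
    "(\<Sum>k<N. w k * dY k) \<le> K * b"
    using soft_levels[OF p l b] unfolding w_def K_def by blast
  have "diag (spow p (X + Y)) i \<le> dl + 8 powr p * (\<Sum>k<N. w k * diag (fcalc ?C (g k)) i)" for i
  proof -
    have "diag (spow p (X + Y)) i \<le> diag (fcalc ?C (\<lambda>t. dl + 8 powr p * (\<Sum>k<N. w k * g k t))) i"
      unfolding spow_def
    proof (rule diag_fcalc_mono[OF P])
      fix t assume t: "0 \<le> t" "t \<le> norm ?C"
      then have "sqrt t \<le> sqrt (norm ?C)" by simp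
      also note N
      finally show "t powr (p / 2) \<le> dl + 8 powr p * (\<Sum>k<N. w k * g k t)"
        using powr_le_dyadic_sum[OF l p t(1)] by (simp add: w_def g_def l4)
    qed (use p in \<open>auto intro!: continuous_on_powr_nonneg continuous_on_add kwg continuous_on_const\<close>)
    also have "\<dots> = dl + 8 powr p * (\<Sum>k<N. w k * diag (fcalc ?C (g k)) i)"
      by (simp only: fcalc_add[OF P continuous_on_const kwg] diag_add diag_const[OF P]
          fcalc_scale[OF P wg] diag_scaleR diag_fcalc_sum[OF P g])
    finally show ?thesis .
  qed
  then have "(\<Sum>i\<in>F. diag (spow p (X + Y)) i)
      \<le> (\<Sum>i\<in>F. dl + 8 powr p * (\<Sum>k<N. w k * diag (fcalc ?C (g k)) i))"
    by (rule sum_mono)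
  also have "\<dots> = real (card F) * dl + 8 powr p * (\<Sum>k<N. w k * (\<Sum>i\<in>F. diag (fcalc ?C (g k)) i))"
    by (simp add: sum.distrib sum_distrib_left sum.swap[of _ _ F] mult.assoc)
  also have "(\<Sum>k<N. w k * (\<Sum>i\<in>F. diag (fcalc ?C (g k)) i)) \<le> (\<Sum>k<N. w k * (dX k + dY k))"
  proof (intro sum_mono mult_left_mono)
    fix k
    have "tr_le (fcalc ?C (g k)) (dX k + dY k)"
      unfolding g_def using l by (intro trace_level_sum[OF X Y _ dX(1) dY(1)]) simp
    then show "(\<Sum>i\<in>F. diag (fcalc ?C (g k)) i) \<le> dX k + dY k" using F by (rule tr_leD)
  qed (simp add: w_def)
  also have "\<dots> \<le> K * (a + b)"
    using dX(2) dY(2) by (simp add: distrib_left sum.distrib)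
  also have "real (card F) * dl \<le> e" using e by (simp add: dl_def field_simps)
  finally show "(\<Sum>i\<in>F. diag (spow p (X + Y)) i) \<le> quasi_const p * (a + b) + e"
    by (simp add: quasi_const_def K_def algebra_simps)
qed

section \<open>Density of finite matrices\<close>

text \<open>Restriction of a family to \<open>I\<close> along a reindexing \<open>\<phi>\<close>; its adjoint spreads a family along \<open>\<phi>\<close>.\<close>

definition pull :: "'i set \<Rightarrow> ('i \<Rightarrow> 'j) \<Rightarrow> ('j l2 \<Rightarrow>\<^sub>L 'i l2)" where
  "pull I \<phi> = (SOME B. norm B \<le> 1 \<and>
     (\<forall>w u. coord (blinfun_apply B w) u = (if u \<in> I then coord w (\<phi> u) else 0)))"

lemma ex_pull:
  assumes \<phi>: "inj_on \<phi> I"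
  shows "\<exists>B. norm B \<le> 1 \<and>
     (\<forall>w u. coord (blinfun_apply B w) u = (if u \<in> I then coord w (\<phi> u) else 0))"
proof -
  have "\<exists>v. (\<forall>u. coord v u = (if u \<in> I then coord w (\<phi> u) else 0)) \<and> (norm v)\<^sup>2 \<le> (norm w)\<^sup>2" for w :: "'b l2"
  proof (rule ex_l2I)
    fix F assume F: "finite (F :: 'a set)"
    have "(\<Sum>u\<in>F. (cmod (if u \<in> I then coord w (\<phi> u) else 0))\<^sup>2) = (\<Sum>u\<in>F \<inter> I. (cmod (coord w (\<phi> u)))\<^sup>2)"
      by (rule sum.mono_neutral_cong_right) (use F in auto)
    also have "\<dots> = (\<Sum>m\<in>\<phi> ` (F \<inter> I). (cmod (coord w m))\<^sup>2)"
      by (subst sum.reindex) (auto intro: inj_on_subset[OF \<phi>])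
    also have "\<dots> \<le> (norm w)\<^sup>2" by (rule sum_coord_le) (use F in simp)
    finally show "(\<Sum>u\<in>F. (cmod (if u \<in> I then coord w (\<phi> u) else 0))\<^sup>2) \<le> (norm w)\<^sup>2" .
  qed
  then obtain g :: "'b l2 \<Rightarrow> 'a l2" where g: "\<And>w u. coord (g w) u = (if u \<in> I then coord w (\<phi> u) else 0)"
    "\<And>w. (norm (g w))\<^sup>2 \<le> (norm w)\<^sup>2" by metis
  have gn: "norm (g w) \<le> norm w" for w by (rule power2_le_imp_le[OF g(2)]) simp
  have bl: "bounded_linear g"
    by (rule bounded_linear_intro[where K = 1]) (auto intro!: l2_eqI simp: g(1) gn)
  show ?thesis
  proof (intro exI[of _ "Blinfun g"] conjI allI)
    show "norm (Blinfun g) \<le> 1"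
      by (rule norm_blinfun_bound) (simp_all add: bounded_linear_Blinfun_apply[OF bl] gn)
  qed (simp add: bounded_linear_Blinfun_apply[OF bl] g(1))
qed

lemma
  assumes "inj_on \<phi> I"
  shows norm_pull: "norm (pull I \<phi>) \<le> 1"
    and coord_pull: "coord (pull I \<phi> w) u = (if u \<in> I then coord w (\<phi> u) else 0)"
proof -
  have "norm (pull I \<phi>) \<le> 1 \<and>
     (\<forall>w u. coord (blinfun_apply (pull I \<phi>) w) u = (if u \<in> I then coord w (\<phi> u) else 0))"
    unfolding pull_def by (rule someI_ex) (rule ex_pull[OF assms])
  then show "norm (pull I \<phi>) \<le> 1"
    "coord (pull I \<phi> w) u = (if u \<in> I then coord w (\<phi> u) else 0)" by blast+
qed

lemma clin_pull: "inj_on \<phi> I \<Longrightarrow> clin (pull I \<phi>)"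
  unfolding clin_def by (auto intro!: l2_eqI simp: coord_pull)

lemma adj_pull_single:
  assumes "inj_on \<phi> I"
  shows "adj (pull I \<phi>) (single u c) = (if u \<in> I then single (\<phi> u) c else 0)"
proof (rule l2_inner_eqI)
  fix w
  have "w \<bullet> adj (pull I \<phi>) (single u c) = coord (pull I \<phi> w) u \<bullet> c"
    unfolding adj_right[symmetric] by (rule inner_single_right)
  then show "w \<bullet> adj (pull I \<phi>) (single u c) = w \<bullet> (if u \<in> I then single (\<phi> u) c else 0)"
    by (simp add: coord_pull[OF assms] inner_single_right)
qed

abbreviation proj :: "'i set \<Rightarrow> 'i l2 \<Rightarrow>\<^sub>L 'i l2" where
  "proj I \<equiv> pull I (\<lambda>i. i)"

lemma coord_proj: "coord (proj I v) i = (if i \<in> I then coord v i else 0)"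
  by (simp add: coord_pull)

lemma norm_proj: "norm (proj I) \<le> 1"
  by (simp add: norm_pull)

lemma clin_proj: "clin (proj I)"
  by (simp add: clin_pull)

lemma proj_single: "proj I (single i c) = (if i \<in> I then single i c else 0)"
  by (rule l2_eqI) (auto simp: coord_proj coord_single)

lemma proj_Compl: "proj I v + proj (- I) v = v"
  by (rule l2_eqI) (simp add: coord_proj)

lemma nonneg_tail:
  fixes f :: "'i \<Rightarrow> real"
  assumes f: "f summable_on UNIV" and f0: "\<And>i. 0 \<le> f i" and e: "0 < e"
  shows "\<exists>F. finite F \<and> (\<forall>G. finite G \<longrightarrow> G \<inter> F = {} \<longrightarrow> sum f G \<le> e)"
proof -
  obtain F where F: "finite F" "dist (sum f F) (infsum f UNIV) \<le> e"
    using infsum_finite_approximation[OF f e] by auto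
  have "sum f G \<le> e" if G: "finite G" "G \<inter> F = {}" for G
  proof -
    have "sum f F + sum f G = sum f (F \<union> G)" using F G by (subst sum.union_disjoint) auto
    also have "\<dots> \<le> infsum f UNIV" by (rule finite_sum_le_infsum[OF f]) (use F G f0 in auto)
    finally show ?thesis using F(2) by (simp add: dist_real_def)
  qed
  with F show ?thesis by blast
qed

lemma diag_spow_summable:
  assumes "0 < p" "tr_le (spow p X) c"
  shows "diag (spow p X) summable_on UNIV"
  using assms by (intro tr_le_summable diag_spow_nonneg)

lemma finite_columns_tail:
  fixes Y :: "'i l2 \<Rightarrow>\<^sub>L 'j l2"
  assumes F: "finite F" and k: "0 < k" and Y: "clin Y"
  shows "\<exists>G. finite G \<and> norm (proj (- G) o\<^sub>L (Y o\<^sub>L proj F)) \<le> k"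
proof -
  define d where "d = k\<^sup>2 / (real (card F) + 1)"
  have d: "0 < d" using k by (simp add: d_def add_nonneg_pos)
  have "\<exists>G. finite G \<and> (\<forall>H. finite H \<longrightarrow> H \<inter> G = {} \<longrightarrow>
      (\<Sum>m\<in>H. (cmod (coord (Y (single j 1)) m))\<^sup>2) \<le> d)" for j
    by (rule nonneg_tail[OF coord_summable _ d]) simp
  then obtain G where G: "\<And>j. finite (G j)" "\<And>j H. finite H \<Longrightarrow> H \<inter> G j = {} \<Longrightarrow>
      (\<Sum>m\<in>H. (cmod (coord (Y (single j 1)) m))\<^sup>2) \<le> d" by metis
  define E where "E = (\<Union>j\<in>F. G j)"
  have E: "finite E" unfolding E_def using F G by simp
  let ?R = "proj (- E) o\<^sub>L (Y o\<^sub>L proj F)"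
  have col: "(norm (?R (single j 1)))\<^sup>2 \<le> (if j \<in> F then d else 0)" for j
  proof (cases "j \<in> F")
    case True
    have "(norm (proj (- E) (Y (single j 1))))\<^sup>2 \<le> d"
    proof (rule norm_sq_leI)
      fix H :: "'j set" assume H: "finite H"
      have "(\<Sum>m\<in>H. (cmod (coord (proj (- E) (Y (single j 1))) m))\<^sup>2) =
          (\<Sum>m\<in>H - E. (cmod (coord (Y (single j 1)) m))\<^sup>2)"
        by (rule sum.mono_neutral_cong_right) (use H in \<open>auto simp: coord_proj\<close>)
      also have "\<dots> \<le> d" by (rule G(2)) (use H True in \<open>auto simp: E_def\<close>)
      finally show "(\<Sum>m\<in>H. (cmod (coord (proj (- E) (Y (single j 1))) m))\<^sup>2) \<le> d" .
    qed
    then show ?thesis using True by (simp add: proj_single)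
  qed (simp add: proj_single blinfun.bilinear_simps)
  have "hs_le ?R (k\<^sup>2)"
    unfolding hs_le_def
  proof (intro allI impI)
    fix H :: "'i set" assume H: "finite H"
    have "(\<Sum>j\<in>H. (norm (?R (single j 1)))\<^sup>2) \<le> (\<Sum>j\<in>H. if j \<in> F then d else 0)"
      by (intro sum_mono col)
    also have "\<dots> = real (card (H \<inter> F)) * d" using H by (simp add: sum.If_cases Int_def)
    also have "\<dots> \<le> real (card F) * d"
      using F d by (intro mult_right_mono) (auto intro: card_mono)
    also have "\<dots> \<le> k\<^sup>2" using k by (simp add: d_def field_simps)
    finally show "(\<Sum>j\<in>H. (norm (?R (single j 1)))\<^sup>2) \<le> k\<^sup>2" .
  qed
  then have "norm ?R \<le> sqrt (k\<^sup>2)" by (intro norm_le_hs clin_compose clin_proj Y)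
  then show ?thesis using E k by auto
qed

text \<open>
  With \<open>g = 1 - min 1 (|X|\<^sup>p / d)\<close>, the diagonal entries of \<open>|X g|\<^sup>p\<close> are dominated by those of \<open>|X|\<^sup>p\<close>, and
  each is at most \<open>d\<close> because \<open>g\<close> vanishes where \<open>|X|\<^sup>p > d\<close>. So their sum tends to \<open>0\<close> with \<open>d\<close>, by
  dominated convergence.
\<close>

lemma small_part:
  assumes p: "1 < p" and c: "tr_le (spow p X) c" and e: "0 < e"
  shows "\<exists>d>0. tr_le (spow p (X o\<^sub>L fcalc (abs_sq X) (\<lambda>t. 1 - min 1 (t powr (p / 2) / d)))) e"
proof -
  let ?C = "abs_sq X"
  note P = positive_abs_sq[of X]
  have p0: "0 < p" using p by simp
  obtain F where F: "finite F" "\<And>G. finite G \<Longrightarrow> G \<inter> F = {} \<Longrightarrow> sum (diag (spow p X)) G \<le> e / 2"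
    using nonneg_tail[OF diag_spow_summable[OF p0 c] diag_spow_nonneg[OF p0], of "e / 2"] e by auto
  define d where "d = e / (2 * (real (card F) + 1))"
  have d: "0 < d" using e by (simp add: d_def add_nonneg_pos)
  define g where "g = (\<lambda>t. 1 - min 1 (t powr (p / 2) / d))"
  have pw: "continuous_on {0..norm ?C} (\<lambda>t. t powr (p / 2))"
    using p by (intro continuous_on_powr_nonneg) auto
  have g: "continuous_on {0..norm ?C} g"
    unfolding g_def using d by (intro continuous_intros pw) auto
  have g01: "0 \<le> g t" "g t \<le> 1" for t using d by (auto simp: g_def)
  define Y where "Y = X o\<^sub>L fcalc ?C g"
  have h: "continuous_on {0..norm ?C} (\<lambda>t. (t * (g t)\<^sup>2) powr (p / 2))"
    by (rule continuous_on_compose2[OF continuous_on_powr_nonneg[of "p / 2" "{0..}"]])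
      (use p in \<open>auto intro!: continuous_intros g\<close>)
  have Y: "spow p Y = fcalc ?C (\<lambda>t. (t * (g t)\<^sup>2) powr (p / 2))"
    unfolding Y_def by (rule spow_compose_fcalc[OF g p0])
  have le: "(t * (g t)\<^sup>2) powr (p / 2) \<le> t powr (p / 2)" if "0 \<le> t" for t
    using that p g01[of t] by (intro powr_mono2) (auto simp: power_le_one mult_left_le)
  have led: "(t * (g t)\<^sup>2) powr (p / 2) \<le> d" if t: "0 \<le> t" for t
  proof (cases "t powr (p / 2) \<le> d")
    case False
    then have "g t = 0" using d by (simp add: g_def)
    then show ?thesis using d by simp
  qed (use le[OF t] in simp)
  have d1: "diag (spow p Y) i \<le> diag (spow p X) i" for i
    unfolding Y unfolding spow_def by (rule diag_fcalc_mono[OF P h pw]) (rule le)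
  have d2: "diag (spow p Y) i \<le> d" for i
    using diag_fcalc_mono[OF P h continuous_on_const led, of i] by (simp add: Y diag_const[OF P])
  have "tr_le (spow p Y) e"
  proof (rule tr_leI)
    fix G :: "'a set" assume G: "finite G"
    have "(\<Sum>i\<in>G. diag (spow p Y) i) = (\<Sum>i\<in>G \<inter> F. diag (spow p Y) i) + (\<Sum>i\<in>G - F. diag (spow p Y) i)"
      using G by (subst sum.union_disjoint[symmetric]) (auto intro!: sum.cong)
    also have "(\<Sum>i\<in>G \<inter> F. diag (spow p Y) i) \<le> real (card (G \<inter> F)) * d"
      by (rule sum_bounded_above[OF d2])
    also have "\<dots> \<le> real (card F) * d" using F d by (intro mult_right_mono) (auto intro: card_mono)
    also have "\<dots> \<le> e / 2" using e by (simp add: d_def field_simps)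
    also have "(\<Sum>i\<in>G - F. diag (spow p Y) i) \<le> (\<Sum>i\<in>G - F. diag (spow p X) i)"
      by (intro sum_mono d1)
    also have "\<dots> \<le> e / 2" by (rule F(2)) (use G in auto)
    finally show "(\<Sum>i\<in>G. diag (spow p Y) i) \<le> e" by simp
  qed
  then show ?thesis using d unfolding Y_def g_def by blast
qed

text \<open>
  Let \<open>f = min 1 (|X|\<^sup>p / d)\<close>. The part \<open>X (1 - f)\<close> is small by \<open>small_part\<close>. Since \<open>f\<close> and \<open>|X|\<^sup>2 f\<close> are
  dominated by multiples of \<open>|X|\<^sup>p\<close>, the part \<open>Y = X f\<close> is the product of the two Hilbert-Schmidt operators
  \<open>U = X \<surd>f\<close> and \<open>W = \<surd>f\<close>. Hence cutting off its columns converges in trace norm. In the remaining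
  finitely many columns it suffices to cut off rows in operator norm.
\<close>

lemma finite_matrices_dense:
  fixes X :: "'i l2 \<Rightarrow>\<^sub>L 'j l2"
  assumes p: "1 < p" and X: "clin X" and c: "tr_le (spow p X) c" and e: "0 < e"
  shows "\<exists>Z F G. finite F \<and> finite G \<and> clin Z \<and> tr_le (spow p (X - Z)) e \<and>
    (\<forall>i j. i \<notin> G \<or> j \<notin> F \<longrightarrow> coord (blinfun_apply Z (single j 1)) i = 0)"
proof -
  let ?C = "abs_sq X"
  note P = positive_abs_sq[of X]
  have p0: "0 < p" using p by simp
  define K where "K = quasi_const p"
  have K: "0 < K" unfolding K_def by (rule quasi_const_pos[OF p])
  define n where "n = e / (K * (1 + 2 * K))"
  have n: "0 < n" using e K by (simp add: n_def)
  obtain d where d: "d > 0"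
    and Y1: "tr_le (spow p (X o\<^sub>L fcalc ?C (\<lambda>t. 1 - min 1 (t powr (p / 2) / d)))) n"
    using small_part[OF p c n] by blast
  define f where "f = (\<lambda>t. min 1 (t powr (p / 2) / d))"
  define r where "r = (\<lambda>t. sqrt (f t))"
  have pw: "S \<subseteq> {0..} \<Longrightarrow> continuous_on S (\<lambda>t. t powr (p / 2))" for S :: "real set"
    using p by (intro continuous_on_powr_nonneg) auto
  have f: "S \<subseteq> {0..} \<Longrightarrow> continuous_on S f" for S
    unfolding f_def using d by (intro continuous_intros pw) auto
  have r: "S \<subseteq> {0..} \<Longrightarrow> continuous_on S r" for S
    unfolding r_def by (intro continuous_intros f)
  have sub: "{0..norm ?C} \<subseteq> {0..}" by auto
  have f0: "0 \<le> f t" for t using d by (simp add: f_def)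
  have fle: "f t \<le> 1 / d * t powr (p / 2)" for t by (simp add: f_def)
  define U where "U = X o\<^sub>L fcalc ?C r"
  define W where "W = fcalc ?C r"
  define Y where "Y = U o\<^sub>L W"
  define Y1 where "Y1 = X o\<^sub>L fcalc ?C (\<lambda>t. 1 - f t)"
  have cU: "clin U" and cW: "clin W"
    unfolding U_def W_def by (intro clin_compose X clin_fcalc P clin_abs_sq r order_refl)+
  have cY: "clin Y" unfolding Y_def by (intro clin_compose cU cW)
  have cf: "continuous_on {0..} (\<lambda>t. 1 - f t)" by (intro continuous_intros f order_refl)
  have cY1: "clin Y1" unfolding Y1_def by (intro clin_compose X clin_fcalc P clin_abs_sq cf)
  have XY: "X = Y1 + Y"
  proof -
    have mf: "continuous_on {0..norm ?C} (\<lambda>t. 1 - f t)" by (intro continuous_intros f sub)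
    have rr: "continuous_on {0..norm ?C} (\<lambda>t. r t * r t)" by (intro continuous_intros r sub)
    have "fcalc ?C (\<lambda>t. (1 - f t) + r t * r t) = fcalc ?C (\<lambda>_. 1)"
      by (rule fcalc_cong) (simp add: r_def f0)
    then have "fcalc ?C (\<lambda>t. 1 - f t) + (W o\<^sub>L W) = id_blinfun"
      by (simp add: fcalc_add[OF P mf rr] fcalc_mult[OF P r[OF sub] r[OF sub]] W_def fcalc_const[OF P])
    from arg_cong[OF this, of blinfun_apply]
    have "fcalc ?C (\<lambda>t. 1 - f t) v + W (W v) = v" for v
      by (simp add: fun_eq_iff blinfun.add_left)
    from arg_cong[OF this, of "blinfun_apply X"]
    have "X (fcalc ?C (\<lambda>t. 1 - f t) v) + X (W (W v)) = X v" for v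
      by (simp add: blinfun.add_right)
    then show ?thesis
      by (intro blinfun_eqI) (simp add: Y1_def Y_def U_def W_def blinfun.add_left)
  qed
  have hW: "hs_le W (1 / d * c)"
    unfolding hs_le_iff_tr_le
  proof (rule tr_le_diag_scale[OF c])
    fix i
    have "diag (abs_sq W) i = diag (fcalc ?C (\<lambda>t. r t * r t)) i"
      by (simp only: diag_def abs_sq_form W_def fcalc_mult_form[OF P r[OF sub] r[OF sub]])
    also have "\<dots> \<le> diag (fcalc ?C (\<lambda>t. 1 / d * t powr (p / 2))) i"
    proof (rule diag_fcalc_mono[OF P])
      show "r t * r t \<le> 1 / d * t powr (p / 2)" for t using f0[of t] fle[of t] by (simp add: r_def)
    qed (intro continuous_intros r pw sub)+
    also have "\<dots> = 1 / d * diag (spow p X) i"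
      by (simp only: fcalc_scale[OF P pw[OF sub]] diag_scaleR spow_def)
    finally show "diag (abs_sq W) i \<le> 1 / d * diag (spow p X) i" .
  qed (use d in simp)
  define M where "M = norm ?C"
  have M: "0 \<le> M" by (simp add: M_def)
  have hU: "hs_le U (M / d * c)"
    unfolding hs_le_iff_tr_le
  proof (rule tr_le_diag_scale[OF c])
    fix i
    have "diag (abs_sq U) i = diag (fcalc ?C (\<lambda>t. t * (r t)\<^sup>2)) i"
      unfolding U_def abs_sq_compose_fcalc[OF r[OF sub]] ..
    also have "\<dots> \<le> diag (fcalc ?C (\<lambda>t. M / d * t powr (p / 2))) i"
    proof (rule diag_fcalc_mono[OF P])
      fix t :: real assume t: "0 \<le> t" "t \<le> norm ?C"
      have "t * f t \<le> M * (1 / d * t powr (p / 2))"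
        by (intro mult_mono fle f0) (use t in \<open>simp_all add: M_def\<close>)
      then show "t * (r t)\<^sup>2 \<le> M / d * t powr (p / 2)" using f0[of t] by (simp add: r_def)
    qed (intro continuous_intros r pw sub)+
    also have "\<dots> = M / d * diag (spow p X) i"
      by (simp only: fcalc_scale[OF P pw[OF sub]] diag_scaleR spow_def)
    finally show "diag (abs_sq U) i \<le> M / d * diag (spow p X) i" .
  qed (use d M in simp)
  define A where "A = M / d * c"
  define t where "t = (n / (norm Y powr (p - 1) * sqrt A + 1))\<^sup>2"
  have A: "0 \<le> A" unfolding A_def by (rule hs_le_nonneg[OF hU])
  have den: "0 < norm Y powr (p - 1) * sqrt A + 1" using A by (intro add_nonneg_pos) auto
  have t: "0 < t" unfolding t_def using n den by simp
  have "(\<lambda>i. (norm (W (single i 1)))\<^sup>2) summable_on UNIV"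
    by (rule nonneg_summable_boundedI[OF _ hs_leD[OF hW]]) simp_all
  then obtain F where F: "finite F"
    "\<And>G. finite G \<Longrightarrow> G \<inter> F = {} \<Longrightarrow> (\<Sum>i\<in>G. (norm (W (single i 1)))\<^sup>2) \<le> t"
    using nonneg_tail[of "\<lambda>i. (norm (W (single i 1)))\<^sup>2", OF _ _ t] by auto
  define Y2 where "Y2 = U o\<^sub>L (W o\<^sub>L proj (- F))"
  have hW': "hs_le (W o\<^sub>L proj (- F)) t"
    unfolding hs_le_def
  proof (intro allI impI)
    fix G :: "'i set" assume G: "finite G"
    have "(\<Sum>i\<in>G. (norm ((W o\<^sub>L proj (- F)) (single i 1)))\<^sup>2) = (\<Sum>i\<in>G - F. (norm (W (single i 1)))\<^sup>2)"
      by (rule sum.mono_neutral_cong_right) (use G in \<open>auto simp: proj_single blinfun.bilinear_simps\<close>)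
    also have "\<dots> \<le> t" by (rule F(2)) (use G in auto)
    finally show "(\<Sum>i\<in>G. (norm ((W o\<^sub>L proj (- F)) (single i 1)))\<^sup>2) \<le> t" .
  qed
  have cY2: "clin Y2" unfolding Y2_def by (intro clin_compose cU cW clin_proj)
  have "norm Y2 \<le> norm Y"
  proof -
    have "Y2 = Y o\<^sub>L proj (- F)" by (rule blinfun_eqI) (simp add: Y2_def Y_def)
    then have "norm Y2 \<le> norm Y * norm (proj (- F))" by (simp add: norm_blinfun_compose)
    also have "\<dots> \<le> norm Y * 1" by (intro mult_left_mono norm_proj) simp
    finally show ?thesis by simp
  qed
  then have nY2: "norm Y2 powr (p - 1) \<le> norm Y powr (p - 1)" using p by (intro powr_mono2) auto
  have Y2: "tr_le (spow p Y2) n"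
  proof (rule tr_le_mono)
    have "tr_le (spow 1 Y2) (sqrt A * sqrt t)"
      unfolding Y2_def A_def by (intro trace_norm_product cU hU hW' clin_compose cW clin_proj)
    then show "tr_le (spow p Y2) (norm Y2 powr (p - 1) * (sqrt A * sqrt t))"
      by (rule spow_le_of_trace_norm[OF p])
    have "norm Y2 powr (p - 1) * (sqrt A * sqrt t) \<le> norm Y powr (p - 1) * (sqrt A * sqrt t)"
      using A t by (intro mult_right_mono nY2) auto
    also have "\<dots> \<le> (norm Y powr (p - 1) * sqrt A + 1) * sqrt t" using t by (simp add: distrib_right)
    also have "\<dots> = n"
    proof -
      have "sqrt t = n / (norm Y powr (p - 1) * sqrt A + 1)" unfolding t_def using n den by simp
      then show ?thesis using den by simp
    qed
    finally show "norm Y2 powr (p - 1) * (sqrt A * sqrt t) \<le> n" .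
  qed
  define k where "k = (n / (real (card F) + 1)) powr (1 / p)"
  have k: "0 < k" using n by (simp add: k_def add_nonneg_pos)
  obtain G where G: "finite G" "norm (proj (- G) o\<^sub>L (Y o\<^sub>L proj F)) \<le> k"
    using finite_columns_tail[OF F(1) k cY] by blast
  define Y3 where "Y3 = proj (- G) o\<^sub>L (Y o\<^sub>L proj F)"
  define Z where "Z = proj G o\<^sub>L (Y o\<^sub>L proj F)"
  have cY3: "clin Y3" and cZ: "clin Z" unfolding Y3_def Z_def by (intro clin_compose cY clin_proj)+
  have Y3: "tr_le (spow p Y3) n"
  proof (rule tr_le_mono)
    show "tr_le (spow p Y3) (real (card F) * norm Y3 powr p)"
      by (rule tr_le_finite_columns[OF p0 F(1)]) (simp add: Y3_def proj_single blinfun.bilinear_simps)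
    have "norm Y3 powr p \<le> k powr p" using G p by (intro powr_mono2) (auto simp: Y3_def)
    also have "\<dots> = n / (real (card F) + 1)" using n p by (simp add: k_def powr_powr)
    finally have "real (card F) * norm Y3 powr p \<le> real (card F) * (n / (real (card F) + 1))"
      by (intro mult_left_mono) auto
    also have "\<dots> \<le> n" using n by (simp add: field_simps)
    finally show "real (card F) * norm Y3 powr p \<le> n" .
  qed
  have "X - Z = Y1 + (Y2 + Y3)"
  proof (rule blinfun_eqI)
    fix v
    have "Y v = Y (proj F v) + Y (proj (- F) v)"
      by (simp add: proj_Compl flip: blinfun.add_right)
    moreover have "proj (- G) (Y (proj F v)) = Y (proj F v) - proj G (Y (proj F v))"
      by (simp add: eq_diff_eq proj_Compl add.commute)
    moreover have "Y2 v = Y (proj (- F) v)" by (simp add: Y2_def Y_def)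
    ultimately show "(X - Z) v = (Y1 + (Y2 + Y3)) v"
      using arg_cong[OF XY, of "\<lambda>B. blinfun_apply B v"]
      by (simp add: blinfun.bilinear_simps Y3_def Z_def)
  qed
  moreover have "tr_le (spow p (Y1 + (Y2 + Y3))) (K * (n + K * (n + n)))"
  proof -
    have "clin (Y2 + Y3)"
      using cY2 cY3 by (simp add: clin_def blinfun.bilinear_simps l2_eqI algebra_simps)
    moreover have "tr_le (spow p Y1) n" using \<open>tr_le (spow p (X o\<^sub>L _)) n\<close> by (simp add: Y1_def f_def)
    ultimately show ?thesis
      unfolding K_def by (intro trace_powr_add[OF p] cY1 cY2 cY3 Y2 Y3)
  qed
  moreover have "K * (n + K * (n + n)) = e"
  proof -
    have "K * (n + K * (n + n)) = n * (K * (1 + 2 * K))" by (simp add: algebra_simps)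
    moreover have "K * (1 + 2 * K) \<noteq> 0" using K by auto
    ultimately show ?thesis by (simp add: n_def)
  qed
  moreover have "coord (Z (single j 1)) i = 0" if "i \<notin> G \<or> j \<notin> F" for i j
    using that by (auto simp: Z_def coord_proj proj_single blinfun.bilinear_simps)
  ultimately show ?thesis using F(1) G(1) cZ by metis
qed

section \<open>Matrices and operators\<close>

definition mat_of :: "('j l2 \<Rightarrow>\<^sub>L 'i l2) \<Rightarrow> 'i \<Rightarrow> 'j \<Rightarrow> complex" where
  "mat_of B i j = coord (B (single j 1)) i"

text \<open>
  Operators on \<open>\<ell>\<^sub>2(I)\<close> are handled as operators on the family space over the whole index type that vanish
  off \<open>I\<close>. The unit matrix over \<open>I\<close> then becomes the projection onto \<open>I\<close>.
\<close>

definition supported :: "'i set \<Rightarrow> 'i cmat \<Rightarrow> bool" where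
  "supported I x \<longleftrightarrow> (\<forall>i j. i \<notin> I \<or> j \<notin> I \<longrightarrow> x i j = 0)"

lemma supportedD: "supported I x \<Longrightarrow> i \<notin> I \<or> j \<notin> I \<Longrightarrow> x i j = 0"
  by (simp add: supported_def)

lemma clin_single: "clin B \<Longrightarrow> B (single j c) = cscale c (B (single j 1))"
  unfolding clin_def by (metis mult.right_neutral single_cscale)

lemma has_sum_mat_of:
  assumes "clin B"
  shows "((\<lambda>j. mat_of B i j * coord v j) has_sum coord (B v) i) UNIV"
proof -
  have "((\<lambda>j. coord (B (single j (coord v j))) i) has_sum coord (B v) i) UNIV"
    by (rule has_sum_bounded_linear[OF bounded_linear_coord
          has_sum_bounded_linear[OF blinfun.bounded_linear_right has_sum_single]])
  moreover have "coord (B (single j (coord v j))) i = mat_of B i j * coord v j" for j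
    by (simp add: clin_single[OF assms, of j "coord v j"] mat_of_def)
  ultimately show ?thesis by simp
qed

lemma mat_of_inject:
  assumes "clin A" "clin B" "\<And>i j. mat_of A i j = mat_of B i j"
  shows "A = B"
proof (rule blinfun_eqI, rule l2_eqI)
  fix v i
  show "coord (A v) i = coord (B v) i"
    using has_sum_mat_of[OF assms(1), of i v] has_sum_mat_of[OF assms(2), of i v]
    by (simp add: assms(3) has_sum_unique)
qed

lemma ell2_ex_coord:
  assumes "v \<in> ell2 I"
  shows "\<exists>w. v = coord w \<and> (\<forall>i. i \<notin> I \<longrightarrow> coord w i = 0)"
proof -
  have "(\<lambda>i. (cmod (v i))\<^sup>2) summable_on I" and v0: "\<And>i. i \<notin> I \<Longrightarrow> v i = 0"
    using assms by (auto simp: ell2_def)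
  then have "(\<lambda>i. (cmod (v i))\<^sup>2) summable_on UNIV"
    by (subst summable_on_cong_neutral[where T = I and g = "\<lambda>i. (cmod (v i))\<^sup>2"]) auto
  then have "coord (Abs_l2 v) = v" by (simp add: Abs_l2_inverse)
  then show ?thesis using v0 by metis
qed

lemma coord_in_ell2:
  assumes "\<forall>i. i \<notin> I \<longrightarrow> coord w i = 0"
  shows "coord w \<in> ell2 I" "ell2_norm I (coord w) = norm w"
proof -
  have hs: "((\<lambda>i. (cmod (coord w i))\<^sup>2) has_sum (norm w)\<^sup>2) I"
    using norm_sq_has_sum[of w]
    by (subst has_sum_cong_neutral[where T = UNIV and g = "\<lambda>i. (cmod (coord w i))\<^sup>2"]) (use assms in auto)
  then show "coord w \<in> ell2 I" using assms by (auto simp: ell2_def has_sum_imp_summable)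
  show "ell2_norm I (coord w) = norm w" using hs by (simp add: ell2_norm_def infsumI)
qed

lemma mat_vec_mat_of:
  assumes B: "clin B" and I: "supported I (mat_of B)"
  shows "mat_vec I (mat_of B) (coord v) = coord (B v)"
proof
  fix i
  have "((\<lambda>j. mat_of B i j * coord v j) has_sum coord (B v) i) I"
    using has_sum_mat_of[OF B, of i v]
    by (subst has_sum_cong_neutral[where T = UNIV and g = "\<lambda>j. mat_of B i j * coord v j"])
      (use supportedD[OF I] in auto)
  then show "mat_vec I (mat_of B) (coord v) i = coord (B v) i" by (simp add: mat_vec_def infsumI)
qed

lemma supported_apply:
  assumes B: "clin B" and I: "supported I (mat_of B)" and i: "i \<notin> I"
  shows "coord (B v) i = 0"
  using has_sum_mat_of[OF B, of i v] supportedD[OF I] i by (simp add: has_sum_unique[OF _ has_sum_0])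

lemma bounded_op_mat_of:
  assumes B: "clin B" and I: "supported I (mat_of B)"
  shows "bounded_op I (mat_of B)"
  unfolding bounded_op_def
proof (intro conjI exI[of _ "norm B"] ballI)
  fix v assume "v \<in> ell2 I"
  then obtain w where w: "v = coord w" "\<forall>i. i \<notin> I \<longrightarrow> coord w i = 0" using ell2_ex_coord by blast
  have 0: "\<forall>i. i \<notin> I \<longrightarrow> coord (B w) i = 0" by (simp add: supported_apply[OF B I])
  show "mat_vec I (mat_of B) v \<in> ell2 I"
    unfolding w mat_vec_mat_of[OF B I] by (rule coord_in_ell2[OF 0])
  show "ell2_norm I (mat_vec I (mat_of B) v) \<le> norm B * ell2_norm I v"
    unfolding w mat_vec_mat_of[OF B I] coord_in_ell2(2)[OF 0] coord_in_ell2(2)[OF w(2)]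
    by (rule norm_blinfun)
qed (use I in \<open>simp add: supported_def\<close>)

text \<open>
  Boundedness on \<open>\<ell>\<^sub>2\<close> makes the rows square summable: apply \<open>x\<close> to the conjugate of a finite piece of
  the row. Only then is \<open>x v\<close> given by convergent sums, and additive in \<open>v\<close>.
\<close>

lemma bounded_op_row:
  assumes "bounded_op I x"
  shows "\<exists>r. \<forall>j. coord r j = x i j"
proof -
  obtain C where C: "\<And>v. v \<in> ell2 I \<Longrightarrow> mat_vec I x v \<in> ell2 I"
    "\<And>v. v \<in> ell2 I \<Longrightarrow> ell2_norm I (mat_vec I x v) \<le> C * ell2_norm I v"
    and x0: "\<And>i j. i \<notin> I \<or> j \<notin> I \<Longrightarrow> x i j = 0"
    using assms unfolding bounded_op_def by blast
  have "\<exists>r. (\<forall>j. coord r j = x i j) \<and> (norm r)\<^sup>2 \<le> C\<^sup>2"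
  proof (rule ex_l2I)
    fix F :: "'a set" assume F: "finite F"
    define u where "u = (\<Sum>j\<in>F. single j (cnj (x i j)))"
    define S where "S = (\<Sum>j\<in>F. (cmod (x i j))\<^sup>2)"
    have nu: "(norm u)\<^sup>2 = S" by (simp add: u_def S_def norm_sum_single_sq[OF F])
    have cu: "coord u j = (if j \<in> F then cnj (x i j) else 0)" for j
      using F by (simp add: u_def coord_single)
    have xj: "x i j = 0" if "j \<notin> I" for j using x0 that by blast
    have u0: "\<forall>j. j \<notin> I \<longrightarrow> coord u j = 0" by (simp add: cu xj)
    note ue = coord_in_ell2[OF u0]
    obtain w where w: "mat_vec I x (coord u) = coord w" "\<forall>i. i \<notin> I \<longrightarrow> coord w i = 0"
      using ell2_ex_coord[OF C(1)[OF ue(1)]] by blast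
    have "mat_vec I x (coord u) i = (\<Sum>j\<in>F. x i j * cnj (x i j))"
      unfolding mat_vec_def
      by (intro infsumI has_sum_finite_neutralI[of "F \<inter> I"])
        (use F xj in \<open>auto simp: cu intro!: sum.mono_neutral_cong_right intro: ccontr\<close>)
    then have "coord w i = complex_of_real S"
      by (simp only: w(1) S_def of_real_sum complex_norm_square)
    then have "\<bar>S\<bar> \<le> norm w" using coord_le_norm[of w i] by (simp only: norm_of_real)
    then have "S \<le> norm w" by simp
    also have "norm w = ell2_norm I (mat_vec I x (coord u))" by (simp add: w coord_in_ell2(2))
    also have "\<dots> \<le> C * norm u" using C(2)[OF ue(1)] by (simp add: ue(2))
    finally have "norm u * norm u \<le> C * norm u" using nu by (simp add: power2_eq_square)
    then have "norm u = 0 \<or> norm u \<le> C" by (auto simp: mult_le_cancel_right)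
    then have "(norm u)\<^sup>2 \<le> C\<^sup>2" by (auto intro: power_mono)
    then show "(\<Sum>j\<in>F. (cmod (x i j))\<^sup>2) \<le> C\<^sup>2" by (simp add: nu S_def)
  qed
  then show ?thesis by blast
qed

lemma coord_mult_summable: "(\<lambda>j. coord r j * coord v j) summable_on A"
proof -
  have "(\<lambda>j. (cmod (coord r j))\<^sup>2 + (cmod (coord v j))\<^sup>2) summable_on UNIV"
    by (intro summable_on_add coord_summable)
  then have "(\<lambda>j. norm (coord r j * coord v j)) summable_on UNIV"
  proof (rule summable_on_comparison_test)
    fix j
    have "2 * (cmod (coord r j) * cmod (coord v j)) \<le> (cmod (coord r j))\<^sup>2 + (cmod (coord v j))\<^sup>2"
      using sum_squares_bound[of "cmod (coord r j)" "cmod (coord v j)"] by simp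
    moreover have "0 \<le> cmod (coord r j) * cmod (coord v j)" by simp
    ultimately show "norm (coord r j * coord v j) \<le> (cmod (coord r j))\<^sup>2 + (cmod (coord v j))\<^sup>2"
      unfolding norm_mult by linarith
  qed simp
  then have "(\<lambda>j. coord r j * coord v j) summable_on UNIV" by (rule abs_summable_summable)
  then show ?thesis by (rule summable_on_subset_banach) simp
qed

lemma bounded_op_ex:
  assumes x: "bounded_op I x"
  shows "\<exists>B. clin B \<and> mat_of B = x \<and> supported I x"
proof -
  obtain C where C: "\<And>v. v \<in> ell2 I \<Longrightarrow> mat_vec I x v \<in> ell2 I"
    "\<And>v. v \<in> ell2 I \<Longrightarrow> ell2_norm I (mat_vec I x v) \<le> C * ell2_norm I v"
    and x0: "\<And>i j. i \<notin> I \<or> j \<notin> I \<Longrightarrow> x i j = 0"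
    using x unfolding bounded_op_def by blast
  obtain r where r: "\<And>i j. coord (r i) j = x i j" using bounded_op_row[OF x] by metis
  have sm: "(\<lambda>j. x i j * coord v j) summable_on A" for i v A
    using coord_mult_summable[of "r i" v A] by (simp add: r)
  have "\<exists>u. (\<forall>i. coord u i = (\<Sum>\<^sub>\<infinity>j\<in>I. x i j * coord v j)) \<and> norm u \<le> \<bar>C\<bar> * norm v" for v
  proof -
    have p0: "\<forall>i. i \<notin> I \<longrightarrow> coord (proj I v) i = 0" by (simp add: coord_proj)
    note pe = coord_in_ell2[OF p0]
    obtain u where u: "mat_vec I x (coord (proj I v)) = coord u" "\<forall>i. i \<notin> I \<longrightarrow> coord u i = 0"
      using ell2_ex_coord[OF C(1)[OF pe(1)]] by blast
    have "coord u i = (\<Sum>\<^sub>\<infinity>j\<in>I. x i j * coord v j)" for i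
      unfolding u(1)[symmetric] mat_vec_def by (rule infsum_cong) (simp add: coord_proj)
    moreover have "norm u \<le> C * norm (proj I v)"
      using C(2)[OF pe(1)] unfolding u(1) pe(2) coord_in_ell2(2)[OF u(2)] .
    then have "norm u \<le> \<bar>C\<bar> * norm (proj I v)"
      by (rule order_trans) (intro mult_right_mono, auto)
    moreover have "norm (proj I v) \<le> norm v"
      using norm_blinfun[of "proj I" v] mult_right_mono[OF norm_proj[of I] norm_ge_zero[of v]] by simp
    then have "\<bar>C\<bar> * norm (proj I v) \<le> \<bar>C\<bar> * norm v" by (intro mult_left_mono) auto
    ultimately show ?thesis by (intro exI[of _ u]) auto
  qed
  then obtain g where g: "\<And>v i. coord (g v) i = (\<Sum>\<^sub>\<infinity>j\<in>I. x i j * coord v j)"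
    "\<And>v. norm (g v) \<le> \<bar>C\<bar> * norm v" by metis
  have bl: "bounded_linear g"
  proof (rule bounded_linear_intro[where K = "\<bar>C\<bar>"])
    show "g (v + w) = g v + g w" for v w
      by (rule l2_eqI) (simp add: g(1) distrib_left infsum_add sm)
    show "g (a *\<^sub>R v) = a *\<^sub>R g v" for a v
    proof (rule l2_eqI)
      fix i
      have "coord (g (a *\<^sub>R v)) i = (\<Sum>\<^sub>\<infinity>j\<in>I. complex_of_real a * (x i j * coord v j))"
        by (simp add: g(1) scaleR_conv_of_real mult_ac)
      also have "\<dots> = coord (a *\<^sub>R g v) i"
        by (simp only: infsum_cmult_right') (simp add: g(1) scaleR_conv_of_real)
      finally show "coord (g (a *\<^sub>R v)) i = coord (a *\<^sub>R g v) i" .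
    qed
    show "norm (g v) \<le> norm v * \<bar>C\<bar>" for v using g(2)[of v] by (simp only: mult.commute)
  qed
  have ap: "blinfun_apply (Blinfun g) = g" by (rule bounded_linear_Blinfun_apply[OF bl])
  have "clin (Blinfun g)"
    unfolding clin_def ap
  proof (intro allI, rule l2_eqI)
    fix c v i
    have "coord (g (cscale c v)) i = (\<Sum>\<^sub>\<infinity>j\<in>I. c * (x i j * coord v j))"
      by (simp add: g(1) mult_ac)
    also have "\<dots> = coord (cscale c (g v)) i"
      by (simp only: infsum_cmult_right') (simp add: g(1))
    finally show "coord (g (cscale c v)) i = coord (cscale c (g v)) i" .
  qed
  moreover have "mat_of (Blinfun g) i j = x i j" for i j
  proof -
    have "((\<lambda>k. x i k * coord (single j 1) k) has_sum x i j) I"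
      by (rule has_sum_finite_neutralI[of "{j} \<inter> I"]) (auto simp: coord_single x0 Int_insert_left)
    then show ?thesis by (simp add: mat_of_def ap g(1) infsumI)
  qed
  ultimately show ?thesis using x0 by (intro exI[of _ "Blinfun g"]) (auto simp: supported_def fun_eq_iff)
qed

lemma mat_of_simps:
  "mat_of (A + B) i j = mat_of A i j + mat_of B i j"
  "mat_of (A - B) i j = mat_of A i j - mat_of B i j"
  "mat_of (r *\<^sub>R A) i j = complex_of_real r * mat_of A i j"
  "mat_of 0 i j = 0"
  by (simp_all add: mat_of_def blinfun.bilinear_simps scaleR_conv_of_real)

lemma mat_diff_mat_of: "mat_diff (mat_of A) (mat_of B) = mat_of (A - B)"
  by (simp add: mat_diff_def fun_eq_iff mat_of_simps)

lemma mat_add_mat_of: "mat_add (mat_of A) (mat_of B) = mat_of (A + B)"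
  by (simp add: mat_add_def fun_eq_iff mat_of_simps)

lemma mat_of_proj_left: "mat_of (proj I o\<^sub>L B) i j = (if i \<in> I then mat_of B i j else 0)"
  by (simp add: mat_of_def coord_proj)

lemma clin_diff: "clin A \<Longrightarrow> clin B \<Longrightarrow> clin (A - B)"
  by (simp add: clin_def blinfun.bilinear_simps l2_eqI algebra_simps)

lemma clin_add: "clin A \<Longrightarrow> clin B \<Longrightarrow> clin (A + B)"
  by (simp add: clin_def blinfun.bilinear_simps l2_eqI algebra_simps)

lemma supported_proj_left:
  assumes "clin B" "supported I (mat_of B)"
  shows "proj I o\<^sub>L B = B"
  by (rule mat_of_inject[OF clin_compose[OF clin_proj assms(1)] assms(1)])
    (use supportedD[OF assms(2)] in \<open>auto simp: mat_of_proj_left\<close>)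

lemma supported_proj_right:
  assumes "clin B" "supported I (mat_of B)"
  shows "B o\<^sub>L proj I = B"
  by (rule mat_of_inject[OF clin_compose[OF assms(1) clin_proj] assms(1)])
    (use supportedD[OF assms(2)] in \<open>auto simp: mat_of_def proj_single blinfun.bilinear_simps\<close>)

lemma supported_compose:
  assumes "clin A" "clin B" "supported I (mat_of A)" "supported I (mat_of B)"
  shows "supported I (mat_of (A o\<^sub>L B))"
  unfolding supported_def
proof (intro allI impI)
  fix i j assume ij: "i \<notin> I \<or> j \<notin> I"
  have "B (single j 1) = 0" if "j \<notin> I"
    by (rule l2_eqI) (use supportedD[OF assms(4)] that in \<open>auto simp: mat_of_def\<close>)
  then show "mat_of (A o\<^sub>L B) i j = 0"
    using ij supported_apply[OF assms(1,3)] by (auto simp: mat_of_def blinfun.bilinear_simps)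
qed

lemma op_norm_mat_of:
  assumes B: "clin B" and I: "supported I (mat_of B)"
  shows "op_norm I (mat_of B) = norm B"
proof -
  define V where "V = {v \<in> ell2 I. ell2_norm I v \<le> 1}"
  have le: "ell2_norm I (mat_vec I (mat_of B) v) \<le> norm B" if v: "v \<in> V" for v
  proof -
    obtain w where w: "v = coord w" "\<forall>i. i \<notin> I \<longrightarrow> coord w i = 0"
      using v ell2_ex_coord unfolding V_def by blast
    have "norm w \<le> 1" using v coord_in_ell2(2)[OF w(2)] by (simp add: V_def w(1))
    have "norm (B w) \<le> norm B * norm w" by (rule norm_blinfun)
    also have "\<dots> \<le> norm B" using \<open>norm w \<le> 1\<close> by (simp add: mult_left_le)
    finally show ?thesis unfolding w(1) mat_vec_mat_of[OF B I]
      using coord_in_ell2(2)[of I "B w"] supported_apply[OF B I] by simp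
  qed
  have bdd: "bdd_above ((\<lambda>v. ell2_norm I (mat_vec I (mat_of B) v)) ` V)"
    by (rule bdd_aboveI[of _ "norm B"]) (use le in auto)
  have V0: "coord 0 \<in> V" using coord_in_ell2[of I 0] by (simp add: V_def)
  have unit: "norm (B w) \<le> op_norm I (mat_of B)" if w: "\<forall>i. i \<notin> I \<longrightarrow> coord w i = 0" "norm w \<le> 1" for w
  proof -
    have "coord w \<in> V" using coord_in_ell2[OF w(1)] w(2) by (simp add: V_def)
    from cSUP_upper[OF this bdd] show ?thesis
      unfolding op_norm_def V_def[symmetric] mat_vec_mat_of[OF B I]
      using coord_in_ell2(2)[of I "B w"] supported_apply[OF B I] by simp
  qed
  have on0: "0 \<le> op_norm I (mat_of B)" using unit[of 0] by simp
  have "norm B \<le> op_norm I (mat_of B)"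
  proof (rule norm_blinfun_bound[OF on0])
    fix v
    define w where "w = proj I v"
    have Bw: "B v = B w"
      unfolding w_def using arg_cong[OF supported_proj_right[OF B I], of "\<lambda>A. blinfun_apply A v"] by simp
    have wv: "norm w \<le> norm v"
      unfolding w_def using norm_blinfun[of "proj I" v] mult_right_mono[OF norm_proj[of I] norm_ge_zero[of v]]
      by simp
    have "norm (B w) \<le> op_norm I (mat_of B) * norm w"
    proof (cases "w = 0")
      case False
      have "norm (B (inverse (norm w) *\<^sub>R w)) \<le> op_norm I (mat_of B)"
        by (rule unit) (use False in \<open>simp_all add: w_def coord_proj\<close>)
      then show ?thesis using False by (simp add: blinfun.bilinear_simps field_simps)
    qed (simp add: blinfun.bilinear_simps)
    also have "\<dots> \<le> op_norm I (mat_of B) * norm v" by (intro mult_left_mono wv on0)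
    finally show "norm (B v) \<le> op_norm I (mat_of B) * norm v" unfolding Bw .
  qed
  moreover have "op_norm I (mat_of B) \<le> norm B"
    unfolding op_norm_def V_def[symmetric] by (rule cSUP_least) (use V0 le in auto)
  ultimately show ?thesis by simp
qed

lemma mat_mul_mat_of:
  assumes "clin A" "supported I (mat_of A)"
  shows "mat_mul I (mat_of A) (mat_of B) = mat_of (A o\<^sub>L B)"
proof (intro ext)
  fix i j
  have "mat_mul I (mat_of A) (mat_of B) i j = mat_vec I (mat_of A) (coord (B (single j 1))) i"
    by (simp add: mat_mul_def mat_vec_def mat_of_def)
  then show "mat_mul I (mat_of A) (mat_of B) i j = mat_of (A o\<^sub>L B) i j"
    by (simp add: mat_vec_mat_of[OF assms]) (simp add: mat_of_def)
qed

lemma mat_adj_mat_of: "clin A \<Longrightarrow> mat_adj (mat_of A) = mat_of (adj A)"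
  by (simp add: mat_adj_def mat_of_def fun_eq_iff coord_clin)

lemma supported_adj: "clin A \<Longrightarrow> supported I (mat_of A) \<Longrightarrow> supported I (mat_of (adj A))"
  by (auto simp: supported_def mat_of_def coord_clin)

lemma mat_of_poly_op_monom:
  assumes A: "clin A" and I: "supported I (mat_of A)"
  shows "mat_pow I (mat_of A) k = mat_of (proj I o\<^sub>L poly_op (monom 1 k) A)"
proof (induction k)
  case 0
  show ?case
    by (auto simp: fun_eq_iff mat_one_def mat_of_def coord_proj coord_single monom_0 blinfun.bilinear_simps)
next
  case (Suc k)
  have "mat_pow I (mat_of A) (Suc k) = mat_of (A o\<^sub>L (proj I o\<^sub>L poly_op (monom 1 k) A))"
    by (simp add: Suc mat_mul_mat_of[OF A I])
  also have "A o\<^sub>L (proj I o\<^sub>L poly_op (monom 1 k) A) = proj I o\<^sub>L poly_op (monom 1 (Suc k)) A"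
  proof (rule blinfun_eqI)
    fix v
    have 1: "A (proj I w) = A w" for w
      using arg_cong[OF supported_proj_right[OF A I], of "\<lambda>A. blinfun_apply A w"] by simp
    have 2: "proj I (A w) = A w" for w
      using arg_cong[OF supported_proj_left[OF A I], of "\<lambda>A. blinfun_apply A w"] by simp
    show "(A o\<^sub>L (proj I o\<^sub>L poly_op (monom 1 k) A)) v = (proj I o\<^sub>L poly_op (monom 1 (Suc k)) A) v"
      by (simp add: 1 2 monom_Suc blinfun.bilinear_simps)
  qed
  finally show ?case .
qed

lemma poly_op_sum: "poly_op (\<Sum>k\<in>K. f k) A = (\<Sum>k\<in>K. poly_op (f k) A)"
  by (induction K rule: infinite_finite_induct) (simp_all add: poly_op_add)

lemma mat_poly_mat_of:
  assumes A: "clin A" and I: "supported I (mat_of A)"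
  shows "mat_poly I q (mat_of A) = mat_of (proj I o\<^sub>L poly_op q A)"
proof (intro ext)
  fix i j
  have mq: "monom (coeff q k) k = smult (coeff q k) (monom 1 k)" for k
    by (simp add: smult_monom)
  have "poly_op q A = (\<Sum>k\<le>degree q. poly_op (monom (coeff q k) k) A)"
    by (simp flip: poly_op_sum add: poly_as_sum_of_monoms)
  also have "\<dots> = (\<Sum>k\<le>degree q. coeff q k *\<^sub>R poly_op (monom 1 k) A)"
    by (simp only: mq poly_op_smult)
  finally have q: "poly_op q A = (\<Sum>k\<le>degree q. coeff q k *\<^sub>R poly_op (monom 1 k) A)" .
  show "mat_poly I q (mat_of A) i j = mat_of (proj I o\<^sub>L poly_op q A) i j"
    unfolding mat_poly_def mat_of_poly_op_monom[OF A I] mat_of_proj_left q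
    by (simp add: mat_of_def blinfun.sum_left blinfun.scaleR_left scaleR_conv_of_real)
qed

lemma adj_fcalc:
  assumes "positive_op A" "continuous_on {0..norm A} f"
  shows "adj (fcalc A f) = fcalc A f"
  by (rule adj_eqI) (rule fcalc_symmetric[OF assms])

lemma supported_fcalc:
  assumes A: "positive_op A" "clin A" "supported I (mat_of A)"
    and f: "continuous_on {0..} f" "f 0 = 0"
  shows "supported I (mat_of (fcalc A f))"
proof -
  have fc: "continuous_on {0..norm A} f" by (rule continuous_on_subset[OF f(1)]) auto
  have col: "mat_of (fcalc A f) i j = 0" if "j \<notin> I" for i j
  proof -
    have "A (single j 1) = 0"
      by (rule l2_eqI) (use supportedD[OF A(3)] that in \<open>auto simp: mat_of_def\<close>)
    from fcalc_kernel[OF A(1) fc this] show ?thesis by (simp add: mat_of_def f(2))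
  qed
  have "mat_of (fcalc A f) i j = cnj (mat_of (fcalc A f) j i)" for i j
    using coord_clin[OF clin_fcalc[OF A(1,2) f(1)], of j i] by (simp add: mat_of_def adj_fcalc[OF A(1) fc])
  then show ?thesis using col unfolding supported_def by (metis complex_cnj_zero)
qed

text \<open>
  A polynomial of the matrix is the projection onto \<open>I\<close> times the polynomial of the operator, as the
  constant terms are multiples of different units. The difference disappears in the limit, because
  \<open>f 0 = 0\<close> makes \<open>f(A)\<close> vanish off \<open>I\<close>.
\<close>

lemma fun_calc_mat_of:
  assumes A: "positive_op A" "clin A" "supported I (mat_of A)"
    and f: "continuous_on {0..} f" "f 0 = 0"
  shows "fun_calc I f (mat_of A) = mat_of (fcalc A f)"
proof -
  let ?f = "fcalc A f"
  note cf = clin_fcalc[OF A(1,2) f(1)]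
  note sf = supported_fcalc[OF A f]
  have fc: "continuous_on {0..norm A} f" by (rule continuous_on_subset[OF f(1)]) auto
  have clinq: "clin (poly_op q A)" for q
    using clin_fcalc[OF A(1,2), of "poly q"] by (simp add: fcalc_poly[OF A(1)] continuous_on_poly)
  have dist: "op_norm I (mat_diff (mat_poly I q (mat_of A)) (mat_of B)) = norm ((proj I o\<^sub>L poly_op q A) - B)"
    if B: "clin B" "supported I (mat_of B)" for q B
  proof -
    let ?Q = "proj I o\<^sub>L poly_op q A"
    have "adj (poly_op q A) = poly_op q A"
      using adj_fcalc[OF A(1), of "poly q"] by (simp add: fcalc_poly[OF A(1)] continuous_on_poly)
    have "A (single j 1) = 0" if "j \<notin> I" for j
      by (rule l2_eqI) (use supportedD[OF A(3)] that in \<open>auto simp: mat_of_def\<close>)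
    then have "supported I (mat_of ?Q)"
      by (auto simp: supported_def mat_of_proj_left) (auto simp: mat_of_def poly_op_kernel coord_single)
    then have "supported I (mat_of (?Q - B))"
      using B(2) by (simp add: supported_def mat_of_simps)
    then show ?thesis
      unfolding mat_poly_mat_of[OF A(2,3)] mat_diff_mat_of
      by (intro op_norm_mat_of clin_diff clin_compose clin_proj clinq B)
  qed
  have lim: "(\<lambda>n. proj I o\<^sub>L poly_op (q n) A) \<longlonglongrightarrow> ?f"
    if "uniform_limit {0..op_norm I (mat_of A)} (\<lambda>n. poly (q n)) f sequentially" for q
  proof -
    have "(\<lambda>n. poly_op (q n) A) \<longlonglongrightarrow> ?f"
      using that unfolding op_norm_mat_of[OF A(2,3)] by (rule fcalc_LIMSEQ[OF A(1)])
    from bounded_bilinear.tendsto[OF bounded_bilinear_blinfun_compose tendsto_const this, of "proj I"]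
    show ?thesis by (simp add: supported_proj_left[OF cf sf])
  qed
  show ?thesis
    unfolding fun_calc_def
  proof (rule the_equality)
    show "bounded_op I (mat_of ?f) \<and>
     (\<forall>q :: nat \<Rightarrow> real poly.
        uniform_limit {0..op_norm I (mat_of A)} (\<lambda>n. poly (q n)) f sequentially \<longrightarrow>
        (\<lambda>n. op_norm I (mat_diff (mat_poly I (q n) (mat_of A)) (mat_of ?f))) \<longlonglongrightarrow> 0)"
      using bounded_op_mat_of[OF cf sf] lim by (simp add: dist[OF cf sf] LIM_zero tendsto_norm_zero)
  next
    fix b
    assume b: "bounded_op I b \<and>
     (\<forall>q :: nat \<Rightarrow> real poly.
        uniform_limit {0..op_norm I (mat_of A)} (\<lambda>n. poly (q n)) f sequentially \<longrightarrow>
        (\<lambda>n. op_norm I (mat_diff (mat_poly I (q n) (mat_of A)) b)) \<longlonglongrightarrow> 0)"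
    then obtain B where B: "clin B" "mat_of B = b" "supported I b" using bounded_op_ex by blast
    obtain q where q: "uniform_limit {0..op_norm I (mat_of A)} (\<lambda>n. poly (q n)) f sequentially"
      using weierstrass_poly[OF fc] unfolding op_norm_mat_of[OF A(2,3)] by blast
    have sB: "supported I (mat_of B)" using B by simp
    from q b have "(\<lambda>n. op_norm I (mat_diff (mat_poly I (q n) (mat_of A)) (mat_of B))) \<longlonglongrightarrow> 0"
      unfolding B(2) by blast
    then have "(\<lambda>n. (proj I o\<^sub>L poly_op (q n) A) - B) \<longlonglongrightarrow> 0"
      unfolding dist[OF B(1) sB] by (rule tendsto_norm_zero_cancel)
    then have "(\<lambda>n. proj I o\<^sub>L poly_op (q n) A) \<longlonglongrightarrow> B" by (rule LIM_zero_cancel)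
    from LIMSEQ_unique[OF this lim[OF q]] have "B = ?f" .
    then show "b = mat_of ?f" using B(2) by simp
  qed
qed

lemma abs_op_powr_mat_of:
  assumes p: "0 < p" and X: "clin X" "supported I (mat_of X)"
  shows "abs_op_powr I (mat_of X) p = mat_of (spow p X)" "supported I (mat_of (spow p X))"
proof -
  let ?C = "abs_sq X"
  note P = positive_abs_sq[of X]
  have cC: "clin ?C" by (rule clin_abs_sq[OF X(1)])
  have sC: "supported I (mat_of ?C)"
    unfolding abs_sq_def by (intro supported_compose clin_adj X supported_adj)
  have sq: "continuous_on S sqrt" for S :: "real set" by (intro continuous_intros)
  have R: "positive_op (fcalc ?C sqrt)" by (rule positive_op_fcalc[OF P sq]) simp
  have "mat_mul I (mat_adj (mat_of X)) (mat_of X) = mat_of ?C"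
    unfolding mat_adj_mat_of[OF X(1)] abs_sq_def by (intro mat_mul_mat_of clin_adj X supported_adj)
  then have ab: "abs_op I (mat_of X) = mat_of (fcalc ?C sqrt)"
    unfolding abs_op_def by (simp add: fun_calc_mat_of[OF P cC sC sq])
  have "fcalc (fcalc ?C sqrt) (\<lambda>t. t powr p) = fcalc ?C (\<lambda>t. sqrt t powr p)"
    by (rule fcalc_compose[OF P sq]) (use p in \<open>auto intro!: continuous_on_powr_nonneg\<close>)
  also have "\<dots> = spow p X"
    unfolding spow_def by (rule fcalc_cong) (simp add: sqrt_powr)
  finally have S: "fcalc (fcalc ?C sqrt) (\<lambda>t. t powr p) = spow p X" .
  have cont: "continuous_on {0..} (\<lambda>t::real. t powr p)" using p by (intro continuous_on_powr_nonneg) auto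
  show "abs_op_powr I (mat_of X) p = mat_of (spow p X)"
    unfolding abs_op_powr_def ab S[symmetric]
    by (rule fun_calc_mat_of[OF R clin_fcalc[OF P cC sq] supported_fcalc[OF P cC sC sq] cont])
      (use p in auto)
  show "supported I (mat_of (spow p X))"
    unfolding spow_def
    by (rule supported_fcalc[OF P cC sC]) (use p in \<open>auto intro!: continuous_on_powr_nonneg\<close>)
qed

lemma mat_of_spow_diag:
  assumes p: "0 < p" and X: "clin X"
  shows "mat_of (spow p X) i i = complex_of_real (diag (spow p X) i)"
proof -
  have pw: "continuous_on {0..norm (abs_sq X)} (\<lambda>t. t powr (p / 2))"
    using p by (intro continuous_on_powr_nonneg) auto
  have "mat_of (spow p X) i i = cnj (mat_of (spow p X) i i)"
    using coord_clin[OF clin_spow[OF X p], of i i]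
    by (simp add: mat_of_def spow_def adj_fcalc[OF positive_abs_sq pw])
  then have "Im (mat_of (spow p X) i i) = 0" by (simp add: complex_eq_iff)
  moreover have "Re (mat_of (spow p X) i i) = diag (spow p X) i"
    by (simp add: mat_of_def diag_def inner_single_left inner_complex_def)
  ultimately show ?thesis by (simp add: complex_eq_iff)
qed

lemma schatten_mat_of:
  assumes p: "0 < p" and X: "clin X" "supported I (mat_of X)"
  shows "mat_of X \<in> schatten I p \<longleftrightarrow> diag (spow p X) summable_on UNIV"
    and "schatten_norm I p (mat_of X) = (infsum (diag (spow p X)) UNIV) powr (1 / p)"
proof -
  note m = abs_op_powr_mat_of[OF p X]
  have 0: "complex_of_real (diag (spow p X) i) = 0" if "i \<notin> I" for i
    using supportedD[OF m(2), of i i] that by (simp add: mat_of_spow_diag[OF p X(1)])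
  have "(\<lambda>i. abs_op_powr I (mat_of X) p i i) summable_on I \<longleftrightarrow>
      (\<lambda>i. complex_of_real (diag (spow p X) i)) summable_on UNIV"
    by (rule summable_on_cong_neutral) (use 0 in \<open>auto simp: m(1) mat_of_spow_diag[OF p X(1)]\<close>)
  moreover have sm: "(\<lambda>i. complex_of_real (diag (spow p X) i)) summable_on UNIV \<longleftrightarrow> diag (spow p X) summable_on UNIV"
    using summable_on_Re[of "\<lambda>i. complex_of_real (diag (spow p X) i)" UNIV]
      summable_on_of_real[of "diag (spow p X)" UNIV] by auto
  ultimately show "mat_of X \<in> schatten I p \<longleftrightarrow> diag (spow p X) summable_on UNIV"
    by (simp add: schatten_def bounded_op_mat_of[OF X])
  have "mat_trace I (abs_op_powr I (mat_of X) p) = (\<Sum>\<^sub>\<infinity>i. complex_of_real (diag (spow p X) i))"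
    unfolding mat_trace_def
    by (rule infsum_cong_neutral) (use 0 in \<open>auto simp: m(1) mat_of_spow_diag[OF p X(1)]\<close>)
  also have "\<dots> = complex_of_real (infsum (diag (spow p X)) UNIV)"
  proof (cases "diag (spow p X) summable_on UNIV")
    case True
    then show ?thesis by (intro infsumI has_sum_of_real has_sum_infsum)
  next
    case False
    then show ?thesis using sm by (simp add: infsum_not_exists)
  qed
  finally show "schatten_norm I p (mat_of X) = (infsum (diag (spow p X)) UNIV) powr (1 / p)"
    by (simp add: schatten_norm_def)
qed

lemma schattenE:
  assumes "x \<in> schatten I p" "0 < p"
  obtains X where "clin X" "mat_of X = x" "supported I (mat_of X)"
    "tr_le (spow p X) (schatten_norm I p x powr p)"
proof -
  obtain X where X: "clin X" "mat_of X = x" "supported I (mat_of X)"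
    using assms(1) bounded_op_ex unfolding schatten_def by blast
  have sm: "diag (spow p X) summable_on UNIV"
    using assms schatten_mat_of(1)[OF assms(2) X(1,3)] by (simp add: X(2))
  have "infsum (diag (spow p X)) UNIV \<ge> 0" by (intro infsum_nonneg diag_spow_nonneg assms)
  then have "schatten_norm I p x powr p = infsum (diag (spow p X)) UNIV"
    using assms schatten_mat_of(2)[OF assms(2) X(1,3)] by (simp add: X(2) powr_powr)
  then have "tr_le (spow p X) (schatten_norm I p x powr p)"
    by (intro tr_leI) (auto intro!: finite_sum_le_infsum sm diag_spow_nonneg assms)
  with X show thesis by (rule that)
qed

lemma schattenI:
  assumes p: "0 < p" and X: "clin X" "supported I (mat_of X)" and c: "tr_le (spow p X) c"
  shows "mat_of X \<in> schatten I p" "schatten_norm I p (mat_of X) \<le> c powr (1 / p)"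
proof -
  have sm: "diag (spow p X) summable_on UNIV" by (rule diag_spow_summable[OF p c])
  then show "mat_of X \<in> schatten I p" by (simp add: schatten_mat_of(1)[OF p X])
  have "infsum (diag (spow p X)) UNIV \<le> c"
    by (rule infsum_le_finite_sums[OF sm]) (rule tr_leD[OF c])
  then show "schatten_norm I p (mat_of X) \<le> c powr (1 / p)"
    unfolding schatten_mat_of(2)[OF p X]
    by (intro powr_mono2 infsum_nonneg diag_spow_nonneg p) (use p in auto)
qed

lemma schatten_norm_nonneg: "0 \<le> schatten_norm I p x"
  by (simp add: schatten_norm_def)

section \<open>Schatten classes of matrices\<close>

lemma entry_le_schatten_norm:
  assumes x: "x \<in> schatten I p" and p: "0 < p"
  shows "cmod (x i j) \<le> schatten_norm I p x"
proof -
  obtain X where X: "clin X" "mat_of X = x" "tr_le (spow p X) (schatten_norm I p x powr p)"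
    using schattenE[OF x p] by metis
  have "cmod (x i j) \<le> norm (X (single j 1))"
    unfolding X(2)[symmetric] mat_of_def by (rule coord_le_norm)
  also have "\<dots> \<le> norm X" using norm_blinfun[of X "single j 1"] by simp
  also have "\<dots> \<le> (schatten_norm I p x powr p) powr (1 / p)" by (rule norm_le_trace_powr[OF p X(1,3)])
  also have "\<dots> = schatten_norm I p x" using p schatten_norm_nonneg[of I p x] by (simp add: powr_powr)
  finally show ?thesis .
qed

lemma schatten_supported: "x \<in> schatten I p \<Longrightarrow> supported I x"
  by (simp add: schatten_def bounded_op_def supported_def)

lemma schatten_add:
  assumes p: "1 < p" and x: "x \<in> schatten I p" and y: "y \<in> schatten I p"
  shows "mat_add x y \<in> schatten I p"
proof -
  have p0: "0 < p" using p by simp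
  obtain X a where X: "clin X" "mat_of X = x" "supported I (mat_of X)" "tr_le (spow p X) a"
    using schattenE[OF x p0] by metis
  obtain Y b where Y: "clin Y" "mat_of Y = y" "supported I (mat_of Y)" "tr_le (spow p Y) b"
    using schattenE[OF y p0] by metis
  have "mat_of (X + Y) \<in> schatten I p"
    by (rule schattenI[OF p0 clin_add[OF X(1) Y(1)] _ trace_powr_add[OF p X(1) Y(1) X(4) Y(4)]])
      (use X(3) Y(3) in \<open>simp add: supported_def mat_of_simps\<close>)
  then show ?thesis by (simp add: X(2) Y(2) flip: mat_add_mat_of)
qed

lemma schatten_scale:
  assumes p: "0 < p" and x: "x \<in> schatten I p"
  shows "mat_scale c x \<in> schatten I p"
proof -
  obtain X a where X: "clin X" "mat_of X = x" "supported I (mat_of X)" "tr_le (spow p X) a"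
    using schattenE[OF x p] by metis
  let ?C = "abs_sq X"
  note P = positive_abs_sq[of X]
  define Y where "Y = Blinfun (cscale c) o\<^sub>L X"
  have Yv: "Y v = cscale c (X v)" for v
    by (simp add: Y_def bounded_linear_Blinfun_apply[OF bounded_linear_cscale])
  have cY: "clin Y"
    unfolding clin_def Yv using X(1) by (auto simp: clin_def intro!: l2_eqI)
  have mY: "mat_of Y = mat_scale c x"
    by (simp add: mat_of_def fun_eq_iff mat_scale_def Yv X(2)[symmetric])
  have id: "continuous_on {0..norm ?C} (\<lambda>t. t)" by (intro continuous_intros)
  have scal: "cscale c v \<bullet> cscale c w = (cmod c)\<^sup>2 * (v \<bullet> w)" for v w :: "'a l2"
  proof -
    have "cnj c * c = complex_of_real ((cmod c)\<^sup>2)"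
      unfolding complex_norm_square by (rule mult.commute)
    then have "cscale (cnj c) (cscale c w) = (cmod c)\<^sup>2 *\<^sub>R w"
      by (intro l2_eqI) (simp only: coord_cscale coord_simps scaleR_conv_of_real mult.assoc[symmetric])
    then show ?thesis by (simp add: cscale_inner)
  qed
  have "abs_sq Y = (cmod c)\<^sup>2 *\<^sub>R ?C"
    by (rule blinfun_eqI, rule l2_inner_eqI) (simp add: abs_sq_form Yv scal blinfun.bilinear_simps)
  also have "\<dots> = fcalc ?C (\<lambda>t. (cmod c)\<^sup>2 * t)"
    by (simp add: fcalc_scale[OF P id] fcalc_ident[OF P])
  finally have "spow p Y = fcalc (fcalc ?C (\<lambda>t. (cmod c)\<^sup>2 * t)) (\<lambda>t. t powr (p / 2))"
    by (simp add: spow_def)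
  also have "\<dots> = fcalc ?C (\<lambda>t. ((cmod c)\<^sup>2 * t) powr (p / 2))"
    by (rule fcalc_compose[OF P]) (use p in \<open>auto intro!: continuous_intros continuous_on_powr_nonneg\<close>)
  also have "\<dots> = fcalc ?C (\<lambda>t. ((cmod c)\<^sup>2) powr (p / 2) * t powr (p / 2))"
    by (rule fcalc_cong) (simp add: powr_mult)
  also have "\<dots> = ((cmod c)\<^sup>2) powr (p / 2) *\<^sub>R spow p X"
    unfolding spow_def by (rule fcalc_scale[OF P]) (use p in \<open>auto intro!: continuous_on_powr_nonneg\<close>)
  finally have Y: "spow p Y = ((cmod c)\<^sup>2) powr (p / 2) *\<^sub>R spow p X" .
  have "tr_le (spow p Y) (((cmod c)\<^sup>2) powr (p / 2) * a)"
    by (rule tr_le_diag_scale[OF X(4)]) (simp_all add: Y diag_scaleR)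
  from schattenI(1)[OF p cY _ this] show ?thesis
    using X(3) by (simp add: mY) (simp add: supported_def mat_scale_def X(2)[symmetric])
qed

lemma bounded_linear_single: "bounded_linear (single i)"
  by (rule bounded_linear_intro[where K = 1]) (simp_all add: single_add single_scaleR)

lemma finitely_supported_ex:
  assumes "finitely_supported x"
  shows "\<exists>B. clin B \<and> mat_of B = x"
proof -
  define S where "S = {(i, j). x i j \<noteq> 0}"
  have S: "finite S" using assms by (simp add: S_def finitely_supported_def)
  define g where "g v = (\<Sum>(i, j)\<in>S. single i (x i j * coord v j))" for v
  have "bounded_linear (\<lambda>v. single i (x i j * coord v j))" for i j
    by (rule bounded_linear_compose[OF bounded_linear_single
          bounded_linear_compose[OF bounded_linear_mult_right bounded_linear_coord]])
  then have bl: "bounded_linear g"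
    unfolding g_def[abs_def] case_prod_unfold by (intro bounded_linear_sum)
  have ap: "blinfun_apply (Blinfun g) = g" by (rule bounded_linear_Blinfun_apply[OF bl])
  have "clin (Blinfun g)"
    unfolding clin_def ap
    by (auto intro!: l2_eqI sum.cong simp: g_def case_prod_unfold coord_single sum_distrib_left)
  moreover have "mat_of (Blinfun g) i j = x i j" for i j
  proof -
    have "mat_of (Blinfun g) i j = (\<Sum>q\<in>S. if q = (i, j) then x i j else 0)"
      unfolding mat_of_def ap g_def case_prod_unfold coord_sum
      by (rule sum.cong) (auto simp: coord_single prod_eq_iff)
    also have "\<dots> = x i j" using S by (auto simp: sum.delta S_def)
    finally show ?thesis .
  qed
  ultimately show ?thesis by (intro exI[of _ "Blinfun g"]) (auto simp: fun_eq_iff)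
qed

lemma finitely_supported_schatten:
  assumes p: "0 < p" and x: "finitely_supported x" "supported I x"
  shows "x \<in> schatten I p"
proof -
  obtain B where B: "clin B" "mat_of B = x" using finitely_supported_ex[OF x(1)] by blast
  let ?F = "snd ` {(i, j). x i j \<noteq> 0}"
  have "finite ?F" using x(1) by (simp add: finitely_supported_def)
  moreover have "B (single j 1) = 0" if "j \<notin> ?F" for j
  proof (rule l2_eqI)
    fix i
    have "x i j = 0" using that by force
    then show "coord (B (single j 1)) i = coord 0 i" using B(2) by (auto simp: mat_of_def)
  qed
  ultimately have "tr_le (spow p B) (card ?F * norm B powr p)" by (rule tr_le_finite_columns[OF p])
  from schattenI(1)[OF p B(1) _ this] show ?thesis using x(2) by (simp add: B(2))
qed

lemma schatten_zero:
  assumes p: "0 < p"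
  shows "(\<lambda>i j. 0) \<in> schatten I p" "schatten_norm I p (\<lambda>i j. 0) = 0"
proof -
  have m: "mat_of (0 :: 'a l2 \<Rightarrow>\<^sub>L 'a l2) = (\<lambda>i j. 0)" by (simp add: fun_eq_iff mat_of_simps)
  have t: "tr_le (spow p (0 :: 'a l2 \<Rightarrow>\<^sub>L 'a l2)) 0"
    using tr_le_finite_columns[OF p, of "{}" "0 :: 'a l2 \<Rightarrow>\<^sub>L 'a l2"] by simp
  have "clin (0 :: 'a l2 \<Rightarrow>\<^sub>L 'a l2)" by (auto simp: clin_def intro: l2_eqI)
  moreover have "supported I (mat_of (0 :: 'a l2 \<Rightarrow>\<^sub>L 'a l2))" by (simp add: m supported_def)
  ultimately show "(\<lambda>i j. 0) \<in> schatten I p" "schatten_norm I p (\<lambda>i j. 0) = 0"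
    using schattenI[OF p _ _ t, of I] schatten_norm_nonneg[of I p "\<lambda>i j. 0"] by (simp_all add: m)
qed

lemma schatten_sum:
  assumes p: "1 < p" and "\<And>k. k \<in> K \<Longrightarrow> f k \<in> schatten I p"
  shows "(\<lambda>i j. \<Sum>k\<in>K. f k i j) \<in> schatten I p"
  using assms(2)
proof (induction K rule: infinite_finite_induct)
  case (insert k K)
  then have "mat_add (f k) (\<lambda>i j. \<Sum>k\<in>K. f k i j) \<in> schatten I p" by (intro schatten_add p) auto
  then show ?case using insert.hyps by (simp add: mat_add_def)
qed (use p in \<open>simp_all add: schatten_zero\<close>)

lemma le_zero_of_small:
  assumes "\<And>d. 0 < d \<Longrightarrow> a \<le> K * d" "0 \<le> (K::real)"
  shows "a \<le> 0"
proof (rule field_le_epsilon)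
  fix e :: real assume e: "0 < e"
  have "a \<le> K * (e / (K + 1))" using assms e by (intro assms(1)) (simp add: add_nonneg_pos)
  also have "\<dots> \<le> e" using assms(2) e by (simp add: field_simps)
  finally show "a \<le> 0 + e" by simp
qed

text \<open>
  Write \<open>x\<close> as a finitely supported matrix plus a small matrix \<open>y\<close>. On the former the two maps agree, and
  the entries of \<open>y\<close> and of \<open>T y\<close> are bounded by a multiple of the norm of \<open>y\<close>.
\<close>

lemma schur_extension_apply:
  assumes T: "schur_extension p m T" and p: "1 < p" and x: "x \<in> schatten UNIV p"
  shows "T x = schur_mul m x"
proof (intro ext)
  fix i j
  have p0: "0 < p" using p by simp
  have T1: "\<And>x. x \<in> schatten UNIV p \<Longrightarrow> T x \<in> schatten UNIV p"
    and T2: "\<And>x y. x \<in> schatten UNIV p \<Longrightarrow> y \<in> schatten UNIV p \<Longrightarrow> T (mat_add x y) = mat_add (T x) (T y)"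
    and T3: "\<And>x. finitely_supported x \<Longrightarrow> T x = schur_mul m x"
    using T unfolding schur_extension_def bounded_linear_map_on_def by auto
  obtain C where C: "\<And>x. x \<in> schatten UNIV p \<Longrightarrow> schatten_norm UNIV p (T x) \<le> C * schatten_norm UNIV p x"
    using T unfolding schur_extension_def bounded_linear_map_on_def by blast
  obtain X a where X: "clin X" "mat_of X = x" "tr_le (spow p X) a"
    using schattenE[OF x p0] by metis
  have "cmod (T x i j - schur_mul m x i j) \<le> (\<bar>C\<bar> + cmod (m i j)) * d" if d: "0 < d" for d
  proof -
    obtain Z F G where Z: "finite F" "finite G" "clin Z" "tr_le (spow p (X - Z)) (d powr p)"
      "\<And>i j. i \<notin> G \<or> j \<notin> F \<Longrightarrow> coord (blinfun_apply Z (single j 1)) i = 0"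
      using finite_matrices_dense[OF p X(1) X(3), of "d powr p"] d by auto
    define z where "z = mat_of Z"
    define y where "y = mat_of (X - Z)"
    have "{(i, j). z i j \<noteq> 0} \<subseteq> G \<times> F" using Z(5) by (auto simp: z_def mat_of_def)
    then have fz: "finitely_supported z"
      unfolding finitely_supported_def by (rule finite_subset) (use Z in simp)
    have zS: "z \<in> schatten UNIV p"
      by (rule finitely_supported_schatten[OF p0 fz]) (simp add: supported_def)
    have y: "y \<in> schatten UNIV p" "schatten_norm UNIV p y \<le> (d powr p) powr (1 / p)"
      unfolding y_def by (rule schattenI[OF p0 clin_diff[OF X(1) Z(3)] _ Z(4)], simp add: supported_def)+
    then have yd: "schatten_norm UNIV p y \<le> d" using p0 d by (simp add: powr_powr)
    have xyz: "x = mat_add y z"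
      by (simp add: y_def z_def mat_add_mat_of X(2))
    have "T x i j - schur_mul m x i j = T y i j - m i j * y i j"
      unfolding xyz T2[OF y(1) zS] T3[OF fz] by (simp add: mat_add_def schur_mul_def algebra_simps)
    then have "cmod (T x i j - schur_mul m x i j) \<le> cmod (T y i j) + cmod (m i j) * cmod (y i j)"
      by (metis norm_mult norm_triangle_ineq4)
    also have "cmod (T y i j) \<le> \<bar>C\<bar> * d"
    proof -
      have "cmod (T y i j) \<le> C * schatten_norm UNIV p y"
        using entry_le_schatten_norm[OF T1[OF y(1)] p0] C[OF y(1)] by (rule order_trans)
      also have "\<dots> \<le> \<bar>C\<bar> * d"
        by (intro mult_mono yd) (auto simp: schatten_norm_nonneg)
      finally show ?thesis .
    qed
    also have "cmod (m i j) * cmod (y i j) \<le> cmod (m i j) * d"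
      by (intro mult_left_mono order_trans[OF entry_le_schatten_norm[OF y(1) p0] yd]) simp
    finally show ?thesis by (simp add: distrib_right)
  qed
  then have "cmod (T x i j - schur_mul m x i j) \<le> 0" by (rule le_zero_of_small) simp_all
  then show "T x i j = schur_mul m x i j" by simp
qed

section \<open>Reindexing rows and columns\<close>

text \<open>
  The operator \<open>V X W\<^sup>*\<close> with the isometries \<open>V\<close> and \<open>W\<close> given by \<open>\<phi>\<close> and \<open>\<psi>\<close>. Its matrix is that of \<open>X\<close>,
  placed in the rows \<open>\<phi> ` I\<close> and the columns \<open>\<psi> ` I\<close>.
\<close>

definition spread :: "'i set \<Rightarrow> ('i \<Rightarrow> 'j) \<Rightarrow> ('i \<Rightarrow> 'j) \<Rightarrow> ('i l2 \<Rightarrow>\<^sub>L 'i l2) \<Rightarrow> ('j l2 \<Rightarrow>\<^sub>L 'j l2)" where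
  "spread I \<phi> \<psi> X = adj (pull I \<phi>) o\<^sub>L (X o\<^sub>L pull I \<psi>)"

lemma pull_single:
  assumes "inj_on \<phi> I"
  shows "pull I \<phi> (single m c) = (if m \<in> \<phi> ` I then single (inv_into I \<phi> m) c else 0)"
proof (rule l2_eqI)
  fix u
  show "coord (pull I \<phi> (single m c)) u =
      coord (if m \<in> \<phi> ` I then single (inv_into I \<phi> m) c else 0) u"
  proof (cases "m \<in> \<phi> ` I")
    case True
    then obtain k where "k \<in> I" "m = \<phi> k" by blast
    then show ?thesis using assms by (auto simp: coord_pull coord_single inj_on_eq_iff)
  next
    case False
    then show ?thesis by (auto simp: coord_pull[OF assms] coord_single)
  qed
qed

lemma coord_adj_pull:
  assumes "inj_on \<phi> I"
  shows "coord (adj (pull I \<phi>) w) m = (if m \<in> \<phi> ` I then coord w (inv_into I \<phi> m) else 0)"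
proof (rule l2_inner_eqI)
  fix c
  have "c \<bullet> coord (adj (pull I \<phi>) w) m = pull I \<phi> (single m c) \<bullet> w"
    by (simp add: adj_right inner_single_left)
  then show "c \<bullet> coord (adj (pull I \<phi>) w) m = c \<bullet> (if m \<in> \<phi> ` I then coord w (inv_into I \<phi> m) else 0)"
    by (simp add: pull_single[OF assms] inner_single_left)
qed

lemma pull_adj_pull:
  assumes "inj_on \<phi> I"
  shows "pull I \<phi> (adj (pull I \<phi>) w) = proj I w"
  by (rule l2_eqI) (simp add: coord_pull[OF assms] coord_adj_pull[OF assms] coord_proj assms)

lemma mat_of_spread:
  assumes "inj_on \<phi> I" "inj_on \<psi> I"
  shows "mat_of (spread I \<phi> \<psi> X) m n =
    (if m \<in> \<phi> ` I \<and> n \<in> \<psi> ` I then mat_of X (inv_into I \<phi> m) (inv_into I \<psi> n) else 0)"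
  by (simp add: mat_of_def spread_def coord_adj_pull[OF assms(1)] pull_single[OF assms(2)] blinfun.bilinear_simps)

lemma clin_spread: "inj_on \<phi> I \<Longrightarrow> inj_on \<psi> I \<Longrightarrow> clin X \<Longrightarrow> clin (spread I \<phi> \<psi> X)"
  unfolding spread_def by (intro clin_compose clin_adj clin_pull)

text \<open>
  Since \<open>|V X W\<^sup>*|\<^sup>2 W = W |X|\<^sup>2\<close>, the isometry \<open>W\<close> also intertwines the powers.
\<close>

lemma diag_spow_spread:
  assumes \<phi>: "inj_on \<phi> I" and \<psi>: "inj_on \<psi> I" and p: "0 < p"
    and X: "clin X" "supported I (mat_of X)"
  shows "v \<in> I \<Longrightarrow> diag (spow p (spread I \<phi> \<psi> X)) (\<psi> v) = diag (spow p X) v"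
    and "n \<notin> \<psi> ` I \<Longrightarrow> diag (spow p (spread I \<phi> \<psi> X)) n = 0"
proof -
  let ?Y = "spread I \<phi> \<psi> X"
  let ?W = "adj (pull I \<psi>)"
  have PX: "proj I (X v) = X v" for v
    using arg_cong[OF supported_proj_left[OF X], of "\<lambda>A. blinfun_apply A v"] by simp
  have XP: "X (proj I v) = X v" for v
    using arg_cong[OF supported_proj_right[OF X], of "\<lambda>A. blinfun_apply A v"] by simp
  have "abs_sq ?Y (?W v) = ?W (abs_sq X v)" for v
  proof (rule l2_inner_eqI)
    fix u
    have "u \<bullet> abs_sq ?Y (?W v) = adj (pull I \<phi>) (X (pull I \<psi> u)) \<bullet> adj (pull I \<phi>) (X v)"
      by (simp add: abs_sq_form spread_def pull_adj_pull[OF \<psi>] XP)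
    also have "\<dots> = X (pull I \<psi> u) \<bullet> pull I \<phi> (adj (pull I \<phi>) (X v))"
      by (simp add: adj_left)
    also have "\<dots> = pull I \<psi> u \<bullet> abs_sq X v"
      by (simp add: pull_adj_pull[OF \<phi>] PX abs_sq_form)
    finally show "u \<bullet> abs_sq ?Y (?W v) = u \<bullet> ?W (abs_sq X v)" by (simp add: adj_right)
  qed
  then have S: "spow p ?Y (?W v) = ?W (spow p X v)" for v
    unfolding spow_def using p
    by (intro fcalc_intertwine positive_abs_sq continuous_on_powr_nonneg) auto
  show "diag (spow p ?Y) (\<psi> v) = diag (spow p X) v" if v: "v \<in> I"
  proof -
    have W: "?W (single v 1) = single (\<psi> v) 1" using v by (simp add: adj_pull_single[OF \<psi>])
    have "diag (spow p ?Y) (\<psi> v) = ?W (single v 1) \<bullet> ?W (spow p X (single v 1))"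
      unfolding diag_def W[symmetric] S ..
    also have "\<dots> = proj I (single v 1) \<bullet> spow p X (single v 1)"
      by (simp add: pull_adj_pull[OF \<psi>] flip: adj_right)
    finally show ?thesis using v by (simp add: proj_single diag_def)
  qed
  show "diag (spow p ?Y) n = 0" if "n \<notin> \<psi> ` I"
    using that by (intro diag_spow_kernel[OF p]) (simp add: spread_def pull_single[OF \<psi>] blinfun.bilinear_simps)
qed

lemma schatten_spread:
  assumes \<phi>: "inj_on \<phi> I" "\<phi> ` I \<subseteq> J" and \<psi>: "inj_on \<psi> I" "\<psi> ` I \<subseteq> J" and p: "0 < p"
    and X: "clin X" "supported I (mat_of X)"
  shows "mat_of (spread I \<phi> \<psi> X) \<in> schatten J p \<longleftrightarrow> mat_of X \<in> schatten I p"
    and "schatten_norm J p (mat_of (spread I \<phi> \<psi> X)) = schatten_norm I p (mat_of X)"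
proof -
  let ?Y = "spread I \<phi> \<psi> X"
  have Y: "clin ?Y" "supported J (mat_of ?Y)"
    using clin_spread[OF \<phi>(1) \<psi>(1) X(1)] \<phi> \<psi> by (auto simp: supported_def mat_of_spread)
  have D: "(diag (spow p ?Y) has_sum S) UNIV \<longleftrightarrow> (diag (spow p X) has_sum S) UNIV" for S
  proof -
    have "(diag (spow p ?Y) has_sum S) UNIV \<longleftrightarrow> (diag (spow p ?Y) has_sum S) (\<psi> ` I)"
      by (rule has_sum_cong_neutral) (auto simp: diag_spow_spread(2)[OF \<phi>(1) \<psi>(1) p X])
    also have "\<dots> \<longleftrightarrow> ((diag (spow p ?Y) \<circ> \<psi>) has_sum S) I"
      by (rule has_sum_reindex[OF \<psi>(1)])
    also have "\<dots> \<longleftrightarrow> (diag (spow p X) has_sum S) UNIV"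
    proof (rule has_sum_cong_neutral)
      fix v assume "v \<in> UNIV - I"
      then have "X (single v 1) = 0"
        by (intro l2_eqI) (use supportedD[OF X(2)] in \<open>auto simp: mat_of_def\<close>)
      then show "diag (spow p X) v = 0" by (rule diag_spow_kernel[OF p])
    qed (auto simp: diag_spow_spread(1)[OF \<phi>(1) \<psi>(1) p X])
    finally show ?thesis .
  qed
  then have "diag (spow p ?Y) summable_on UNIV \<longleftrightarrow> diag (spow p X) summable_on UNIV"
    by (simp add: summable_on_def)
  moreover have "infsum (diag (spow p ?Y)) UNIV = infsum (diag (spow p X)) UNIV"
  proof (cases "diag (spow p X) summable_on UNIV")
    case True
    then have "(diag (spow p ?Y) has_sum infsum (diag (spow p X)) UNIV) UNIV" by (simp add: D)
    then show ?thesis by (rule infsumI)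
  qed (use calculation in \<open>simp add: infsum_not_exists\<close>)
  ultimately show "mat_of ?Y \<in> schatten J p \<longleftrightarrow> mat_of X \<in> schatten I p"
    and "schatten_norm J p (mat_of ?Y) = schatten_norm I p (mat_of X)"
    by (simp_all add: schatten_mat_of[OF p X] schatten_mat_of[OF p Y])
qed

section \<open>Amplification of a Schur multiplier\<close>

definition amp_symbol :: "(int \<Rightarrow> int \<Rightarrow> complex) \<Rightarrow> (nat \<times> int) cmat" where
  "amp_symbol m u v = m (snd u) (snd v)"

text \<open>
  The tensor product of the \<open>(k, l)\<close> matrix unit with \<open>y\<close>.
\<close>

definition block :: "nat \<Rightarrow> nat \<Rightarrow> int cmat \<Rightarrow> (nat \<times> int) cmat" where
  "block k l y u v = (if fst u = k \<and> fst v = l then y (snd u) (snd v) else 0)"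

lemma block_schatten:
  assumes y: "y \<in> schatten UNIV p" and p: "0 < p" and kl: "k < s" "l < s"
  shows "block k l y \<in> schatten (amp_index s) p"
    and "schatten_norm (amp_index s) p (block k l y) = schatten_norm UNIV p y"
proof -
  obtain Y where Y: "clin Y" "mat_of Y = y" "supported UNIV (mat_of Y)"
    using schattenE[OF y p] by metis
  have inj: "inj (Pair a :: int \<Rightarrow> nat \<times> int)" for a by (simp add: inj_on_def)
  have inv: "inv (Pair a) (a, i) = i" for a :: nat and i :: int by (rule inv_f_f[OF inj])
  have "mat_of (spread UNIV (Pair k) (Pair l) Y) = block k l y"
  proof (intro ext)
    fix u v :: "nat \<times> int"
    show "mat_of (spread UNIV (Pair k) (Pair l) Y) u v = block k l y u v"
      unfolding mat_of_spread[OF inj inj]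
      by (cases u; cases v) (auto simp: block_def Y(2) inv)
  qed
  moreover have "range (Pair k) \<subseteq> amp_index s" "range (Pair l) \<subseteq> amp_index s" using kl by auto
  ultimately show "block k l y \<in> schatten (amp_index s) p"
    and "schatten_norm (amp_index s) p (block k l y) = schatten_norm UNIV p y"
    using schatten_spread[OF inj _ inj _ p Y(1,3), of k "amp_index s" l] y by (simp_all add: Y(2))
qed

text \<open>
  There are only \<open>s\<^sup>2\<close> blocks, each of which is a reindexed multiple of \<open>y\<close>, and \<open>S\<^sub>p\<close> is closed under
  addition.
\<close>

lemma tensor_schatten:
  assumes p: "1 < p" and a: "a \<in> schatten {..<s} p" and y: "y \<in> schatten UNIV p"
  shows "mat_tensor a y \<in> schatten (amp_index s) p"
proof -
  have p0: "0 < p" using p by simp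
  have a0: "a k l = 0" if "\<not> (k < s \<and> l < s)" for k l
    using supportedD[OF schatten_supported[OF a], of k l] that by auto
  have "mat_tensor a y = (\<lambda>u v. \<Sum>q\<in>{..<s} \<times> {..<s}.
      mat_scale (a (fst q) (snd q)) (block (fst q) (snd q) y) u v)"
  proof (intro ext)
    fix u v :: "nat \<times> int"
    have "(\<Sum>q\<in>{..<s} \<times> {..<s}. mat_scale (a (fst q) (snd q)) (block (fst q) (snd q) y) u v) =
        (\<Sum>q\<in>{..<s} \<times> {..<s}. if q = (fst u, fst v) then a (fst u) (fst v) * y (snd u) (snd v) else 0)"
      by (rule sum.cong) (auto simp: mat_scale_def block_def)
    also have "\<dots> = a (fst u) (fst v) * y (snd u) (snd v)"
      using a0[of "fst u" "fst v"] by (auto simp: sum.delta)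
    finally show "mat_tensor a y u v = (\<Sum>q\<in>{..<s} \<times> {..<s}.
        mat_scale (a (fst q) (snd q)) (block (fst q) (snd q) y) u v)"
      by (simp add: mat_tensor_def case_prod_unfold)
  qed
  also have "\<dots> \<in> schatten (amp_index s) p"
    by (intro schatten_sum[OF p] schatten_scale[OF p0] block_schatten(1)[OF y p0]) auto
  finally show ?thesis .
qed

lemma alg_tensor_schatten:
  assumes p: "1 < p" and z: "z \<in> alg_tensor (schatten {..<s} p) (schatten UNIV p)"
  shows "z \<in> schatten (amp_index s) p" "z \<in> schatten_tensor s p"
proof -
  have p0: "0 < p" using p by simp
  obtain n a y where z': "z = (\<lambda>u v. \<Sum>r<(n::nat). mat_tensor (a r) (y r) u v)"
    "\<And>r. r < n \<Longrightarrow> a r \<in> schatten {..<s} p \<and> y r \<in> schatten UNIV p"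
    using z unfolding alg_tensor_def by blast
  show zS: "z \<in> schatten (amp_index s) p"
    unfolding z'(1) by (intro schatten_sum[OF p] tensor_schatten[OF p]) (use z'(2) in auto)
  have "mat_diff z z = (\<lambda>u v. 0)" by (simp add: mat_diff_def fun_eq_iff)
  with zS z show "z \<in> schatten_tensor s p"
    by (auto simp: schatten_tensor_def schatten_zero[OF p0] intro!: bexI[of _ z])
qed

lemma tensor_in_alg_tensor:
  assumes "a \<in> A" "y \<in> Y"
  shows "mat_tensor a y \<in> alg_tensor A Y"
  unfolding alg_tensor_def
  using assms by (intro CollectI exI[of _ 1] exI[of _ "\<lambda>_. a"] exI[of _ "\<lambda>_. y"]) (simp add: fun_eq_iff)

lemma schatten_tensor_schatten: "x \<in> schatten_tensor s p \<Longrightarrow> x \<in> schatten (amp_index s) p"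
  by (simp add: schatten_tensor_def)

lemma mat_tensor_schur:
  "schur_mul (amp_symbol m) (mat_tensor a y) = mat_tensor a (schur_mul m y)"
  by (simp add: schur_mul_def amp_symbol_def mat_tensor_def fun_eq_iff)

lemma alg_tensor_schur:
  assumes T: "\<And>y. y \<in> Y \<Longrightarrow> schur_mul m y \<in> Y" and z: "z \<in> alg_tensor A Y"
  shows "schur_mul (amp_symbol m) z \<in> alg_tensor A Y"
proof -
  obtain n a y where z': "z = (\<lambda>u v. \<Sum>r<(n::nat). mat_tensor (a r) (y r) u v)"
    "\<And>r. r < n \<Longrightarrow> a r \<in> A \<and> y r \<in> Y"
    using z unfolding alg_tensor_def by blast
  have "schur_mul (amp_symbol m) z = (\<lambda>u v. \<Sum>r<n. mat_tensor (a r) (schur_mul m (y r)) u v)"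
    unfolding z'(1) mat_tensor_schur[symmetric] by (simp add: schur_mul_def sum_distrib_left fun_eq_iff)
  then show ?thesis
    unfolding alg_tensor_def using z'(2) T
    by (intro CollectI exI[of _ n] exI[of _ a] exI[of _ "\<lambda>r. schur_mul m (y r)"]) simp
qed

text \<open>
  A symbol has the block property at size \<open>s\<close> if its amplification is the compression of the symbol
  itself to a set of rows and a set of columns. Rows and columns may be placed independently of each
  other. Then \<open>x\<close> and \<open>id\<^sub>s \<otimes> M\<^sub>m (x)\<close> sit inside \<open>S\<^sub>p(\<ell>\<^sub>2(\<int>))\<close> with the same norms, padded by zeros, and
  the second arises from the first by \<open>M\<^sub>m\<close>.
\<close>

definition block_property :: "nat \<Rightarrow> (int \<Rightarrow> int \<Rightarrow> complex) \<Rightarrow> bool" where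
  "block_property s m \<longleftrightarrow> (\<exists>\<phi> \<psi>. inj_on \<phi> (amp_index s) \<and> inj_on \<psi> (amp_index s) \<and>
     (\<forall>u\<in>amp_index s. \<forall>v\<in>amp_index s. m (\<phi> u) (\<psi> v) = m (snd u) (snd v)))"

lemma amplified_schur_norm:
  assumes T: "schur_extension p m T" and p: "1 < p" and b: "block_property s m"
    and x: "x \<in> schatten (amp_index s) p"
  shows "schur_mul (amp_symbol m) x \<in> schatten (amp_index s) p"
    and "\<exists>y\<in>schatten UNIV p. schatten_norm UNIV p y = schatten_norm (amp_index s) p x \<and>
      schatten_norm (amp_index s) p (schur_mul (amp_symbol m) x) = schatten_norm UNIV p (T y)"
proof -
  let ?I = "amp_index s"
  have p0: "0 < p" using p by simp
  obtain \<phi> \<psi> where \<phi>: "inj_on \<phi> ?I" and \<psi>: "inj_on \<psi> ?I"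
    and m: "\<And>u v. u \<in> ?I \<Longrightarrow> v \<in> ?I \<Longrightarrow> m (\<phi> u) (\<psi> v) = m (snd u) (snd v)"
    using b unfolding block_property_def by blast
  obtain X where X: "clin X" "mat_of X = x" "supported ?I (mat_of X)"
    using schattenE[OF x p0] by metis
  define y where "y = mat_of (spread ?I \<phi> \<psi> X)"
  have y: "y \<in> schatten UNIV p" "schatten_norm UNIV p y = schatten_norm ?I p x"
    using schatten_spread[OF \<phi> subset_UNIV \<psi> subset_UNIV p0 X(1,3)] x by (simp_all add: y_def X(2))
  have Ty: "T y = schur_mul m y" by (rule schur_extension_apply[OF T p y(1)])
  have TyS: "T y \<in> schatten UNIV p"
    using T y(1) unfolding schur_extension_def bounded_linear_map_on_def by blast
  obtain Z where Z: "clin Z" "mat_of Z = T y" using schattenE[OF TyS p0] by metis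
  define Y where "Y = pull ?I \<phi> o\<^sub>L (Z o\<^sub>L adj (pull ?I \<psi>))"
  have cY: "clin Y" unfolding Y_def by (intro clin_compose clin_adj clin_pull \<phi> \<psi> Z)
  have mY: "mat_of Y u v = schur_mul (amp_symbol m) x u v" for u v
  proof (cases "u \<in> ?I \<and> v \<in> ?I")
    case True
    then have uv: "u \<in> ?I" "v \<in> ?I" by auto
    have "mat_of Y u v = mat_of Z (\<phi> u) (\<psi> v)"
      using uv by (simp add: mat_of_def Y_def coord_pull[OF \<phi>] adj_pull_single[OF \<psi>])
    also have "\<dots> = m (\<phi> u) (\<psi> v) * y (\<phi> u) (\<psi> v)" by (simp add: Z(2) Ty schur_mul_def)
    also have "y (\<phi> u) (\<psi> v) = x u v"
      using uv by (simp add: y_def mat_of_spread[OF \<phi> \<psi>] inv_into_f_f[OF \<phi>] inv_into_f_f[OF \<psi>] X(2))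
    finally show ?thesis using m[OF uv] by (simp add: schur_mul_def amp_symbol_def)
  next
    case False
    then have "mat_of Y u v = 0"
      by (auto simp: mat_of_def Y_def coord_pull[OF \<phi>] adj_pull_single[OF \<psi>] blinfun.bilinear_simps)
    moreover have "x u v = 0" using supportedD[OF X(3), of u v] False by (auto simp: X(2))
    ultimately show ?thesis by (simp add: schur_mul_def)
  qed
  then have mY: "mat_of Y = schur_mul (amp_symbol m) x" by (simp add: fun_eq_iff)
  have sY: "supported ?I (mat_of Y)"
    using X(3) unfolding mY X(2) by (simp add: supported_def schur_mul_def)
  have ZY: "mat_of (spread ?I \<phi> \<psi> Y) = T y"
  proof (intro ext)
    fix i j
    show "mat_of (spread ?I \<phi> \<psi> Y) i j = T y i j"
    proof (cases "i \<in> \<phi> ` ?I \<and> j \<in> \<psi> ` ?I")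
      case True
      then obtain u v where uv: "u \<in> ?I" "v \<in> ?I" "i = \<phi> u" "j = \<psi> v" by blast
      show ?thesis
        unfolding Ty unfolding mat_of_spread[OF \<phi> \<psi>] y_def schur_mul_def uv(3,4)
        using uv(1,2) m[OF uv(1,2)]
        by (simp add: inv_into_f_f[OF \<phi>] inv_into_f_f[OF \<psi>] mY X(2) schur_mul_def amp_symbol_def)
    next
      case False
      then show ?thesis unfolding Ty unfolding mat_of_spread[OF \<phi> \<psi>] y_def schur_mul_def by auto
    qed
  qed
  note S = schatten_spread[OF \<phi> subset_UNIV \<psi> subset_UNIV p0 cY sY, unfolded ZY mY]
  show "schur_mul (amp_symbol m) x \<in> schatten ?I p" using S(1) TyS by simp
  show "\<exists>y\<in>schatten UNIV p. schatten_norm UNIV p y = schatten_norm ?I p x \<and>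
      schatten_norm ?I p (schur_mul (amp_symbol m) x) = schatten_norm UNIV p (T y)"
    using y S(2) by (intro bexI[of _ y]) auto
qed

definition is_amplification ::
  "nat \<Rightarrow> real \<Rightarrow> (int cmat \<Rightarrow> int cmat) \<Rightarrow> ((nat \<times> int) cmat \<Rightarrow> (nat \<times> int) cmat) \<Rightarrow> bool" where
  "is_amplification s p T W \<longleftrightarrow>
     bounded_linear_map_on (schatten_tensor s p) (schatten_norm (amp_index s) p) W \<and>
     (\<forall>a\<in>schatten {..<s} p. \<forall>y\<in>schatten UNIV p. W (mat_tensor a y) = mat_tensor a (T y))"

text \<open>
  The block property gives the bound. The closure of the algebraic tensor product is preserved since
  an approximant \<open>z\<close> of \<open>x\<close> is mapped to an approximant of the image of \<open>x\<close>, with the error controlled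
  by that bound.
\<close>

lemma amplification_exists:
  assumes T: "schur_extension p m T" and p: "1 < p" and b: "block_property s m"
  shows "is_amplification s p T (schur_mul (amp_symbol m))"
proof -
  let ?I = "amp_index s"
  let ?W = "schur_mul (amp_symbol m)"
  have T1: "\<And>y. y \<in> schatten UNIV p \<Longrightarrow> schur_mul m y \<in> schatten UNIV p"
    using T schur_extension_apply[OF T p]
    unfolding schur_extension_def bounded_linear_map_on_def by metis
  obtain C0 where C0: "\<And>x. x \<in> schatten UNIV p \<Longrightarrow> schatten_norm UNIV p (T x) \<le> C0 * schatten_norm UNIV p x"
    using T unfolding schur_extension_def bounded_linear_map_on_def by blast
  define C where "C = \<bar>C0\<bar> + 1"
  have C: "schatten_norm ?I p (?W x) \<le> C * schatten_norm ?I p x" if "x \<in> schatten ?I p" for x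
  proof -
    obtain y where y: "y \<in> schatten UNIV p" "schatten_norm UNIV p y = schatten_norm ?I p x"
      "schatten_norm ?I p (?W x) = schatten_norm UNIV p (T y)"
      using amplified_schur_norm(2)[OF T p b \<open>x \<in> schatten ?I p\<close>] by blast
    have "schatten_norm ?I p (?W x) \<le> C0 * schatten_norm ?I p x" using C0[OF y(1)] by (simp add: y)
    also have "\<dots> \<le> C * schatten_norm ?I p x"
      by (intro mult_right_mono) (auto simp: C_def schatten_norm_nonneg)
    finally show ?thesis .
  qed
  have "?W x \<in> schatten_tensor s p" if x: "x \<in> schatten_tensor s p" for x
    unfolding schatten_tensor_def
  proof (intro CollectI conjI allI impI)
    show "?W x \<in> schatten ?I p" by (rule amplified_schur_norm(1)[OF T p b schatten_tensor_schatten[OF x]])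
    fix e :: real assume e: "0 < e"
    have C1: "0 < C" by (simp add: C_def add_nonneg_pos)
    then have "0 < e / C" using e by simp
    then obtain z where z: "z \<in> alg_tensor (schatten {..<s} p) (schatten UNIV p)"
      "mat_diff x z \<in> schatten ?I p" "schatten_norm ?I p (mat_diff x z) < e / C"
      using x unfolding schatten_tensor_def by blast
    have d: "mat_diff (?W x) (?W z) = ?W (mat_diff x z)"
      by (simp add: mat_diff_def schur_mul_def fun_eq_iff algebra_simps)
    have "schatten_norm ?I p (?W (mat_diff x z)) \<le> C * schatten_norm ?I p (mat_diff x z)"
      by (rule C[OF z(2)])
    also have "\<dots> < C * (e / C)" using z(3) C1 by (intro mult_strict_left_mono)
    also have "\<dots> = e" using C1 by simp
    finally have "schatten_norm ?I p (mat_diff (?W x) (?W z)) < e" by (simp add: d)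
    moreover have "mat_diff (?W x) (?W z) \<in> schatten ?I p"
      unfolding d by (rule amplified_schur_norm(1)[OF T p b z(2)])
    moreover have "?W z \<in> alg_tensor (schatten {..<s} p) (schatten UNIV p)"
      by (rule alg_tensor_schur[OF T1 z(1)])
    ultimately show "\<exists>z\<in>alg_tensor (schatten {..<s} p) (schatten UNIV p).
        mat_diff (?W x) z \<in> schatten ?I p \<and> schatten_norm ?I p (mat_diff (?W x) z) < e" by blast
  qed
  moreover have "?W (mat_add x y) = mat_add (?W x) (?W y)" for x y
    by (simp add: mat_add_def schur_mul_def fun_eq_iff algebra_simps)
  moreover have "?W (mat_scale c x) = mat_scale c (?W x)" for c x
    by (simp add: mat_scale_def schur_mul_def fun_eq_iff)
  ultimately have "bounded_linear_map_on (schatten_tensor s p) (schatten_norm ?I p) ?W"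
    unfolding bounded_linear_map_on_def using C schatten_tensor_schatten by blast
  then show ?thesis by (simp add: is_amplification_def mat_tensor_schur schur_extension_apply[OF T p])
qed

text \<open>
  The map is determined on algebraic tensors by additivity. An element \<open>x\<close> differs from some algebraic
  tensor \<open>z\<close> by a matrix of small norm, which is again in the closure, and the entries of its image are
  small as well.
\<close>

lemma amplification_apply:
  assumes T: "schur_extension p m T" and p: "1 < p"
    and W: "is_amplification s p T W" and x: "x \<in> schatten_tensor s p"
  shows "W x = schur_mul (amp_symbol m) x"
proof (intro ext)
  fix u v
  let ?I = "amp_index s"
  let ?A = "alg_tensor (schatten {..<s} p) (schatten UNIV p)"
  have p0: "0 < p" using p by simp
  have W1: "\<And>x. x \<in> schatten_tensor s p \<Longrightarrow> W x \<in> schatten ?I p"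
    and W2: "\<And>x y. x \<in> schatten_tensor s p \<Longrightarrow> y \<in> schatten_tensor s p \<Longrightarrow> W (mat_add x y) = mat_add (W x) (W y)"
    and W0: "\<And>c x. x \<in> schatten_tensor s p \<Longrightarrow> W (mat_scale c x) = mat_scale c (W x)"
    and W3: "\<And>a y. a \<in> schatten {..<s} p \<Longrightarrow> y \<in> schatten UNIV p \<Longrightarrow> W (mat_tensor a y) = mat_tensor a (T y)"
    using W schatten_tensor_schatten unfolding is_amplification_def bounded_linear_map_on_def by blast+
  obtain C where C: "\<And>x. x \<in> schatten_tensor s p \<Longrightarrow> schatten_norm ?I p (W x) \<le> C * schatten_norm ?I p x"
    using W unfolding is_amplification_def bounded_linear_map_on_def by blast
  have alg: "W z = schur_mul (amp_symbol m) z" if z: "z \<in> ?A" for z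
  proof -
    obtain n a y where z': "z = (\<lambda>u v. \<Sum>r<(n::nat). mat_tensor (a r) (y r) u v)"
      "\<And>r. r < n \<Longrightarrow> a r \<in> schatten {..<s} p \<and> y r \<in> schatten UNIV p"
      using z unfolding alg_tensor_def by blast
    have "W (\<lambda>u v. \<Sum>r<k. mat_tensor (a r) (y r) u v) =
        schur_mul (amp_symbol m) (\<lambda>u v. \<Sum>r<k. mat_tensor (a r) (y r) u v)" if "k \<le> n" for k
      using that
    proof (induction k)
      case 0
      have zero: "(\<lambda>u v. 0) \<in> schatten_tensor s p"
        by (rule alg_tensor_schatten(2)[OF p]) (auto simp: alg_tensor_def intro!: exI[of _ 0])
      have "mat_scale 0 (\<lambda>u v. 0) = (\<lambda>u v. 0)" by (simp add: mat_scale_def)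
      with W0[OF zero, of 0] have "W (\<lambda>u v. 0) = (\<lambda>u v. 0)" by (simp add: mat_scale_def)
      then show ?case by (simp add: schur_mul_def)
    next
      case (Suc k)
      have ay: "a k \<in> schatten {..<s} p" "y k \<in> schatten UNIV p" using z'(2)[of k] Suc.prems by auto
      have 1: "(\<lambda>u v. \<Sum>r<k. mat_tensor (a r) (y r) u v) \<in> schatten_tensor s p"
        by (rule alg_tensor_schatten(2)[OF p]) (use z'(2) Suc.prems in \<open>fastforce simp: alg_tensor_def\<close>)
      have 2: "mat_tensor (a k) (y k) \<in> schatten_tensor s p"
        by (rule alg_tensor_schatten(2)[OF p tensor_in_alg_tensor[OF ay]])
      have "(\<lambda>u v. \<Sum>r<Suc k. mat_tensor (a r) (y r) u v) =
          mat_add (\<lambda>u v. \<Sum>r<k. mat_tensor (a r) (y r) u v) (mat_tensor (a k) (y k))"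
        by (simp add: mat_add_def)
      then have "W (\<lambda>u v. \<Sum>r<Suc k. mat_tensor (a r) (y r) u v) =
          mat_add (schur_mul (amp_symbol m) (\<lambda>u v. \<Sum>r<k. mat_tensor (a r) (y r) u v))
            (schur_mul (amp_symbol m) (mat_tensor (a k) (y k)))"
        using Suc by (simp add: W2[OF 1 2] W3[OF ay] mat_tensor_schur schur_extension_apply[OF T p ay(2)])
      then show ?case by (simp add: mat_add_def schur_mul_def algebra_simps fun_eq_iff)
    qed
    from this[of n] show ?thesis by (simp add: z'(1))
  qed
  have "cmod (W x u v - schur_mul (amp_symbol m) x u v) \<le> (\<bar>C\<bar> + cmod (amp_symbol m u v)) * d"
    if d: "0 < d" for d
  proof -
    obtain z where z: "z \<in> ?A" "mat_diff x z \<in> schatten ?I p" "schatten_norm ?I p (mat_diff x z) < d"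
      using x d unfolding schatten_tensor_def by blast
    define w where "w = mat_diff x z"
    \<comment> \<open>an approximant \<open>q\<close> of \<open>x\<close> yields the approximant \<open>q - z\<close> of \<open>w\<close>, written as a sum of \<open>n + n'\<close> tensors\<close>
    have w: "w \<in> schatten_tensor s p"
      unfolding schatten_tensor_def
    proof (intro CollectI conjI allI impI)
      show "w \<in> schatten ?I p" using z(2) by (simp add: w_def)
      fix e :: real assume "0 < e"
      then obtain q where q: "q \<in> ?A" "mat_diff x q \<in> schatten ?I p" "schatten_norm ?I p (mat_diff x q) < e"
        using x unfolding schatten_tensor_def by blast
      obtain n a y where q': "q = (\<lambda>u v. \<Sum>r<(n::nat). mat_tensor (a r) (y r) u v)"
        "\<And>r. r < n \<Longrightarrow> a r \<in> schatten {..<s} p \<and> y r \<in> schatten UNIV p"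
        using q(1) unfolding alg_tensor_def by blast
      obtain n' a' y' where z': "z = (\<lambda>u v. \<Sum>r<(n'::nat). mat_tensor (a' r) (y' r) u v)"
        "\<And>r. r < n' \<Longrightarrow> a' r \<in> schatten {..<s} p \<and> y' r \<in> schatten UNIV p"
        using z(1) unfolding alg_tensor_def by blast
      define b where "b r = (if r < n then a r else a' (r - n))" for r
      define t where "t r = (if r < n then y r else mat_scale (-1) (y' (r - n)))" for r
      have "mat_diff q z = (\<lambda>u v. \<Sum>r<n + n'. mat_tensor (b r) (t r) u v)"
      proof (intro ext)
        fix u v :: "nat \<times> int"
        have "(\<Sum>r<n + n'. mat_tensor (b r) (t r) u v) =
            (\<Sum>r<n. mat_tensor (b r) (t r) u v) + (\<Sum>r<n'. mat_tensor (b (n + r)) (t (n + r)) u v)"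
          by (induction n') (simp_all add: add.assoc)
        also have "\<dots> = q u v + (\<Sum>r<n'. - mat_tensor (a' r) (y' r) u v)"
          by (simp add: q'(1) b_def t_def mat_tensor_def mat_scale_def case_prod_unfold)
        finally show "mat_diff q z u v = (\<Sum>r<n + n'. mat_tensor (b r) (t r) u v)"
          by (simp add: mat_diff_def z'(1) sum_negf)
      qed
      moreover have "\<forall>r<n + n'. b r \<in> schatten {..<s} p \<and> t r \<in> schatten UNIV p"
        using q'(2) z'(2) by (auto simp: b_def t_def intro!: schatten_scale p0)
      ultimately have "mat_diff q z \<in> ?A" unfolding alg_tensor_def by blast
      moreover have "mat_diff w (mat_diff q z) = mat_diff x q"
        by (simp add: w_def mat_diff_def fun_eq_iff)
      ultimately show "\<exists>z\<in>?A. mat_diff w z \<in> schatten ?I p \<and> schatten_norm ?I p (mat_diff w z) < e"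
        using q(2,3) by (intro bexI[of _ "mat_diff q z"]) simp_all
    qed
    have xw: "x = mat_add w z" by (simp add: w_def mat_add_def mat_diff_def)
    have "W x u v - schur_mul (amp_symbol m) x u v = W w u v - amp_symbol m u v * w u v"
      unfolding xw W2[OF w alg_tensor_schatten(2)[OF p z(1)]] alg[OF z(1)]
      by (simp add: mat_add_def schur_mul_def algebra_simps)
    then have "cmod (W x u v - schur_mul (amp_symbol m) x u v) \<le>
        cmod (W w u v) + cmod (amp_symbol m u v) * cmod (w u v)"
      by (metis norm_mult norm_triangle_ineq4)
    also have "cmod (W w u v) \<le> \<bar>C\<bar> * d"
    proof -
      have "cmod (W w u v) \<le> C * schatten_norm ?I p w"
        using entry_le_schatten_norm[OF W1[OF w] p0] C[OF w] by (rule order_trans)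
      also have "\<dots> \<le> \<bar>C\<bar> * d"
        by (intro mult_mono) (use z(3) in \<open>auto simp: schatten_norm_nonneg w_def\<close>)
      finally show ?thesis .
    qed
    also have "cmod (amp_symbol m u v) * cmod (w u v) \<le> cmod (amp_symbol m u v) * d"
      using entry_le_schatten_norm[OF z(2) p0, of u v] z(3)
      by (intro mult_left_mono) (simp_all add: w_def)
    finally show ?thesis by (simp add: distrib_right)
  qed
  then have "cmod (W x u v - schur_mul (amp_symbol m) x u v) \<le> 0" by (rule le_zero_of_small) simp_all
  then show "W x u v = schur_mul (amp_symbol m) x u v" by simp
qed

text \<open>
  The block property bounds every amplification, and the amplification of size \<open>1\<close> restricts to \<open>T\<close>
  on the isometric copy \<open>e\<^sub>0\<^sub>0 \<otimes> y\<close> of \<open>S\<^sub>p\<close>.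
\<close>

theorem schur_norm_eq_cb_norm:
  assumes p: "1 < p" and b: "\<And>s. block_property s m"
  shows "schur_norm p m = schur_cb_norm p m"
proof (cases "m \<in> schur_multipliers p")
  case True
  define T where "T = schur_map p m"
  have p0: "0 < p" using p by simp
  have T: "schur_extension p m T"
  proof -
    have "\<exists>T. schur_extension p m T" using True by (simp add: schur_multipliers_def)
    then show ?thesis unfolding T_def schur_map_def by (rule someI_ex)
  qed
  define N where "N = map_norm_on (schatten UNIV p) (schatten_norm UNIV p) T"
  define Ns where "Ns s = map_norm_on (schatten_tensor s p) (schatten_norm (amp_index s) p)
      (amplification s p T)" for s
  have W: "is_amplification s p T (amplification s p T)" for s
  proof -
    have "\<exists>W. is_amplification s p T W" using amplification_exists[OF T p b] by blast
    then have "is_amplification s p T (SOME W. is_amplification s p T W)" by (rule someI_ex)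
    moreover have "amplification s p T = (SOME W. is_amplification s p T W)"
      unfolding amplification_def is_amplification_def ..
    ultimately show ?thesis by simp
  qed
  have "Ns s \<le> N" for s
    unfolding Ns_def map_norm_on_def
  proof (rule SUP_least)
    fix x assume "x \<in> {x \<in> schatten_tensor s p. schatten_norm (amp_index s) p x \<le> 1}"
    then have x: "x \<in> schatten_tensor s p" "schatten_norm (amp_index s) p x \<le> 1" by auto
    obtain y where y: "y \<in> schatten UNIV p" "schatten_norm UNIV p y = schatten_norm (amp_index s) p x"
      "schatten_norm (amp_index s) p (schur_mul (amp_symbol m) x) = schatten_norm UNIV p (T y)"
      using amplified_schur_norm(2)[OF T p b schatten_tensor_schatten[OF x(1)]] by blast
    have "ennreal (schatten_norm UNIV p (T y)) \<le> N"
      unfolding N_def map_norm_on_def by (rule SUP_upper) (use y x in simp)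
    then show "ennreal (schatten_norm (amp_index s) p (amplification s p T x)) \<le> N"
      by (simp add: amplification_apply[OF T p W x(1)] y(3))
  qed
  then have "(SUP s\<in>{1..}. Ns s) \<le> N" by (intro SUP_least)
  moreover have "N \<le> Ns 1"
    unfolding N_def map_norm_on_def
  proof (rule SUP_least)
    fix y :: "int cmat" assume "y \<in> {x \<in> schatten UNIV p. schatten_norm UNIV p x \<le> 1}"
    then have y: "y \<in> schatten UNIV p" "schatten_norm UNIV p y \<le> 1" by auto
    have one: "mat_one {..<1} \<in> schatten {..<1::nat} p"
    proof (rule finitely_supported_schatten[OF p0])
      have "{(i, j). mat_one {..<1::nat} i j \<noteq> 0} \<subseteq> {..<1} \<times> {..<1}" by (auto simp: mat_one_def)
      then show "finitely_supported (mat_one {..<1::nat})"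
        unfolding finitely_supported_def by (rule finite_subset) simp
    qed (auto simp: supported_def mat_one_def)
    have t: "mat_tensor (mat_one {..<1}) z = block 0 0 z" for z
      by (auto simp: mat_tensor_def mat_one_def block_def fun_eq_iff)
    have Ty: "T y \<in> schatten UNIV p"
      using T y(1) unfolding schur_extension_def bounded_linear_map_on_def by blast
    have x: "block 0 0 y \<in> schatten_tensor 1 p"
      unfolding t[symmetric] by (rule alg_tensor_schatten(2)[OF p tensor_in_alg_tensor[OF one y(1)]])
    have "amplification 1 p T (block 0 0 y) = block 0 0 (T y)"
      unfolding t[symmetric] using W[of 1] one y(1) unfolding is_amplification_def by blast
    moreover have "ennreal (schatten_norm (amp_index 1) p (amplification 1 p T (block 0 0 y))) \<le> Ns 1"
      unfolding Ns_def map_norm_on_def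
      by (rule SUP_upper) (use x y block_schatten(2)[OF y(1) p0, of 0 1 0] in simp)
    ultimately show "ennreal (schatten_norm UNIV p (T y)) \<le> Ns 1"
      using block_schatten(2)[OF Ty p0, of 0 1 0] by simp
  qed
  then have "N \<le> (SUP s\<in>{1..}. Ns s)" by (rule order_trans) (intro SUP_upper, simp)
  ultimately have "N = (SUP s\<in>{1..}. Ns s)" by (rule order_antisym[rotated])
  then show ?thesis using True by (simp add: schur_norm_def schur_cb_norm_def N_def Ns_def T_def)
qed (simp add: schur_norm_def schur_cb_norm_def)

section \<open>Triangular truncation\<close>

text \<open>
  Spacing consecutive blocks \<open>2 s\<close> apart and shifting the rows by \<open>s\<close> makes a comparison of a row with a
  column depend on the block numbers only: the positions inside blocks contribute
  \<open>s + k - l\<close>, which is positive and less than \<open>2 s\<close>.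
\<close>

lemma triangular_block_property:
  "block_property s (\<lambda>i j. if i - j \<ge> 0 then 1 else 0)"
proof -
  define \<phi> where "\<phi> u = 2 * int s * snd u + (int s + int (fst u))" for u :: "nat \<times> int"
  define \<psi> where "\<psi> u = 2 * int s * snd u + int (fst u)" for u :: "nat \<times> int"
  have gap: "2 * int s * i + a < 2 * int s * j + b" if "i < j" "a - b < 2 * int s" for i j a b
  proof -
    have "2 * int s * 1 \<le> 2 * int s * (j - i)" using that by (intro mult_left_mono) auto
    then show ?thesis using that by (simp add: algebra_simps)
  qed
  have inj: "snd u = snd v" if "2 * int s * snd u + int (fst u) = 2 * int s * snd v + int (fst v)"
    "fst u < s" "fst v < s" for u v :: "nat \<times> int"
    using gap[of "snd u" "snd v" "int (fst u)" "int (fst v)"]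
      gap[of "snd v" "snd u" "int (fst v)" "int (fst u)"] that by (cases "snd u" "snd v" rule: linorder_cases) auto
  have inj_eq: "u = v" if "2 * int s * snd u + int (fst u) = 2 * int s * snd v + int (fst v)"
    "u \<in> amp_index s" "v \<in> amp_index s" for u v :: "nat \<times> int"
  proof (rule prod_eqI)
    show "snd u = snd v" by (rule inj[OF that(1)]) (use that in auto)
    with that(1) show "fst u = fst v" by simp
  qed
  have "inj_on \<phi> (amp_index s)" "inj_on \<psi> (amp_index s)"
    by (rule inj_onI, rule inj_eq; simp add: \<phi>_def \<psi>_def)+
  moreover have "(\<psi> v \<le> \<phi> u) = (snd v \<le> snd u)" if "fst u < s" "fst v < s" for u v
  proof
    assume "snd v \<le> snd u"
    then have "2 * int s * snd v \<le> 2 * int s * snd u" by (intro mult_left_mono) auto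
    moreover have "int (fst v) < int s" "0 \<le> int (fst u)" using that by simp_all
    ultimately show "\<psi> v \<le> \<phi> u" unfolding \<phi>_def \<psi>_def by linarith
  next
    assume le: "\<psi> v \<le> \<phi> u"
    show "snd v \<le> snd u"
    proof (rule ccontr)
      assume "\<not> snd v \<le> snd u"
      then have "\<phi> u < \<psi> v" unfolding \<phi>_def \<psi>_def by (intro gap) (use that in auto)
      with le show False by simp
    qed
  qed
  ultimately show ?thesis unfolding block_property_def by (intro exI[of _ \<phi>] exI[of _ \<psi>]) auto
qed

theorem corollary4p2:
  fixes h :: "int \<Rightarrow> int \<Rightarrow> complex" and p :: real
  assumes h: "h = (\<lambda>i j. if i - j \<ge> 0 then 1 else 0)"
    and p: "1 < p"
  shows "schur_norm p h = schur_cb_norm p h"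
  unfolding h by (rule schur_norm_eq_cb_norm[OF p triangular_block_property])

end
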